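(* Let $X_1,\ldots,X_n$ be random variables having the same distribution function $F$ as a random variable $X$. Suppose that $\mathbb{E}|\min(X,0)|<\infty$ and condition $\mathcal{C}_2(\gamma,a,\rho,A)$ holds with $\rho<0$ (and $\gamma<0$), and let $x^{\star}$ be the finite right endpoint of $F$. Let $k=k_n$ be a sequence of positive integers asymptotically proportional to $n^{\alpha}$ for some $\alpha\in(0,1)$, and assume that $\widehat\gamma_n$ and $\widehat a(n/k)$ are estimators such that \[ \sqrt{k}\left( \widehat{\gamma}_n-\gamma,\ \frac{\widehat{a}(n/k)}{a(n/k)}-1,\ \frac{X_{n-k,n}-U(n/k)}{a(n/k)} \right) \stackrel{d}{\longrightarrow} (\Gamma, \Lambda, B), \] where $(\Gamma,\Lambda,B)$ is a nontrivial trivariate weak limit, and that $\sqrt{k}(\overline{X}_n-\mathbb{E}(X))\stackrel{\mathbb{P}}{\longrightarrow} 0$. Let $p_n$ be asymptotically proportional to $n^{-\beta}$, where $\beta>0$ is such that $\alpha+\beta-1>0$. If moreover $\sqrt{k} A(n/k)\to \lambda\in \mathbb{R}$, then, up to changing probability spaces and with appropriate versions of the estimators involved, \begin{align*} \widetilde{\xi}_{1-p_n}^{\star} - \xi_{1-p_n} &= \frac{a(\frac{n}{k})}{\sqrt{k}}\, \frac{1}{\gamma^2} \left( \Gamma + \gamma^2 B - \gamma \Lambda - \frac{\lambda\gamma}{\gamma+\rho} + o_{\mathbb{P}}(1) \right) \\ &\quad - \left[a\left(\frac{n}{k}\right)\left(\frac{k}{n p_n}\right)^{\gamma}\right]^{\frac{1}{1-\gamma}}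 \frac{(1-\gamma)^{-\frac{1}{1-\gamma}}}{\gamma\, (x^{\star}-\mathbb{E}(X))^{\frac{\gamma}{1-\gamma}} } \left( \frac{\log\big(n p_n^{1/(1-\gamma)}/k\big)}{\sqrt{k}}\, \Gamma +o_{\mathbb{P}}\left( \frac{\log n}{\sqrt{k}} \right) \right) \\ &\quad + O\Big(n^{\beta\gamma/(1-\gamma)} \big( n^{\beta\gamma/(1-\gamma)} + |A( n^{\beta/(1-\gamma)} )| \big)\Big), \end{align*} where $\widetilde{\xi}_{1-p_n}^{\star}$ is the quantile-based extreme expectile estimator defined in the context.
   Context: Notation. $F(x)=\mathbb{P}(X\le x)$, $q_\tau=\inf\{x\in\mathbb{R}: F(x)\ge\tau\}$, $U(s)=q_{1-s^{-1}}$ ($s>1$), $x^\star=\sup\{x:F(x)<1\}$, $\overline X_n=\frac1n\sum_{t=1}^nX_t$, and $X_{1,n}\le\cdots\le X_{n,n}$ are the order statistics. Two sequences $(u_n)$, $(v_n)$ are asymptotically proportional if $u_n/v_n$ tends to a finite positive limit as $n\to\infty$. Expectiles. For $\tau\in(0,1)$, the $\tau$th expectile of $X$ is $\xi_\tau=\arg\min_{\theta\in\mathbb{R}}\mathbb{E}[\eta_\tau(X-\theta)-\eta_\tau(X)]$, where $\eta_\tau(x)=|\tau-\mathbf{1}\{x\le 0\}|\,x^2$. Condition $\mathcal{C}_2(\gamma,a,\rho,A)$: there exist $\gamma<0$, $\rho\le 0$, a positive function $a(\cdot)$ and a measurable function $A(\cdot)$ having constant sign and converging to $0$ at infinity such that,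 for all $z>0$, \[ \lim_{s \to \infty} \frac{1}{A(s)} \left( \frac{U(sz)-U(s)}{a(s)}-\frac{z^{\gamma}-1}{\gamma} \right) = \int_1^z v^{\gamma-1} \left( \int_1^v u^{\rho-1}\, \mathrm{d}u \right) \mathrm{d}v. \] Under this condition $x^\star$ is finite. Estimators. \[ \widehat{q}_{1-p_n}^{\star} = X_{n-k,n} + \widehat{a}(n/k) \frac{(k/(np_n))^{\widehat{\gamma}_n}-1}{\widehat{\gamma}_n}, \qquad \widehat{x}^{\star} = X_{n-k,n} - \frac{\widehat{a}(n/k)}{\widehat{\gamma}_n}, \] \[ \widetilde{\xi}_{1-p_n}^{\star} = \widehat{x}^{\star} - [(\widehat{x}^{\star}-\overline{X}_n)(1-\widehat{\gamma}_n^{-1})]^{-\widehat{\gamma}_n/(1-\widehat{\gamma}_n)} (\widehat{x}^{\star} - \widehat{q}_{1-p_n}^{\star})^{1/(1-\widehat{\gamma}_n)}. \] "Up to changing probability spaces and with appropriate versions of the estimators involved" means: there is a probability space carrying a random vector with the law of $(\Gamma,\Lambda,B)$ and, for each $n$, a copy of $(\widehat\gamma_n,\widehat a(n/k),X_{n-k,n},\overline X_n)$ with the same joint distribution as the original, on which the stated expansion holds for the corresponding version of $\widetilde{\xi}_{1-p_n}^{\star}$. *)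

theory Defs
  imports "HOL-Probability.Probability" "HOL-Library.Landau_Symbols"
begin

definition quantile :: "(real \<Rightarrow> real) \<Rightarrow> real \<Rightarrow> real" where
  "quantile F \<tau> = Inf {x. \<tau> \<le> F x}"

text \<open>Only meant for arguments s > 1.\<close>
definition tail_quantile :: "(real \<Rightarrow> real) \<Rightarrow> real \<Rightarrow> real" where
  "tail_quantile F s = quantile F (1 - 1 / s)"

text \<open>A real supremum; under the condition \<open>second_order_cond\<close> below with U the tail quantile
  function of F, the set is bounded above, so this is the usual finite right endpoint.\<close>
definition right_endpoint :: "(real \<Rightarrow> real) \<Rightarrow> real" where
  "right_endpoint F = Sup {x. F x < 1}"

definition expectile_loss :: "real \<Rightarrow> real \<Rightarrow> real" where
  "expectile_loss \<tau> x = \<bar>\<tau> - of_bool (x \<le> 0)\<bar> * x\<^sup>2"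

definition expectile :: "'a measure \<Rightarrow> ('a \<Rightarrow> real) \<Rightarrow> real \<Rightarrow> real" where
  "expectile M X \<tau> =
     arg_min (\<lambda>\<theta>. \<integral>\<omega>. (expectile_loss \<tau> (X \<omega> - \<theta>) - expectile_loss \<tau> (X \<omega>)) \<partial>M) (\<lambda>_. True)"

text \<open>The condition \<open>\<C>\<^sub>2(\<gamma>, a, \<rho>, A)\<close>. The functions a and A live on the domain s > 1 of U; their
  values elsewhere are unconstrained. The interval integrals are oriented, so that z < 1 is
  covered. A function A that vanishes at arbitrarily large arguments is excluded by the limit
  (division by zero yields zero, whereas the limit is nonzero for \<open>z \<noteq> 1\<close>).\<close>
definition second_order_cond ::
    "(real \<Rightarrow> real) \<Rightarrow> real \<Rightarrow> (real \<Rightarrow> real) \<Rightarrow> real \<Rightarrow> (real \<Rightarrow> real) \<Rightarrow> bool" where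
  "second_order_cond U \<gamma> a \<rho> A \<longleftrightarrow>
     \<gamma> < 0 \<and> \<rho> \<le> 0 \<and>
     (\<forall>s>1. 0 < a s) \<and>
     A \<in> borel_measurable (restrict_space borel {1<..}) \<and>
     ((\<forall>s>1. 0 \<le> A s) \<or> (\<forall>s>1. A s \<le> 0)) \<and>
     (A \<longlongrightarrow> 0) at_top \<and>
     (\<forall>z>0. ((\<lambda>s. 1 / A s * ((U (s * z) - U s) / a s - (z powr \<gamma> - 1) / \<gamma>)) \<longlongrightarrow>
        (LBINT v=1..z. v powr (\<gamma> - 1) * (LBINT u=1..v. u powr (\<rho> - 1)))) at_top)"

definition asymp_proportional :: "(nat \<Rightarrow> real) \<Rightarrow> (nat \<Rightarrow> real) \<Rightarrow> bool" where
  "asymp_proportional u v \<longleftrightarrow> (\<exists>c>0. (\<lambda>n. u n / v n) \<longlonglongrightarrow> c)"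

text \<open>The i-th smallest value among \<open>X 1, \<dots>, X n\<close>, for \<open>1 \<le> i \<le> n\<close>.\<close>
definition order_stat :: "(nat \<Rightarrow> 'a \<Rightarrow> real) \<Rightarrow> nat \<Rightarrow> nat \<Rightarrow> 'a \<Rightarrow> real" where
  "order_stat X i n \<omega> = sort (map (\<lambda>t. X t \<omega>) [1..<Suc n]) ! (i - 1)"

definition sample_mean :: "(nat \<Rightarrow> 'a \<Rightarrow> real) \<Rightarrow> nat \<Rightarrow> 'a \<Rightarrow> real" where
  "sample_mean X n \<omega> = (\<Sum>t=1..n. X t \<omega>) / real n"

text \<open>Convergence in distribution of the random elements \<open>Z n\<close> to the law L.\<close>
definition conv_in_distr ::
    "'a measure \<Rightarrow> (nat \<Rightarrow> 'a \<Rightarrow> 'b::topological_space) \<Rightarrow> 'b measure \<Rightarrow> bool" where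
  "conv_in_distr M Z L \<longleftrightarrow>
     (\<forall>f :: 'b \<Rightarrow> real. continuous_on UNIV f \<longrightarrow> bounded (range f) \<longrightarrow>
        (\<lambda>n. \<integral>\<omega>. f (Z n \<omega>) \<partial>M) \<longlonglongrightarrow> (\<integral>x. f x \<partial>L))"

text \<open>\<open>R n = o\<^sub>P(c n)\<close>; measurability is part of the notion, since \<open>measure\<close> is zero on
  non-measurable sets. Convergence of R to 0 in probability is the case \<open>c = (\<lambda>_. 1)\<close>.\<close>
definition small_o_prob ::
    "'a measure \<Rightarrow> (nat \<Rightarrow> 'a \<Rightarrow> real) \<Rightarrow> (nat \<Rightarrow> real) \<Rightarrow> bool" where
  "small_o_prob M R c \<longleftrightarrow>
     (\<forall>n. R n \<in> borel_measurable M) \<and>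
     (\<forall>\<epsilon>>0. (\<lambda>n. measure M {\<omega> \<in> space M. \<bar>R n \<omega>\<bar> > \<epsilon> * \<bar>c n\<bar>}) \<longlonglongrightarrow> 0)"

text \<open>In the estimators below, g, b, x and m stand for the values of \<open>\<gamma>\<close>-hat, of a-hat at n/k,
  of the order statistic with index n - k, and of the sample mean; r stands for \<open>k / (n p)\<close>.\<close>

definition quantile_est :: "real \<Rightarrow> real \<Rightarrow> real \<Rightarrow> real \<Rightarrow> real" where
  "quantile_est r g b x = x + b * ((r powr g - 1) / g)"

definition endpoint_est :: "real \<Rightarrow> real \<Rightarrow> real \<Rightarrow> real" where
  "endpoint_est g b x = x - b / g"

definition expectile_est :: "real \<Rightarrow> real \<Rightarrow> real \<Rightarrow> real \<Rightarrow> real \<Rightarrow> real" where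
  "expectile_est r g b x m =
     endpoint_est g b x
     - ((endpoint_est g b x - m) * (1 - 1 / g)) powr (- g / (1 - g))
       * (endpoint_est g b x - quantile_est r g b x) powr (1 / (1 - g))"

end

theory Submission
  imports Defs "HOL-Real_Asymp.Real_Asymp"
begin

text \<open>
  Comparing the increments of \<open>U\<close> over \<open>[s, swz]\<close> for two values of \<open>z\<close> turns the second-order
  condition into a linear system which shows that \<open>a\<close> and \<open>A\<close> are regularly varying. Summing
  dyadic increments then gives \<open>x\<^sup>\<star> - U(s) = \<kappa> s\<^sup>\<gamma> (1 + O(A(s)))\<close> and the second-order
  expansion of \<open>(x\<^sup>\<star> - U(s)) / a(s)\<close>. In terms of the excess function \<open>E (X - \<xi>)\<^sub>+\<close>, which is the
  integral of the tail, the expectile is the root of \<open>(1 - 2p) E (X - \<xi>)\<^sub>+ = p (\<xi> - E X)\<close>; so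
  \<open>x\<^sup>\<star> - \<xi>\<close> equals an explicit power \<open>T\<close> of \<open>p\<close> up to the relative error
  \<open>O(|A| + (x\<^sup>\<star> - \<xi>) + p)\<close>.

  The estimation error splits into the error of the endpoint estimator (the term with \<open>a / \<surd>k\<close>), the
  error in estimating \<open>T\<close>, whose logarithm is linear in \<open>\<gamma>\<close>-hat with a slope of order \<open>log n\<close>, and the
  deterministic bias \<open>x\<^sup>\<star> - \<xi> - T\<close>. Both random errors are functions of the standardised errors of
  the estimators, so it remains to realise the convergence in distribution as convergence in
  probability. For this the limit law is coupled with each law of the sequence by a density that is
  concentrated near the diagonal, and the couplings are glued along the limit variable; convergence
  in probability, which suffices, spares the almost sure Skorokhod representation.
\<close>

section \<open>Dyadic increments\<close>

text \<open>The obstacle is uniformity. The second-order condition gives one limit for each fixed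
  ratio \<open>z\<close>, and \<open>a\<close> is not assumed measurable, so no uniform convergence
  theorem applies to it. Along the points \<open>2 ^ j * s\<close> only the ratio 2 occurs, and
  since \<open>a\<close> and \<open>A\<close> shrink there by factors tending to
  \<open>2 powr \<gamma>\<close> and \<open>2 powr \<rho>\<close>, both below 1, increments sum like
  geometric series; monotonicity of \<open>U\<close>, or slow variation of
  \<open>a s * s powr (- \<gamma>)\<close>, then frees the limit from the starting point. Uniformity
  over all larger arguments is required of \<open>A\<close> alone, to bound the error in the tail by
  \<open>A\<close> at a single point, and \<open>A\<close> is measurable. The expectile equation
  involves the tail on the whole interval up to the shortfall, whose size is not known in advance; a
  crude fixed accuracy settles its order before the sharp accuracy is inserted. In the coupling,
  coordinate \<open>Suc n\<close> carries the joint law of the four statistics; the sample mean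
  takes no part in the distance that the coupling makes small, as its error vanishes in probability
  by its law alone.\<close>

lemma eventually_at_top_posE:
  fixes P :: "real \<Rightarrow> bool"
  assumes "\<forall>\<^sub>F s in at_top. P s"
  obtains S where "S > 0" "\<And>s. s \<ge> S \<Longrightarrow> P s"
proof -
  obtain S where "\<And>s. s \<ge> S \<Longrightarrow> P s"
    using assms unfolding eventually_at_top_linorder by blast
  then show ?thesis by (intro that[of "max S 1"]) auto
qed

text \<open>The increments along \<open>2 ^ j * s\<close> telescope and are dominated by a geometric
  series with ratio \<open>r\<close>, whose sum yields the factor
  \<open>1 / (1 - r)\<close>.\<close>

lemma dyadic_limit:
  fixes f g :: "real \<Rightarrow> real"
  assumes "S > 0" "0 \<le> r" "r < 1" "0 \<le> K"
    and step: "\<And>s. s \<ge> S \<Longrightarrow> \<bar>f (2 * s) - f s\<bar> \<le> K * \<bar>g s\<bar>"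
    and decay: "\<And>s. s \<ge> S \<Longrightarrow> \<bar>g (2 * s)\<bar> \<le> r * \<bar>g s\<bar>"
    and "s \<ge> S"
  shows "convergent (\<lambda>j. f (2 ^ j * s))"
    and "(\<lambda>j. f (2 ^ j * s)) \<longlonglongrightarrow> l \<Longrightarrow> \<bar>l - f s\<bar> \<le> K * \<bar>g s\<bar> / (1 - r)"
proof -
  have ge: "2 ^ j * s \<ge> S" for j :: nat
  proof -
    have "1 * s \<le> 2 ^ j * s" using assms by (intro mult_right_mono) auto
    then show ?thesis using \<open>s \<ge> S\<close> by simp
  qed
  have g: "\<bar>g (2 ^ j * s)\<bar> \<le> r ^ j * \<bar>g s\<bar>" for j
  proof (induction j)
    case (Suc j)
    have "\<bar>g (2 ^ Suc j * s)\<bar> \<le> r * \<bar>g (2 ^ j * s)\<bar>"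
      using decay[OF ge[of j]] by (simp add: mult.assoc)
    also have "\<dots> \<le> r * (r ^ j * \<bar>g s\<bar>)" using Suc \<open>0 \<le> r\<close> by (intro mult_left_mono) auto
    finally show ?case by (simp add: mult.assoc)
  qed simp
  have inc: "\<bar>f (2 ^ Suc j * s) - f (2 ^ j * s)\<bar> \<le> K * \<bar>g s\<bar> * r ^ j" for j
  proof -
    have "\<bar>f (2 ^ Suc j * s) - f (2 ^ j * s)\<bar> \<le> K * \<bar>g (2 ^ j * s)\<bar>"
      using step[OF ge[of j]] by (simp add: mult.assoc)
    also have "\<dots> \<le> K * (r ^ j * \<bar>g s\<bar>)" using g \<open>0 \<le> K\<close> by (intro mult_left_mono) auto
    finally show ?thesis by (simp add: mult_ac)
  qed
  have geo: "(\<lambda>j. K * \<bar>g s\<bar> * r ^ j) sums (K * \<bar>g s\<bar> * (1 / (1 - r)))"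
    using assms by (intro sums_mult geometric_sums) auto
  have sm: "summable (\<lambda>j. f (2 ^ Suc j * s) - f (2 ^ j * s))"
    using geo inc by (intro summable_comparison_test[OF _ sums_summable[OF geo]]) auto
  have eq: "f (2 ^ j * s) = f s + (\<Sum>i<j. f (2 ^ Suc i * s) - f (2 ^ i * s))" for j
    using sum_lessThan_telescope[of "\<lambda>i. f (2 ^ i * s)" j] by simp
  have lim: "(\<lambda>j. f (2 ^ j * s)) \<longlonglongrightarrow> f s + (\<Sum>j. f (2 ^ Suc j * s) - f (2 ^ j * s))"
    using tendsto_add[OF tendsto_const summable_LIMSEQ[OF sm], of "f s"] by (simp only: eq[symmetric])
  then show "convergent (\<lambda>j. f (2 ^ j * s))" by (rule convergentI)
  assume "(\<lambda>j. f (2 ^ j * s)) \<longlonglongrightarrow> l"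
  then have l: "l = f s + (\<Sum>j. f (2 ^ Suc j * s) - f (2 ^ j * s))"
    using lim by (rule LIMSEQ_unique)
  have "norm (\<Sum>j. f (2 ^ Suc j * s) - f (2 ^ j * s)) \<le> (\<Sum>j. K * \<bar>g s\<bar> * r ^ j)"
    using inc by (intro norm_suminf_le sums_summable[OF geo]) simp
  then show "\<bar>l - f s\<bar> \<le> K * \<bar>g s\<bar> / (1 - r)"
    using l sums_unique[OF geo] by simp
qed

lemma eventually_ratio_le:
  fixes g :: "real \<Rightarrow> real"
  assumes "((\<lambda>s. g (2 * s) / g s) \<longlongrightarrow> q) at_top" "\<bar>q\<bar> < r" "\<forall>\<^sub>F s in at_top. g s \<noteq> 0"
  shows "\<forall>\<^sub>F s in at_top. \<bar>g (2 * s)\<bar> \<le> r * \<bar>g s\<bar>"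
proof -
  have "\<forall>\<^sub>F s in at_top. \<bar>g (2 * s) / g s\<bar> < r"
    using order_tendstoD(2)[OF tendsto_rabs[OF assms(1)] assms(2)] .
  then show ?thesis
    using assms(3) by eventually_elim (simp add: abs_divide divide_simps split: if_splits)
qed

text \<open>Increments of smaller order than \<open>g\<close> allow \<open>dyadic_limit\<close> to
  be applied with an arbitrarily small constant \<open>K\<close>.\<close>

lemma dyadic_small:
  fixes f g :: "real \<Rightarrow> real"
  assumes f: "((\<lambda>s. (f (2 * s) - f s) / g s) \<longlongrightarrow> 0) at_top"
    and g: "((\<lambda>s. g (2 * s) / g s) \<longlongrightarrow> q) at_top" and q: "\<bar>q\<bar> < 1"
    and nz: "\<forall>\<^sub>F s in at_top. g s \<noteq> 0"
    and l: "\<forall>\<^sub>F s in at_top. (\<lambda>j. f (2 ^ j * s)) \<longlonglongrightarrow> l"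
  shows "((\<lambda>s. (l - f s) / g s) \<longlongrightarrow> 0) at_top"
proof (rule tendstoI)
  fix e :: real assume "e > 0"
  obtain r where r: "\<bar>q\<bar> < r" "r < 1" using q dense by blast
  \<comment> \<open>The geometric sum divides by \<open>1 - r\<close>, so this \<open>K\<close>
    leaves \<open>e / 2\<close>; the strict bound by \<open>e\<close> then follows from
    \<open>g s \<noteq> 0\<close>.\<close>
  define K where "K = e * (1 - r) / 2"
  have K: "K > 0" using \<open>e > 0\<close> r by (simp add: K_def)
  have "\<forall>\<^sub>F s in at_top. \<bar>(f (2 * s) - f s) / g s\<bar> < K"
    using tendstoD[OF f K] by simp
  then have "\<forall>\<^sub>F s in at_top. \<bar>f (2 * s) - f s\<bar> \<le> K * \<bar>g s\<bar>"
    using nz by eventually_elim (simp add: abs_divide divide_simps split: if_splits)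
  with eventually_ratio_le[OF g r(1) nz] nz l
  have "\<forall>\<^sub>F s in at_top. \<bar>f (2 * s) - f s\<bar> \<le> K * \<bar>g s\<bar> \<and> \<bar>g (2 * s)\<bar> \<le> r * \<bar>g s\<bar>
      \<and> g s \<noteq> 0 \<and> (\<lambda>j. f (2 ^ j * s)) \<longlonglongrightarrow> l"
    by eventually_elim simp
  then obtain S where S: "S > 0" "\<And>s. s \<ge> S \<Longrightarrow> \<bar>f (2 * s) - f s\<bar> \<le> K * \<bar>g s\<bar> \<and> \<bar>g (2 * s)\<bar> \<le> r * \<bar>g s\<bar>
      \<and> g s \<noteq> 0 \<and> (\<lambda>j. f (2 ^ j * s)) \<longlonglongrightarrow> l"
    by (rule eventually_at_top_posE) blast
  show "\<forall>\<^sub>F s in at_top. dist ((l - f s) / g s) 0 < e"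
    using eventually_ge_at_top[of S]
  proof eventually_elim
    case (elim s)
    have "\<bar>l - f s\<bar> \<le> K * \<bar>g s\<bar> / (1 - r)"
      using S elim K r by (intro dyadic_limit(2)[of S r K f g s]) auto
    also have "\<dots> = e / 2 * \<bar>g s\<bar>" using r by (simp add: K_def field_simps)
    also have "\<dots> < e * \<bar>g s\<bar>" using S(2)[OF elim] \<open>e > 0\<close> by simp
    finally show ?case using S(2)[OF elim] by (simp add: abs_divide divide_simps)
  qed
qed

text \<open>Adding a multiple of \<open>g\<close> to a function leaves its dyadic limits unchanged;
  the correction terms below rely on this.\<close>

lemma dyadic_null:
  fixes g :: "real \<Rightarrow> real"
  assumes g: "((\<lambda>s. g (2 * s) / g s) \<longlongrightarrow> q) at_top" and q: "\<bar>q\<bar> < 1"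
    and nz: "\<forall>\<^sub>F s in at_top. g s \<noteq> 0"
  shows "\<forall>\<^sub>F s in at_top. (\<lambda>j. g (2 ^ j * s)) \<longlonglongrightarrow> 0"
proof -
  obtain r where r: "\<bar>q\<bar> < r" "r < 1" using q dense by blast
  obtain S where S: "\<And>s. s \<ge> S \<Longrightarrow> \<bar>g (2 * s)\<bar> \<le> r * \<bar>g s\<bar>"
    using eventually_ratio_le[OF g r(1) nz] unfolding eventually_at_top_linorder by blast
  show ?thesis
    using eventually_ge_at_top[of "max S 1"]
  proof eventually_elim
    case (elim s)
    have ge: "2 ^ j * s \<ge> S" for j :: nat
    proof -
      have "1 * s \<le> 2 ^ j * s" using elim by (intro mult_right_mono) auto
      then show ?thesis using elim by linarith
    qed
    have b: "\<bar>g (2 ^ j * s)\<bar> \<le> r ^ j * \<bar>g s\<bar>" for j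
    proof (induction j)
      case (Suc j)
      have "\<bar>g (2 ^ Suc j * s)\<bar> \<le> r * \<bar>g (2 ^ j * s)\<bar>"
        using S[OF ge[of j]] by (simp add: mult.assoc)
      also have "\<dots> \<le> r * (r ^ j * \<bar>g s\<bar>)" using Suc r by (intro mult_left_mono) auto
      finally show ?case by (simp add: mult.assoc)
    qed simp
    have "(\<lambda>j. r ^ j * \<bar>g s\<bar>) \<longlonglongrightarrow> 0 * \<bar>g s\<bar>"
      using r by (intro tendsto_mult tendsto_const LIMSEQ_power_zero) auto
    then show ?case
      by (intro Lim_null_comparison[of "\<lambda>j. g (2 ^ j * s)"]) (use b in auto)
  qed
qed

text \<open>With \<open>c = h / (1 - q)\<close> the function \<open>f + c * g\<close> has increments
  of smaller order than \<open>g\<close>, because \<open>c\<close> solves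
  \<open>h + (q - 1) * c = 0\<close>; \<open>dyadic_small\<close> then applies to it.\<close>

lemma dyadic_ratio:
  fixes f g :: "real \<Rightarrow> real"
  assumes f: "((\<lambda>s. (f (2 * s) - f s) / g s) \<longlongrightarrow> h) at_top"
    and g: "((\<lambda>s. g (2 * s) / g s) \<longlongrightarrow> q) at_top" and q: "\<bar>q\<bar> < 1"
    and nz: "\<forall>\<^sub>F s in at_top. g s \<noteq> 0"
    and l: "\<forall>\<^sub>F s in at_top. (\<lambda>j. f (2 ^ j * s)) \<longlonglongrightarrow> l"
  shows "((\<lambda>s. (l - f s) / g s) \<longlongrightarrow> h / (1 - q)) at_top"
proof -
  define c where "c = h / (1 - q)"
  have c: "h + (q - 1) * c = 0" using q by (simp add: c_def field_simps)
  have "((\<lambda>s. (f (2 * s) - f s) / g s + (g (2 * s) / g s - 1) * c) \<longlongrightarrow> h + (q - 1) * c) at_top"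
    by (intro tendsto_intros f g)
  then have 1: "((\<lambda>s. ((f (2 * s) + c * g (2 * s)) - (f s + c * g s)) / g s) \<longlongrightarrow> 0) at_top"
    unfolding c
    by (rule Lim_transform_eventually) (use nz in eventually_elim, simp add: field_simps)
  have 2: "\<forall>\<^sub>F s in at_top. (\<lambda>j. f (2 ^ j * s) + c * g (2 ^ j * s)) \<longlonglongrightarrow> l"
    using l dyadic_null[OF g q nz]
  proof eventually_elim
    case (elim s)
    have "(\<lambda>j. f (2 ^ j * s) + c * g (2 ^ j * s)) \<longlonglongrightarrow> l + c * 0"
      by (intro tendsto_intros elim)
    then show ?case by simp
  qed
  have "((\<lambda>s. (l - (f s + c * g s)) / g s + c) \<longlongrightarrow> 0 + c) at_top"
    by (intro tendsto_intros dyadic_small[OF 1 g q nz 2])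
  then show ?thesis
    unfolding c_def[symmetric] add_0
    by (rule Lim_transform_eventually) (use nz in eventually_elim, simp add: field_simps)
qed

text \<open>Each starting point has a dyadic limit, which might depend on that point. The assumption
  \<open>slow\<close>, used with the ratio \<open>s / S\<close>, identifies it with the limit
  started at \<open>S\<close>.\<close>

lemma dyadic_bounded:
  fixes f g :: "real \<Rightarrow> real"
  assumes f: "\<forall>\<^sub>F s in at_top. \<bar>f (2 * s) - f s\<bar> \<le> K * \<bar>g s\<bar>" and K: "0 \<le> K"
    and g: "((\<lambda>s. g (2 * s) / g s) \<longlongrightarrow> q) at_top" and q: "\<bar>q\<bar> < 1"
    and nz: "\<forall>\<^sub>F s in at_top. g s \<noteq> 0"
    and slow: "\<And>w. w \<ge> 1 \<Longrightarrow> ((\<lambda>s. f (s * w) - f s) \<longlongrightarrow> 0) at_top"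
  obtains l K' where "\<forall>\<^sub>F s in at_top. \<bar>l - f s\<bar> \<le> K' * \<bar>g s\<bar>"
proof -
  obtain r where r: "\<bar>q\<bar> < r" "r < 1" using q dense by blast
  from f eventually_ratio_le[OF g r(1) nz]
  have "\<forall>\<^sub>F s in at_top. \<bar>f (2 * s) - f s\<bar> \<le> K * \<bar>g s\<bar> \<and> \<bar>g (2 * s)\<bar> \<le> r * \<bar>g s\<bar>"
    by eventually_elim simp
  then obtain S where S: "S > 0" "\<And>s. s \<ge> S \<Longrightarrow> \<bar>f (2 * s) - f s\<bar> \<le> K * \<bar>g s\<bar> \<and> \<bar>g (2 * s)\<bar> \<le> r * \<bar>g s\<bar>"
    by (rule eventually_at_top_posE) blast
  have conv: "convergent (\<lambda>j. f (2 ^ j * s))" if "s \<ge> S" for s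
    using S that r K by (intro dyadic_limit(1)[of S r K f g s]) auto
  define l where "l = lim (\<lambda>j. f (2 ^ j * S))"
  have S_l: "(\<lambda>j. f (2 ^ j * S)) \<longlonglongrightarrow> l"
    unfolding l_def using conv[of S] by (simp add: convergent_LIMSEQ_iff)
  have lim: "(\<lambda>j. f (2 ^ j * s)) \<longlonglongrightarrow> l" if "s \<ge> S" for s
  proof -
    have top: "filterlim (\<lambda>j. 2 ^ j * S) at_top sequentially"
      using S(1) by real_asymp
    have "(\<lambda>j. f (2 ^ j * S * (s / S)) - f (2 ^ j * S)) \<longlonglongrightarrow> 0"
      using that S(1) by (intro filterlim_compose[OF slow top]) auto
    then have "(\<lambda>j. (f (2 ^ j * S * (s / S)) - f (2 ^ j * S)) + f (2 ^ j * S)) \<longlonglongrightarrow> 0 + l"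
      by (intro tendsto_add S_l)
    then show ?thesis using S(1) by simp
  qed
  have "\<bar>l - f s\<bar> \<le> K / (1 - r) * \<bar>g s\<bar>" if "s \<ge> S" for s
    using dyadic_limit(2)[of S r K f g s l] S that r K lim[OF that] by auto
  then show ?thesis
    by (intro that[of l "K / (1 - r)"] eventually_mono[OF eventually_ge_at_top[of S]])
qed

section \<open>Second-order regular variation\<close>

lemma powr_interval_integral:
  assumes "r \<noteq> 0" "v \<ge> 1"
  shows "(LBINT u=1..v. u powr (r - 1)) = (v powr r - 1) / r"
proof -
  have "(LBINT u=ereal 1..ereal v. u powr (r - 1)) = v powr r / r - 1 powr r / r"
  proof (rule interval_integral_FTC_finite)
    show "continuous_on {min 1 v..max 1 v} (\<lambda>u. u powr (r - 1))"
      using assms by (intro continuous_intros) auto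
    fix x assume "min 1 v \<le> x" "x \<le> max 1 v"
    then have "x > 0" using assms by auto
    then have "((\<lambda>u. u powr r / r) has_real_derivative x powr (r - 1)) (at x)"
      using assms by (auto intro!: derivative_eq_intros)
    then show "((\<lambda>u. u powr r / r) has_vector_derivative x powr (r - 1)) (at x within {min 1 v..max 1 v})"
      unfolding has_real_derivative_iff_has_vector_derivative by (rule has_vector_derivative_at_within)
  qed
  then show ?thesis by (simp add: one_ereal_def diff_divide_distrib)
qed

text \<open>Closed form of the double integral in the second-order condition, for nonzero \<gamma>,
  \<rho> and \<open>\<gamma> + \<rho>\<close>.\<close>

definition second_order_limit :: "real \<Rightarrow> real \<Rightarrow> real \<Rightarrow> real" where
  "second_order_limit \<gamma> \<rho> z =
     ((z powr (\<gamma> + \<rho>) - 1) / (\<gamma> + \<rho>) - (z powr \<gamma> - 1) / \<gamma>) / \<rho>"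

lemma second_order_limit_deriv:
  assumes "z > 0" "\<gamma> \<noteq> 0" "\<rho> \<noteq> 0" "\<gamma> + \<rho> \<noteq> 0"
  shows "(second_order_limit \<gamma> \<rho> has_real_derivative z powr (\<gamma> - 1) * ((z powr \<rho> - 1) / \<rho>)) (at z)"
proof -
  have "(second_order_limit \<gamma> \<rho> has_real_derivative (z powr (\<gamma> + \<rho> - 1) - z powr (\<gamma> - 1)) / \<rho>) (at z)"
    unfolding second_order_limit_def using assms by (auto intro!: derivative_eq_intros)
  moreover have "z powr (\<gamma> + \<rho> - 1) = z powr (\<gamma> - 1) * z powr \<rho>"
    by (simp add: powr_add[symmetric] algebra_simps)
  ultimately show ?thesis by (simp add: algebra_simps diff_divide_distrib)
qed

lemma second_order_integral:
  assumes "z \<ge> 1" "\<gamma> \<noteq> 0" "\<rho> \<noteq> 0" "\<gamma> + \<rho> \<noteq> 0"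
  shows "(LBINT v=1..z. v powr (\<gamma> - 1) * (LBINT u=1..v. u powr (\<rho> - 1)))
    = second_order_limit \<gamma> \<rho> z"
proof -
  let ?f = "\<lambda>v. v powr (\<gamma> - 1) * (LBINT u=1..ereal v. u powr (\<rho> - 1))"
  have f: "?f v = v powr (\<gamma> - 1) * ((v powr \<rho> - 1) / \<rho>)" if "v \<ge> 1" for v
    using powr_interval_integral[OF assms(3) that] by simp
  have "(LBINT v=ereal 1..ereal z. ?f v) = second_order_limit \<gamma> \<rho> z - second_order_limit \<gamma> \<rho> 1"
  proof (rule interval_integral_FTC_finite)
    have "continuous_on {min 1 z..max 1 z} (\<lambda>v. v powr (\<gamma> - 1) * ((v powr \<rho> - 1) / \<rho>))"
      using assms by (intro continuous_intros) auto
    then show "continuous_on {min 1 z..max 1 z} ?f"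
      by (rule continuous_on_eq) (use f assms in auto)
    fix x assume x: "min 1 z \<le> x" "x \<le> max 1 z"
    then have "x \<ge> 1" using assms by auto
    show "(second_order_limit \<gamma> \<rho> has_vector_derivative ?f x) (at x within {min 1 z..max 1 z})"
      unfolding f[OF \<open>x \<ge> 1\<close>]
      by (rule has_vector_derivative_at_within[OF second_order_limit_deriv[of x \<gamma> \<rho>,
            unfolded has_real_derivative_iff_has_vector_derivative]]) (use assms \<open>x \<ge> 1\<close> in auto)
  qed
  then show ?thesis by (simp add: one_ereal_def second_order_limit_def)
qed

text \<open>The derivative contains \<open>(x powr \<rho> - 1) / \<rho>\<close>, positive for
  \<open>x > 1\<close>. A nonzero limit is what forces \<open>A\<close> to be nonzero
  eventually.\<close>

lemma second_order_limit_pos: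
  assumes "z > 1" "\<gamma> < 0" "\<rho> < 0"
  shows "second_order_limit \<gamma> \<rho> z > 0"
proof -
  have "second_order_limit \<gamma> \<rho> 1 < second_order_limit \<gamma> \<rho> z"
  proof (rule DERIV_pos_imp_increasing_open[OF assms(1)])
    fix x assume x: "1 < x" "x < z"
    have "x powr \<rho> < 1" using x assms powr_less_mono2_neg[of \<rho> 1 x] by simp
    then have "x powr (\<gamma> - 1) * ((x powr \<rho> - 1) / \<rho>) > 0"
      using x assms by (intro mult_pos_pos divide_neg_neg) auto
    then show "\<exists>y. DERIV (second_order_limit \<gamma> \<rho>) x :> y \<and> 0 < y"
      using second_order_limit_deriv[of x \<gamma> \<rho>] x assms by fastforce
  next
    show "continuous_on {1..z} (second_order_limit \<gamma> \<rho>)"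
      unfolding second_order_limit_def using assms by (intro continuous_intros) auto
  qed
  then show ?thesis by (simp add: second_order_limit_def)
qed

text \<open>Cramer's rule for a system whose \<open>h\<close> coefficients move with
  \<open>s\<close>: only the limiting determinant must not vanish. The constant \<open>e1\<close> is
  divided by when \<open>x\<close> is recovered from \<open>y\<close>.\<close>

lemma tendsto_linear_system:
  fixes x y :: "'b \<Rightarrow> real"
  assumes 1: "\<forall>\<^sub>F s in F. x s * e1 + y s * h1 s = r1 s"
    and 2: "\<forall>\<^sub>F s in F. x s * e2 + y s * h2 s = r2 s"
    and h: "(h1 \<longlongrightarrow> H1) F" "(h2 \<longlongrightarrow> H2) F"
    and r: "(r1 \<longlongrightarrow> X * e1 + Y * H1) F" "(r2 \<longlongrightarrow> X * e2 + Y * H2) F"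
    and det: "e1 * H2 - e2 * H1 \<noteq> 0" and "e1 \<noteq> 0"
  shows "(x \<longlongrightarrow> X) F" "(y \<longlongrightarrow> Y) F"
proof -
  let ?d = "\<lambda>s. e1 * h2 s - e2 * h1 s"
  have d: "(?d \<longlongrightarrow> e1 * H2 - e2 * H1) F" by (intro tendsto_intros h)
  have nz: "\<forall>\<^sub>F s in F. ?d s \<noteq> 0" using tendsto_imp_eventually_ne[OF d det] .
  have "((\<lambda>s. (e1 * r2 s - e2 * r1 s) / ?d s) \<longlongrightarrow>
      (e1 * (X * e2 + Y * H2) - e2 * (X * e1 + Y * H1)) / (e1 * H2 - e2 * H1)) F"
    by (intro tendsto_intros h r det)
  moreover have "(e1 * (X * e2 + Y * H2) - e2 * (X * e1 + Y * H1)) / (e1 * H2 - e2 * H1) = Y"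
    using det by (simp add: field_simps)
  ultimately have "((\<lambda>s. (e1 * r2 s - e2 * r1 s) / ?d s) \<longlongrightarrow> Y) F" by simp
  then show y: "(y \<longlongrightarrow> Y) F"
  proof (rule Lim_transform_eventually)
    show "\<forall>\<^sub>F s in F. (e1 * r2 s - e2 * r1 s) / ?d s = y s"
      using 1 2 nz
    proof eventually_elim
      case (elim s)
      have "e1 * r2 s - e2 * r1 s = y s * ?d s"
        unfolding elim(1,2)[symmetric] by (simp add: algebra_simps)
      then show ?case using elim(3) by simp
    qed
  qed
  have "((\<lambda>s. (r1 s - y s * h1 s) / e1) \<longlongrightarrow> (X * e1 + Y * H1 - Y * H1) / e1) F"
    by (intro tendsto_intros h r y assms)
  then have "((\<lambda>s. (r1 s - y s * h1 s) / e1) \<longlongrightarrow> X) F" using \<open>e1 \<noteq> 0\<close> by simp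
  then show "(x \<longlongrightarrow> X) F"
  proof (rule Lim_transform_eventually)
    show "\<forall>\<^sub>F s in F. (r1 s - y s * h1 s) / e1 = x s"
      using 1 by eventually_elim (use \<open>e1 \<noteq> 0\<close> in \<open>simp add: field_simps\<close>)
  qed
qed

text \<open>Of the tail quantile function only monotonicity is retained; it lets limits along dyadic
  points determine limits at infinity.\<close>

locale second_order_mono =
  fixes U a A :: "real \<Rightarrow> real" and \<gamma> \<rho> :: real
  assumes mono: "1 < s \<Longrightarrow> s \<le> t \<Longrightarrow> U s \<le> U t"
    and second_order: "second_order_cond U \<gamma> a \<rho> A"
    and rho_neg: "\<rho> < 0"
begin

lemma gamma_neg: "\<gamma> < 0" and a_pos: "s > 1 \<Longrightarrow> a s > 0" and A_null: "(A \<longlongrightarrow> 0) at_top"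
  and A_meas: "A \<in> borel_measurable (restrict_space borel {1<..})"
  and so_limit: "z > 0 \<Longrightarrow> ((\<lambda>s. 1 / A s * ((U (s * z) - U s) / a s - (z powr \<gamma> - 1) / \<gamma>)) \<longlongrightarrow>
        (LBINT v=1..z. v powr (\<gamma> - 1) * (LBINT u=1..v. u powr (\<rho> - 1)))) at_top"
  using second_order unfolding second_order_cond_def by fast+

abbreviation "h \<equiv> second_order_limit \<gamma> \<rho>"
abbreviation "E \<equiv> \<lambda>z::real. (z powr \<gamma> - 1) / \<gamma>"

text \<open>The normalised quotient of the second-order condition, kept as a function of
  \<open>s\<close> so that increments of \<open>U\<close> can be handled by exact
  identities.\<close>

definition hs :: "real \<Rightarrow> real \<Rightarrow> real" where
  "hs z s = 1 / A s * ((U (s * z) - U s) / a s - E z)"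

lemma hs_tendsto: "z \<ge> 1 \<Longrightarrow> (hs z \<longlongrightarrow> h z) at_top"
  using so_limit[of z] second_order_integral[of z \<gamma> \<rho>] gamma_neg rho_neg
  unfolding hs_def by (simp only: less_le_trans[OF zero_less_one])

text \<open>Division by zero gives \<open>hs 2 s = 0\<close> wherever \<open>A s = 0\<close>, while
  \<open>hs 2\<close> tends to the positive number \<open>h 2\<close>.\<close>

lemma A_nz: "\<forall>\<^sub>F s in at_top. A s \<noteq> 0"
proof -
  have "h 2 \<noteq> 0" using second_order_limit_pos[of 2 \<gamma> \<rho>] gamma_neg rho_neg by simp
  from tendsto_imp_eventually_ne[OF hs_tendsto this]
  show ?thesis by (auto simp: hs_def elim!: eventually_mono)
qed

lemma increment_eq: "s > 1 \<Longrightarrow> A s \<noteq> 0 \<Longrightarrow> U (s * z) - U s = a s * (E z + A s * hs z s)"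
  using a_pos[of s] by (simp add: hs_def field_simps)

lemma scale_top: "w > 0 \<Longrightarrow> filterlim (\<lambda>s::real. s * w) at_top at_top"
  by real_asymp

text \<open>The identity \<open>U(swz) - U(s) = (U(swz) - U(sw)) + (U(sw) - U(s))\<close> for \<open>z = 2\<close> and \<open>z = 4\<close> is a
  linear system for the relative error of \<open>a(sw) / a(s)\<close> and for \<open>A(sw) / A(s)\<close>.\<close>
lemma scaling:
  assumes "w \<ge> 1"
  shows "((\<lambda>s. (a (s * w) / a s - w powr \<gamma>) / A s) \<longlongrightarrow> w powr \<gamma> * (w powr \<rho> - 1) / \<rho>) at_top"
    and "((\<lambda>s. a (s * w) / a s * (A (s * w) / A s)) \<longlongrightarrow> w powr (\<gamma> + \<rho>)) at_top"
proof -
  let ?x = "\<lambda>s. (a (s * w) / a s - w powr \<gamma>) / A s"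
  let ?y = "\<lambda>s. a (s * w) / a s * (A (s * w) / A s)"
  let ?X = "w powr \<gamma> * (w powr \<rho> - 1) / \<rho>" and ?Y = "w powr (\<gamma> + \<rho>)"
  have top: "filterlim (\<lambda>s. s * w) at_top at_top" using assms by (intro scale_top) auto
  have nzw: "\<forall>\<^sub>F s in at_top. A (s * w) \<noteq> 0"
    using A_nz top by (rule eventually_compose_filterlim)
  have eq: "\<forall>\<^sub>F s in at_top. ?x s * E z + ?y s * hs z (s * w) = hs (w * z) s - hs w s" for z
    using A_nz nzw eventually_gt_at_top[of 1]
  proof eventually_elim
    case (elim s)
    have sw: "s * w > 1" using elim assms less_le_trans[of 1 s "s * w"] by simp
    have "U (s * (w * z)) - U s = (U (s * w * z) - U (s * w)) + (U (s * w) - U s)"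
      by (simp add: mult.assoc)
    then have "a s * (E (w * z) + A s * hs (w * z) s)
        = a (s * w) * (E z + A (s * w) * hs z (s * w)) + a s * (E w + A s * hs w s)"
      using elim sw by (simp add: increment_eq)
    then have "E (w * z) + A s * hs (w * z) s
        = a (s * w) / a s * (E z + A (s * w) * hs z (s * w)) + (E w + A s * hs w s)"
      using a_pos[of s] elim by (simp add: field_simps)
    \<comment> \<open>This cocycle identity cancels the first-order terms, so that each remaining
      term is of the order of \<open>A s\<close>.\<close>
    moreover have "E (w * z) = E w + w powr \<gamma> * E z"
      using gamma_neg by (simp add: powr_mult divide_simps) (simp add: algebra_simps)
    ultimately have "A s * (hs (w * z) s - hs w s) =
        (a (s * w) / a s - w powr \<gamma>) * E z + a (s * w) / a s * A (s * w) * hs z (s * w)"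
      by (simp add: algebra_simps)
    then have "hs (w * z) s - hs w s =
        ((a (s * w) / a s - w powr \<gamma>) * E z + a (s * w) / a s * A (s * w) * hs z (s * w)) / A s"
      using elim by (simp add: field_simps)
    then show ?case by (simp add: add_divide_distrib)
  qed
  have lim: "((\<lambda>s. hs (w * z) s - hs w s) \<longlongrightarrow> ?X * E z + ?Y * h z) at_top" if "z \<ge> 1" for z
  proof -
    have "w * z \<ge> 1" using assms that mult_mono[of 1 w 1 z] by simp
    then have "((\<lambda>s. hs (w * z) s - hs w s) \<longlongrightarrow> h (w * z) - h w) at_top"
      using assms by (intro tendsto_intros hs_tendsto)
    moreover have "h (w * z) - h w = ?X * E z + ?Y * h z"
      using gamma_neg rho_neg assms that
      by (simp add: second_order_limit_def powr_mult powr_add divide_simps) (simp add: algebra_simps)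
    ultimately show ?thesis by simp
  qed
  have hl: "((\<lambda>s. hs z (s * w)) \<longlongrightarrow> h z) at_top" if "z \<ge> 1" for z
    using filterlim_compose[OF hs_tendsto[OF that] top] .
  have p1: "(2::real) powr \<gamma> < 1" using gamma_neg powr_less_mono[of \<gamma> 0 "2::real"] by simp
  have p2: "(2::real) powr \<rho> < 1" using rho_neg powr_less_mono[of \<rho> 0 "2::real"] by simp
  have 4: "(4::real) powr c = (2 powr c)\<^sup>2" for c
  proof -
    have "(4::real) = 2 * 2" by simp
    then have "(4::real) powr c = (2 * 2) powr c" by (rule arg_cong)
    also have "\<dots> = 2 powr c * 2 powr c" by (rule powr_mult)
    finally show ?thesis by (simp only: power2_eq_square)
  qed
  define u v where "u = (2::real) powr \<gamma>" and "v = (2::real) powr (\<gamma> + \<rho>)"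
  have uv: "v = u * 2 powr \<rho>" by (simp add: u_def v_def powr_add)
  have u: "0 < u" "u < 1" using p1 by (simp_all add: u_def)
  then have v: "v < u" using p2 by (simp add: uv)
  \<comment> \<open>As 4 is the square of 2, the determinant is rational in \<open>u\<close> and
    \<open>v\<close> and factors; \<open>v < u < 1\<close> keeps every factor away from 0.\<close>
  have det: "E 2 * h 4 - E 4 * h 2 = (u - 1) * (v - 1) * (v - u) / (\<gamma> * (\<gamma> + \<rho>) * \<rho>)"
    using gamma_neg rho_neg
    by (simp add: second_order_limit_def 4 u_def[symmetric] v_def[symmetric] divide_simps power2_eq_square)
      (simp add: algebra_simps)
  have det': "E 2 * h 4 - E 4 * h 2 \<noteq> 0"
    unfolding det using u v gamma_neg rho_neg by simp
  have E2: "E 2 \<noteq> 0" using p1 gamma_neg by simp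
  show "(?x \<longlongrightarrow> ?X) at_top" "(?y \<longlongrightarrow> ?Y) at_top"
    using tendsto_linear_system[OF eq[of 2] eq[of 4] hl[of 2] hl[of 4] lim[of 2] lim[of 4] det' E2]
    by simp_all
qed

text \<open>The first limit in \<open>scaling\<close> bounds the deviation by a multiple of
  \<open>A\<close>, which tends to 0.\<close>

lemma a_ratio: "w \<ge> 1 \<Longrightarrow> ((\<lambda>s. a (s * w) / a s) \<longlongrightarrow> w powr \<gamma>) at_top"
proof -
  assume w: "w \<ge> 1"
  have "((\<lambda>s. (a (s * w) / a s - w powr \<gamma>) / A s * A s + w powr \<gamma>) \<longlongrightarrow>
      w powr \<gamma> * (w powr \<rho> - 1) / \<rho> * 0 + w powr \<gamma>) at_top"
    by (intro tendsto_intros scaling w A_null)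
  then show ?thesis
    unfolding mult_zero_right add_0
    by (rule Lim_transform_eventually) (use A_nz in eventually_elim, simp)
qed

lemma A_ratio: "w \<ge> 1 \<Longrightarrow> ((\<lambda>s. A (s * w) / A s) \<longlongrightarrow> w powr \<rho>) at_top"
proof -
  assume w: "w \<ge> 1"
  have "((\<lambda>s. a (s * w) / a s * (A (s * w) / A s) / (a (s * w) / a s)) \<longlongrightarrow>
      w powr (\<gamma> + \<rho>) / w powr \<gamma>) at_top"
    using w by (intro tendsto_intros scaling a_ratio) auto
  moreover have "w powr (\<gamma> + \<rho>) / w powr \<gamma> = w powr \<rho>" using w by (simp add: powr_add)
  ultimately have *: "((\<lambda>s. a (s * w) / a s * (A (s * w) / A s) / (a (s * w) / a s)) \<longlongrightarrow> w powr \<rho>) at_top"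
    by simp
  show ?thesis
  proof (rule Lim_transform_eventually[OF *])
    show "\<forall>\<^sub>F s in at_top. a (s * w) / a s * (A (s * w) / A s) / (a (s * w) / a s) = A (s * w) / A s"
      using eventually_gt_at_top[of 1]
    proof eventually_elim
      case (elim s)
      have "s * w > 1" using elim w less_le_trans[of 1 s "s * w"] by simp
      then show ?case using a_pos[of s] a_pos[of "s * w"] elim by simp
    qed
  qed
qed

end

section \<open>Uniform bounds for regularly varying functions\<close>

text \<open>The argument of Csiszar and Erdos: a shifted and an unshifted set of nearly full measure
  meet.\<close>
lemma regularly_varying_bounded:
  fixes f :: "real \<Rightarrow> real"
  assumes meas[measurable]: "f \<in> borel_measurable borel"
    and ratio: "\<And>w. w \<ge> 1 \<Longrightarrow> ((\<lambda>s. f (s * w) / f s) \<longlongrightarrow> w powr r) at_top"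
    and r: "r \<le> 0" and nz: "\<forall>\<^sub>F s in at_top. f s \<noteq> 0"
  obtains M S where "\<And>s z. s \<ge> S \<Longrightarrow> 1 \<le> z \<Longrightarrow> z \<le> 2 \<Longrightarrow> \<bar>f (s * z)\<bar> \<le> M * \<bar>f s\<bar>"
proof (rule ccontr)
  assume "\<not> thesis"
  \<comment> \<open>Negating the claim for the threshold \<open>real m + 1\<close> and the constant
    \<open>real m\<close> gives counterexamples that escape to infinity with unbounded
    quotients.\<close>
  then have ex: "\<exists>s z. s \<ge> real m + 1 \<and> 1 \<le> z \<and> z \<le> 2 \<and> \<bar>f (s * z)\<bar> > real m * \<bar>f s\<bar>" for m
    using that[of "real m + 1" "real m"] by (meson not_le)
  obtain s z where sz: "\<And>m::nat. s m \<ge> real m + 1" "\<And>m. 1 \<le> z m" "\<And>m. z m \<le> 2"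
      "\<And>m. \<bar>f (s m * z m)\<bar> > real m * \<bar>f (s m)\<bar>"
    using ex by metis
  have s_top: "filterlim s at_top sequentially"
  proof (rule filterlim_at_top_mono[OF filterlim_real_sequentially], intro always_eventually allI)
    fix m show "real m \<le> s m" using sz(1)[of m] by linarith
  qed
  have sz_top: "filterlim (\<lambda>m. s m * z m) at_top sequentially"
  proof (rule filterlim_at_top_mono[OF s_top], intro always_eventually allI)
    fix m
    have "s m * 1 \<le> s m * z m" using sz(1)[of m] sz(2)[of m] by (intro mult_left_mono) auto
    then show "s m \<le> s m * z m" by simp
  qed
  have nzs: "\<forall>\<^sub>F m in sequentially. f (s m) \<noteq> 0" and nzsz: "\<forall>\<^sub>F m in sequentially. f (s m * z m) \<noteq> 0"
    using eventually_compose_filterlim[OF nz s_top] eventually_compose_filterlim[OF nz sz_top] by auto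
  \<comment> \<open>Since \<open>r \<le> 0\<close>, \<open>2 powr r\<close> is the minimum of
    \<open>w powr r\<close> on [1, 2]; half of it is eventually a lower bound for the ratio at each
    such \<open>w\<close>.\<close>
  define c where "c = 2 powr r / 2"
  have c: "c > 0" by (simp add: c_def)
  \<comment> \<open>Pointwise convergence becomes a statement on measures: both families of sets
    increase to their whole intervals. \<open>E\<close> covers [1, 4] because it has to meet
    \<open>G\<close> dilated by some \<open>z m \<le> 2\<close>.\<close>
  define E where "E n = {w \<in> {1..4}. \<forall>m\<in>{n..}. \<bar>f (s m * w)\<bar> \<le> 2 * \<bar>f (s m)\<bar>}" for n
  define G where "G n = {v \<in> {1..2}. \<forall>m\<in>{n..}. c * \<bar>f (s m * z m)\<bar> \<le> \<bar>f (s m * z m * v)\<bar>}" for n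
  have Em: "E n \<in> sets borel" for n unfolding E_def by measurable
  have Gm: "G n \<in> sets borel" for n unfolding G_def by measurable
  have "incseq E" by (intro incseq_SucI) (auto simp: E_def)
  have "incseq G" by (intro incseq_SucI) (auto simp: G_def)
  have UE: "(\<Union>n. E n) = {1..4}"
  proof (intro equalityI subsetI)
    fix w :: real assume w: "w \<in> {1..4}"
    have "((\<lambda>m. f (s m * w) / f (s m)) \<longlongrightarrow> w powr r) sequentially"
      using w by (intro filterlim_compose[OF ratio s_top]) auto
    moreover have "\<bar>w powr r\<bar> < 2" using w r powr_mono[of r 0 w] by simp
    ultimately have "\<forall>\<^sub>F m in sequentially. \<bar>f (s m * w) / f (s m)\<bar> < 2"
      by (intro order_tendstoD(2)[OF tendsto_rabs])
    then have "\<forall>\<^sub>F m in sequentially. \<bar>f (s m * w)\<bar> \<le> 2 * \<bar>f (s m)\<bar>"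
      using nzs by eventually_elim (simp add: abs_divide divide_simps split: if_splits)
    then show "w \<in> (\<Union>n. E n)" using w by (auto simp: E_def eventually_sequentially)
  qed (auto simp: E_def)
  have UG: "(\<Union>n. G n) = {1..2}"
  proof (intro equalityI subsetI)
    fix w :: real assume w: "w \<in> {1..2}"
    have "((\<lambda>m. f (s m * z m * w) / f (s m * z m)) \<longlongrightarrow> w powr r) sequentially"
      using w by (intro filterlim_compose[OF ratio sz_top]) auto
    moreover have "c < \<bar>w powr r\<bar>"
    proof -
      have "2 powr r \<le> w powr r" using w r by (intro powr_mono2') auto
      moreover have "(2::real) powr r > 0" by simp
      ultimately show ?thesis unfolding c_def by linarith
    qed
    ultimately have "\<forall>\<^sub>F m in sequentially. c < \<bar>f (s m * z m * w) / f (s m * z m)\<bar>"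
      by (intro order_tendstoD(1)[OF tendsto_rabs])
    then have "\<forall>\<^sub>F m in sequentially. c * \<bar>f (s m * z m)\<bar> \<le> \<bar>f (s m * z m * w)\<bar>"
      using nzsz by eventually_elim (simp add: abs_divide divide_simps split: if_splits)
    then show "w \<in> (\<Union>n. G n)" using w by (auto simp: G_def eventually_sequentially)
  qed (auto simp: G_def)
  have "(\<lambda>n. emeasure lborel (E n)) \<longlonglongrightarrow> emeasure lborel {1..4::real}"
    using Lim_emeasure_incseq[of E lborel] \<open>incseq E\<close> Em by (auto simp: UE)
  then have E3: "(\<lambda>n. emeasure lborel (E n)) \<longlonglongrightarrow> ennreal 3" by simp
  have "(\<lambda>n. emeasure lborel (G n)) \<longlonglongrightarrow> emeasure lborel {1..2::real}"
    using Lim_emeasure_incseq[of G lborel] \<open>incseq G\<close> Gm by (auto simp: UG)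
  then have G1: "(\<lambda>n. emeasure lborel (G n)) \<longlonglongrightarrow> ennreal 1" by simp
  have "\<forall>\<^sub>F n in sequentially. emeasure lborel (E n) > ennreal (5/2)"
    by (rule order_tendstoD(1)[OF E3]) (simp add: ennreal_less_iff)
  moreover have "\<forall>\<^sub>F n in sequentially. emeasure lborel (G n) > ennreal (1/2)"
    by (rule order_tendstoD(1)[OF G1], rule ennreal_lessI) simp_all
  ultimately have "\<forall>\<^sub>F n in sequentially. real n > 2 / c \<and> f (s n) \<noteq> 0 \<and> 
      emeasure lborel (E n) > ennreal (5/2) \<and> emeasure lborel (G n) > ennreal (1/2)"
    using nzs eventually_gt_at_top[of "nat \<lceil>2 / c\<rceil>"]
  proof eventually_elim
    case (elim n)
    have "real n > 2 / c" using elim(4) by linarith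
    with elim show ?case by blast
  qed
  then obtain n where n: "real n > 2 / c" "f (s n) \<noteq> 0" "emeasure lborel (E n) > ennreal (5/2)"
      "emeasure lborel (G n) > ennreal (1/2)"
    using eventually_happens'[OF sequentially_bot] by blast
  \<comment> \<open>\<open>B\<close> is \<open>G n\<close> dilated by \<open>z n \<ge> 1\<close>, so
    its measure still exceeds 1/2. Together with more than 5/2 for \<open>E n\<close> this exceeds
    3, the length of the interval [1, 4] that contains both; hence they meet.\<close>
  define B where "B = {w. w / z n \<in> G n}"
  have zn: "z n > 0" using sz(2)[of n] by simp
  have Bm: "B \<in> sets borel" using Gm[of n] unfolding B_def by measurable
  have "emeasure lborel B = emeasure (density (distr lborel borel ((*) (z n))) (\<lambda>_. ennreal \<bar>z n\<bar>)) B"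
    by (subst lborel_distr_mult'[of "z n"]) (use zn in auto)
  also have "\<dots> = ennreal (z n) * emeasure lborel ((*) (z n) -` B)"
    using Bm zn by (simp add: emeasure_density emeasure_distr nn_integral_cmult)
  also have "(*) (z n) -` B = G n" using zn by (auto simp: B_def)
  finally have eB: "emeasure lborel B = ennreal (z n) * emeasure lborel (G n)" .
  have "1 * emeasure lborel (G n) \<le> ennreal (z n) * emeasure lborel (G n)"
    using sz(2)[of n] by (intro mult_right_mono) auto
  then have B2: "emeasure lborel B > ennreal (1/2)" using n(4) eB by simp
  have Bsub: "B \<subseteq> {1..4}"
  proof
    fix w assume "w \<in> B"
    then have "1 \<le> w / z n" "w / z n \<le> 2" by (auto simp: B_def G_def)
    then have "z n \<le> w" "w \<le> 2 * z n" using zn by (simp_all add: field_simps)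
    then show "w \<in> {1..4}" using sz(2,3)[of n] by auto
  qed
  have "E n \<inter> B \<noteq> {}"
  proof
    assume disj: "E n \<inter> B = {}"
    have "emeasure lborel (E n) + emeasure lborel B = emeasure lborel (E n \<union> B)"
      using Em Bm disj by (intro plus_emeasure) auto
    also have "\<dots> \<le> emeasure lborel {1..4::real}"
      using Bsub by (intro emeasure_mono) (auto simp: E_def)
    also have "\<dots> = ennreal (5/2) + ennreal (1/2)" by (subst ennreal_plus[symmetric]) simp_all
    also have "\<dots> < emeasure lborel (E n) + emeasure lborel B" using n(3) B2 by (intro add_strict_mono)
    finally show False by simp
  qed
  then obtain w where w: "w \<in> E n" "w \<in> B" by blast
  \<comment> \<open>At a common point \<open>f\<close> is compared with \<open>f (s n)\<close>
    through \<open>E n\<close> and with \<open>f (s n * z n)\<close> through \<open>G n\<close>. The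
    resulting constant \<open>2 / c\<close> is below \<open>real n\<close>, against the choice of
    the counterexample.\<close>
  have "c * \<bar>f (s n * z n)\<bar> \<le> \<bar>f (s n * z n * (w / z n))\<bar>"
    using w(2) unfolding B_def G_def by blast
  also have "s n * z n * (w / z n) = s n * w" using zn by simp
  also have "\<bar>f (s n * w)\<bar> \<le> 2 * \<bar>f (s n)\<bar>" using w(1) unfolding E_def by blast
  finally have "\<bar>f (s n * z n)\<bar> \<le> 2 / c * \<bar>f (s n)\<bar>" using c by (simp add: field_simps)
  also have "\<dots> \<le> real n * \<bar>f (s n)\<bar>" using n by (intro mult_right_mono) auto
  finally show False using sz(4)[of n] by simp
qed

text \<open>Doubling \<open>s\<close> eventually does not increase \<open>\<bar>f s\<bar>\<close>,
  since \<open>2 powr r < 1\<close>. Trading a factor 2 of \<open>z\<close> for one of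
  \<open>s\<close> therefore costs no constant, and the bound on [1, 2] persists for all
  \<open>z \<ge> 1\<close>.\<close>

lemma regularly_varying_bounded_all:
  fixes f :: "real \<Rightarrow> real"
  assumes "f \<in> borel_measurable borel"
    and ratio: "\<And>w. w \<ge> 1 \<Longrightarrow> ((\<lambda>s. f (s * w) / f s) \<longlongrightarrow> w powr r) at_top"
    and r: "r < 0" and nz: "\<forall>\<^sub>F s in at_top. f s \<noteq> 0"
  obtains M S where "M > 0" "S > 0" "\<And>s z. s \<ge> S \<Longrightarrow> 1 \<le> z \<Longrightarrow> \<bar>f (s * z)\<bar> \<le> M * \<bar>f s\<bar>"
proof -
  obtain M S where MS: "\<And>s z. s \<ge> S \<Longrightarrow> 1 \<le> z \<Longrightarrow> z \<le> 2 \<Longrightarrow> \<bar>f (s * z)\<bar> \<le> M * \<bar>f s\<bar>"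
    using regularly_varying_bounded[OF assms(1) ratio less_imp_le[OF r] nz] by metis
  have q: "\<bar>2 powr r\<bar> < (1::real)" using r powr_less_mono[of r 0 "2::real"] by simp
  have "\<forall>\<^sub>F s in at_top. \<bar>f (2 * s)\<bar> \<le> 1 * \<bar>f s\<bar>"
    using ratio[of 2] by (intro eventually_ratio_le[OF _ q nz]) (simp add: mult.commute)
  then have "\<forall>\<^sub>F s in at_top. \<bar>f (2 * s)\<bar> \<le> 1 * \<bar>f s\<bar> \<and> s \<ge> S"
    using eventually_ge_at_top[of S] by (rule eventually_conj)
  then obtain T where T: "T > 0" "\<And>s. s \<ge> T \<Longrightarrow> \<bar>f (2 * s)\<bar> \<le> 1 * \<bar>f s\<bar> \<and> s \<ge> S"
    by (rule eventually_at_top_posE) blast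
  have dy: "\<bar>f (s * z)\<bar> \<le> max M 1 * \<bar>f s\<bar>" if "s \<ge> T" "1 \<le> z" "z \<le> 2 ^ j" for j s z
    using that
  proof (induction j arbitrary: s z)
    case 0
    then have "z = 1" by simp
    have "1 * \<bar>f s\<bar> \<le> max M 1 * \<bar>f s\<bar>" by (intro mult_right_mono) auto
    then show ?case using \<open>z = 1\<close> by simp
  next
    case (Suc j)
    show ?case
    proof (cases "z \<le> 2")
      case True
      have "\<bar>f (s * z)\<bar> \<le> M * \<bar>f s\<bar>" using True Suc.prems T(2)[of s] by (intro MS) auto
      also have "\<dots> \<le> max M 1 * \<bar>f s\<bar>" by (intro mult_right_mono) auto
      finally show ?thesis .
    next
      case False
      have "\<bar>f ((2 * s) * (z / 2))\<bar> \<le> max M 1 * \<bar>f (2 * s)\<bar>"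
        using Suc.prems False T(1) by (intro Suc.IH) auto
      also have "\<dots> \<le> max M 1 * \<bar>f s\<bar>"
        using T(2)[of s] Suc.prems by (intro mult_left_mono) auto
      finally show ?thesis by simp
    qed
  qed
  show ?thesis
  proof (rule that[of "max M 1" T])
    fix s z :: real assume sz: "s \<ge> T" "1 \<le> z"
    obtain j where "z < 2 ^ j" using real_arch_pow[of 2 z] by auto
    then show "\<bar>f (s * z)\<bar> \<le> max M 1 * \<bar>f s\<bar>" using sz dy[of s z j] by simp
  qed (use T in auto)
qed

context second_order_mono
begin

text \<open>The second-order error at all larger arguments is controlled by the error at one point;
  this turns asymptotics of quantiles into bounds of the tail on a whole interval.\<close>

lemma A_uniform:
  obtains M S where "M > 0" "S > 1" "\<And>s t. s \<ge> S \<Longrightarrow> s \<le> t \<Longrightarrow> \<bar>A t\<bar> \<le> M * \<bar>A s\<bar>"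
proof -
  \<comment> \<open>Measurability of \<open>A\<close> is known on the half-line above 1 only, so
    \<open>A\<close> is extended by zero.\<close>
  define f where "f x = (if x \<in> {1<..} then A x else 0)" for x
  have f: "f \<in> borel_measurable borel"
    using A_meas unfolding f_def by (subst (asm) measurable_restrict_space_iff[where c=0]) auto
  have fA: "f x = A x" if "x > 1" for x using that by (simp add: f_def)
  have nz: "\<forall>\<^sub>F s in at_top. f s \<noteq> 0"
    using A_nz eventually_gt_at_top[of 1] by eventually_elim (simp add: fA)
  have ratio: "((\<lambda>s. f (s * w) / f s) \<longlongrightarrow> w powr \<rho>) at_top" if "w \<ge> 1" for w
  proof (rule Lim_transform_eventually[OF A_ratio[OF that]])
    show "\<forall>\<^sub>F s in at_top. A (s * w) / A s = f (s * w) / f s"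
      using eventually_gt_at_top[of 1]
    proof eventually_elim
      case (elim s)
      have "s * w > 1" using elim that less_le_trans[of 1 s "s * w"] by simp
      then show ?case using elim by (simp add: fA)
    qed
  qed
  obtain M S where MS: "M > 0" "S > 0" "\<And>s z. s \<ge> S \<Longrightarrow> 1 \<le> z \<Longrightarrow> \<bar>f (s * z)\<bar> \<le> M * \<bar>f s\<bar>"
    using regularly_varying_bounded_all[OF f ratio rho_neg nz] by metis
  show ?thesis
  proof (rule that[OF MS(1), of "max S 2"])
    fix s t assume st: "max S 2 \<le> s" "s \<le> t"
    have "\<bar>f (s * (t / s))\<bar> \<le> M * \<bar>f s\<bar>" using st by (intro MS(3)) auto
    then show "\<bar>A t\<bar> \<le> M * \<bar>A s\<bar>" using st by (simp add: fA)
  qed auto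
qed

end

section \<open>The endpoint and the expansions of \<open>a\<close> and of the distance to the
  endpoint\<close>

text \<open>Values between two dyadic points are enclosed by monotonicity.\<close>

lemma mono_dyadic_tendsto:
  fixes U :: "real \<Rightarrow> real"
  assumes mono: "\<And>s t. 1 < s \<Longrightarrow> s \<le> t \<Longrightarrow> U s \<le> U t"
    and "S > 1" and conv: "(\<lambda>j. U (2 ^ j * S)) \<longlonglongrightarrow> l"
  shows "(U \<longlongrightarrow> l) at_top"
proof -
  have ge: "2 ^ j * S > 1" for j :: nat
  proof -
    have "1 * S \<le> 2 ^ j * S" using assms by (intro mult_right_mono) auto
    then show ?thesis using assms(2) by linarith
  qed
  have inc: "incseq (\<lambda>j. U (2 ^ j * S))"
    using ge assms(2) by (intro incseq_SucI mono) auto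
  have le: "U s \<le> l" if "s > 1" for s
  proof -
    obtain j where "s / S < 2 ^ j" using real_arch_pow[of 2 "s / S"] by auto
    then have "s \<le> 2 ^ j * S" using assms(2) by (simp add: field_simps)
    then have "U s \<le> U (2 ^ j * S)" using that by (rule mono[rotated])
    also have "\<dots> \<le> l" using incseq_le[OF inc conv] .
    finally show ?thesis .
  qed
  show ?thesis
  proof (rule increasing_tendsto)
    show "\<forall>\<^sub>F s in at_top. U s \<le> l"
      using eventually_gt_at_top[of 1] by eventually_elim (rule le)
    fix x assume "x < l"
    then obtain j where j: "x < U (2 ^ j * S)"
      using eventually_happens'[OF sequentially_bot order_tendstoD(1)[OF conv]] by blast
    show "\<forall>\<^sub>F s in at_top. x < U s"
      using eventually_ge_at_top[of "2 ^ j * S"]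
    proof eventually_elim
      case (elim s)
      then show ?case using mono[OF ge[of j] elim] j by linarith
    qed
  qed
qed

text \<open>Both bounds come from \<open>1 + x \<le> exp x\<close>, applied at \<open>x\<close> and
  at \<open>- x\<close>.\<close>

lemma abs_exp_minus_one_le:
  fixes x :: real
  assumes "\<bar>x\<bar> \<le> 1 / 2"
  shows "\<bar>exp x - 1\<bar> \<le> 2 * \<bar>x\<bar>"
proof -
  have 1: "1 + x \<le> exp x" by (rule exp_ge_add_one_self)
  have "(1 - x) * exp x \<le> exp (- x) * exp x"
    using exp_ge_add_one_self[of "- x"] by (intro mult_right_mono) auto
  then have 2: "(1 - x) * exp x \<le> 1" by (simp add: exp_minus field_simps)
  have "(1 - x) * exp x \<le> (1 - x) * (1 + 2 * \<bar>x\<bar>)"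
  proof -
    have "0 \<le> \<bar>x\<bar> * (1 - 2 * \<bar>x\<bar>)" using assms by simp
    then have "1 \<le> (1 - x) * (1 + 2 * \<bar>x\<bar>)"
      by (cases "x \<ge> 0") (auto simp: algebra_simps intro: order_trans[of _ 0])
    then show ?thesis using 2 by linarith
  qed
  then have "exp x \<le> 1 + 2 * \<bar>x\<bar>" using assms by (subst (asm) mult_le_cancel_left_pos) auto
  then show ?thesis using 1 by linarith
qed

context second_order_mono
begin

lemma gamma_q: "\<bar>2 powr \<gamma>\<bar> < (1::real)" and rho_q: "\<bar>2 powr \<rho>\<bar> < (1::real)"
  using gamma_neg rho_neg powr_less_mono[of \<gamma> 0 "2::real"] powr_less_mono[of \<rho> 0 "2::real"] by simp_all

lemma a_nz: "\<forall>\<^sub>F s in at_top. a s \<noteq> 0"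
  using eventually_gt_at_top[of 1] by eventually_elim (use a_pos in force)

lemma a_double: "((\<lambda>s. a (2 * s) / a s) \<longlongrightarrow> 2 powr \<gamma>) at_top"
  using a_ratio[of 2] by (simp add: mult.commute)

lemma A_double: "((\<lambda>s. A (2 * s) / A s) \<longlongrightarrow> 2 powr \<rho>) at_top"
  using A_ratio[of 2] by (simp add: mult.commute)

lemma U_double: "((\<lambda>s. (U (2 * s) - U s) / a s) \<longlongrightarrow> E 2) at_top"
proof -
  have "((\<lambda>s. E 2 + A s * hs 2 s) \<longlongrightarrow> E 2 + 0 * h 2) at_top"
    by (intro tendsto_intros A_null hs_tendsto) simp
  then have "((\<lambda>s. E 2 + A s * hs 2 s) \<longlongrightarrow> E 2) at_top" by simp
  then show ?thesis
  proof (rule Lim_transform_eventually)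
    show "\<forall>\<^sub>F s in at_top. E 2 + A s * hs 2 s = (U (2 * s) - U s) / a s"
      using A_nz eventually_gt_at_top[of 1]
      by eventually_elim (use increment_eq[of _ 2] a_pos in \<open>force simp: field_simps\<close>)
  qed
qed

text \<open>\<open>Lim\<close> is total and is justified by \<open>U_lim\<close>. For the tail
  quantile function of a distribution this number is the right endpoint, by
  \<open>right_endpoint_eq\<close>.\<close>

definition xs :: real where "xs = Lim at_top U"

text \<open>At ratio 2 the increments of \<open>U\<close> are at most a constant times
  \<open>a\<close>, which decays geometrically along dyadic points; monotonicity extends the dyadic
  limit to all arguments.\<close>

lemma U_lim: "(U \<longlongrightarrow> xs) at_top"
proof -
  have "\<forall>\<^sub>F s in at_top. \<bar>(U (2 * s) - U s) / a s\<bar> < \<bar>E 2\<bar> + 1"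
    using order_tendstoD(2)[OF tendsto_rabs[OF U_double], of "\<bar>E 2\<bar> + 1"] by simp
  then have 1: "\<forall>\<^sub>F s in at_top. \<bar>U (2 * s) - U s\<bar> \<le> (\<bar>E 2\<bar> + 1) * \<bar>a s\<bar>"
    using a_nz
  proof eventually_elim
    case (elim s)
    then have "\<bar>U (2 * s) - U s\<bar> / \<bar>a s\<bar> < \<bar>E 2\<bar> + 1" by (simp only: abs_divide)
    then have "\<bar>U (2 * s) - U s\<bar> < (\<bar>E 2\<bar> + 1) * \<bar>a s\<bar>"
      using elim(2) by (subst (asm) pos_divide_less_eq) auto
    then show ?case by (rule less_imp_le)
  qed
  obtain r where r: "\<bar>2 powr \<gamma>\<bar> < r" "r < (1::real)" using gamma_q dense by blast
  from 1 eventually_ratio_le[OF a_double r(1) a_nz] eventually_gt_at_top[of 1]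
  have "\<forall>\<^sub>F s in at_top. \<bar>U (2 * s) - U s\<bar> \<le> (\<bar>E 2\<bar> + 1) * \<bar>a s\<bar> \<and> \<bar>a (2 * s)\<bar> \<le> r * \<bar>a s\<bar> \<and> s > 1"
    by eventually_elim blast
  then obtain S where S: "S > 0" "\<And>s. s \<ge> S \<Longrightarrow> \<bar>U (2 * s) - U s\<bar> \<le> (\<bar>E 2\<bar> + 1) * \<bar>a s\<bar>
      \<and> \<bar>a (2 * s)\<bar> \<le> r * \<bar>a s\<bar> \<and> s > 1"
    by (rule eventually_at_top_posE) blast
  have "0 \<le> r" using r(1) by (meson abs_ge_zero less_imp_le order_trans)
  then have "convergent (\<lambda>j. U (2 ^ j * S))"
    using S r by (intro dyadic_limit(1)[of S r "\<bar>E 2\<bar> + 1" U a S]) auto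
  then obtain l where "(\<lambda>j. U (2 ^ j * S)) \<longlonglongrightarrow> l" by (auto simp: convergent_def)
  then have "(U \<longlongrightarrow> l) at_top"
    using S(2)[of S] by (intro mono_dyadic_tendsto[of U S]) (auto intro: mono)
  then show ?thesis unfolding xs_def by (metis tendsto_Lim trivial_limit_at_top_linorder)
qed

lemma U_le_xs: "s > 1 \<Longrightarrow> U s \<le> xs"
  by (rule tendsto_lowerbound[OF U_lim eventually_mono[OF eventually_ge_at_top[of s]]]) (auto intro: mono)

lemma dyadic_top: "s > 0 \<Longrightarrow> filterlim (\<lambda>j. 2 ^ j * s :: real) at_top sequentially"
  by real_asymp

lemma endpoint_first_order: "((\<lambda>s. (xs - U s) / a s) \<longlongrightarrow> - 1 / \<gamma>) at_top"
proof -
  have "((\<lambda>s. (xs - U s) / a s) \<longlongrightarrow> E 2 / (1 - 2 powr \<gamma>)) at_top"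
  proof (rule dyadic_ratio[OF U_double a_double gamma_q a_nz])
    show "\<forall>\<^sub>F s in at_top. (\<lambda>j. U (2 ^ j * s)) \<longlonglongrightarrow> xs"
      using eventually_gt_at_top[of 0] by eventually_elim (rule filterlim_compose[OF U_lim dyadic_top])
  qed
  moreover have "E 2 / (1 - 2 powr \<gamma>) = - 1 / \<gamma>"
    using gamma_neg gamma_q by (simp add: field_simps)
  ultimately show ?thesis by simp
qed

text \<open>Subtracting \<open>a s / \<gamma>\<close> from \<open>U s\<close> cancels the
  first-order terms, as \<open>E 2 = (2 powr \<gamma> - 1) / \<gamma>\<close>. The remaining
  increments have order \<open>a s * A s\<close>, with dyadic ratio
  \<open>2 powr (\<gamma> + \<rho>)\<close>, and the dyadic limit is still \<open>xs\<close> because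
  \<open>a\<close> vanishes along these points.\<close>

lemma endpoint_second_order:
  "((\<lambda>s. (xs - U s + a s / \<gamma>) / (a s * A s)) \<longlongrightarrow> 1 / (\<gamma> * (\<gamma> + \<rho>))) at_top"
proof -
  let ?f = "\<lambda>s. U s - a s / \<gamma>"
  define q where "q = 2 powr (\<gamma> + \<rho>)"
  have q: "\<bar>q\<bar> < 1" using gamma_neg rho_neg powr_less_mono[of "\<gamma> + \<rho>" 0 "2::real"] by (simp add: q_def)
  have nz: "\<forall>\<^sub>F s in at_top. a s * A s \<noteq> 0" using a_nz A_nz by eventually_elim simp
  have g: "((\<lambda>s. a (2 * s) * A (2 * s) / (a s * A s)) \<longlongrightarrow> q) at_top"
    using scaling(2)[of 2] by (simp add: q_def mult.commute)
  let ?H = "h 2 - 2 powr \<gamma> * (2 powr \<rho> - 1) / \<rho> / \<gamma>"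
  have "((\<lambda>s. hs 2 s - (a (s * 2) / a s - 2 powr \<gamma>) / A s / \<gamma>) \<longlongrightarrow> ?H) at_top"
    using gamma_neg by (intro tendsto_intros hs_tendsto scaling(1)) auto
  then have f: "((\<lambda>s. (?f (2 * s) - ?f s) / (a s * A s)) \<longlongrightarrow> ?H) at_top"
  proof (rule Lim_transform_eventually)
    show "\<forall>\<^sub>F s in at_top. hs 2 s - (a (s * 2) / a s - 2 powr \<gamma>) / A s / \<gamma> = (?f (2 * s) - ?f s) / (a s * A s)"
      using A_nz eventually_gt_at_top[of 1]
    proof eventually_elim
      case (elim s)
      have "a s > 0" using a_pos elim by simp
      define x where "x = (a (s * 2) / a s - 2 powr \<gamma>) / A s"
      have a2: "a (2 * s) = a s * (2 powr \<gamma> + A s * x)"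
        using elim \<open>a s > 0\<close> by (simp add: x_def mult.commute field_simps)
      have U2: "U (2 * s) = U s + a s * (E 2 + A s * hs 2 s)"
        using increment_eq[of s 2] elim by (simp add: mult.commute)
      have "?f (2 * s) - ?f s = a s * A s * (hs 2 s - x / \<gamma>)"
        unfolding a2 U2 using gamma_neg by (simp add: field_simps)
      then show ?case using elim \<open>a s > 0\<close> by (simp add: x_def)
    qed
  qed
  have l: "\<forall>\<^sub>F s in at_top. (\<lambda>j. ?f (2 ^ j * s)) \<longlonglongrightarrow> xs"
    using eventually_gt_at_top[of 0] dyadic_null[OF a_double gamma_q a_nz]
  proof eventually_elim
    case (elim s)
    have "(\<lambda>j. ?f (2 ^ j * s)) \<longlonglongrightarrow> xs - 0 / \<gamma>"
      using gamma_neg by (intro tendsto_intros elim filterlim_compose[OF U_lim dyadic_top]) auto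
    then show ?case by simp
  qed
  have "?H / (1 - q) = 1 / (\<gamma> * (\<gamma> + \<rho>))"
  proof -
    have "?H * (\<gamma> * (\<gamma> + \<rho>)) = 1 - q"
      using gamma_neg rho_neg
      by (simp add: second_order_limit_def q_def powr_add divide_simps) (simp add: algebra_simps)
    moreover have "\<gamma> * (\<gamma> + \<rho>) > 0" using gamma_neg rho_neg by (intro mult_neg_neg) auto
    ultimately show ?thesis using q by (simp add: field_simps)
  qed
  with dyadic_ratio[OF f g q nz l] show ?thesis by (simp add: algebra_simps)
qed

text \<open>The logarithm of \<open>a s * s powr (- \<gamma>)\<close> has increments of order
  \<open>A s\<close>, summable along dyadic points; its limit \<open>l\<close> provides the constant
  \<open>C = exp l\<close>.\<close>

lemma a_expansion:
  obtains C K where "C > 0" "K \<ge> 0" "\<forall>\<^sub>F s in at_top. \<bar>a s / (C * s powr \<gamma>) - 1\<bar> \<le> K * \<bar>A s\<bar>"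
proof -
  let ?f = "\<lambda>s. ln (a s * s powr (- \<gamma>))"
  have incr: "?f (s * w) - ?f s = ln (1 + (a (s * w) / a s - w powr \<gamma>) / A s * A s * w powr (- \<gamma>))"
    if "s > 1" "w \<ge> 1" "A s \<noteq> 0" for s w
  proof -
    have "s * w > 1" using that less_le_trans[of 1 s "s * w"] by simp
    then have "a (s * w) > 0" "a s > 0" using that a_pos by auto
    then have "?f (s * w) - ?f s = ln (a (s * w) / a s * w powr (- \<gamma>))"
      using that by (simp add: ln_mult ln_div ln_powr algebra_simps)
    also have "a (s * w) / a s * w powr (- \<gamma>) = 1 + (a (s * w) / a s - w powr \<gamma>) * w powr (- \<gamma>)"
      using that by (simp add: algebra_simps powr_add[symmetric])
    finally show ?thesis using that by simp
  qed
  have small: "((\<lambda>s. (a (s * w) / a s - w powr \<gamma>) / A s * A s * w powr (- \<gamma>)) \<longlongrightarrow> 0) at_top"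
    if "w \<ge> 1" for w
    using tendsto_mult[OF tendsto_mult[OF scaling(1)[OF that] A_null] tendsto_const[of "w powr (- \<gamma>)"]] by simp
  have slow: "((\<lambda>s. ?f (s * w) - ?f s) \<longlongrightarrow> 0) at_top" if "w \<ge> 1" for w
  proof -
    have "((\<lambda>s. ln (1 + (a (s * w) / a s - w powr \<gamma>) / A s * A s * w powr (- \<gamma>))) \<longlongrightarrow> ln (1 + 0)) at_top"
      by (intro tendsto_intros small that) simp
    then have "((\<lambda>s. ln (1 + (a (s * w) / a s - w powr \<gamma>) / A s * A s * w powr (- \<gamma>))) \<longlongrightarrow> 0) at_top" by simp
    then show ?thesis
      by (rule Lim_transform_eventually)
        (use A_nz eventually_gt_at_top[of 1] in \<open>eventually_elim, use incr that in force\<close>)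
  qed
  \<comment> \<open>One more than the modulus of the limit in \<open>scaling\<close>, hence an
    eventual bound. In \<open>K\<close>, the 2 comes from
    \<open>\<bar>ln (1 + u)\<bar> \<le> 2 * \<bar>u\<bar>\<close> and
    \<open>2 powr (- \<gamma>)\<close> from the normalisation of \<open>u\<close>.\<close>
  define c where "c = \<bar>2 powr \<gamma> * (2 powr \<rho> - 1) / \<rho>\<bar> + 1"
  define K where "K = 2 * c * 2 powr (- \<gamma>)"
  have "K \<ge> 0" by (simp add: K_def c_def)
  have "\<forall>\<^sub>F s in at_top. \<bar>(a (s * 2) / a s - 2 powr \<gamma>) / A s\<bar> < c"
    unfolding c_def by (intro order_tendstoD(2)[OF tendsto_rabs[OF scaling(1)]]) auto
  moreover have "\<forall>\<^sub>F s in at_top. \<bar>(a (s * 2) / a s - 2 powr \<gamma>) / A s * A s * 2 powr (- \<gamma>)\<bar> < 1 / 2"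
    using tendstoD[OF small[of 2], of "1/2"] by simp
  ultimately have fK: "\<forall>\<^sub>F s in at_top. \<bar>?f (2 * s) - ?f s\<bar> \<le> K * \<bar>A s\<bar>"
    using A_nz eventually_gt_at_top[of 1]
  proof eventually_elim
    case (elim s)
    define u where "u = (a (s * 2) / a s - 2 powr \<gamma>) / A s * A s * 2 powr (- \<gamma>)"
    have u: "\<bar>u\<bar> < 1 / 2" using elim(2) by (simp only: u_def)
    have fe: "?f (2 * s) - ?f s = ln (1 + u)"
      using incr[of s 2, OF elim(4) _ elim(3)] unfolding u_def by (simp add: mult.commute[of 2 s])
    have "\<bar>ln (1 + u) - u\<bar> \<le> 2 * u\<^sup>2" using u by (intro abs_ln_one_plus_x_minus_x_bound) auto
    also have "2 * u\<^sup>2 \<le> \<bar>u\<bar>"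
    proof -
      have "0 \<le> \<bar>u\<bar> * (1 - 2 * \<bar>u\<bar>)" using u by simp
      then show ?thesis by (simp add: algebra_simps power2_eq_square)
    qed
    finally have "\<bar>ln (1 + u)\<bar> \<le> 2 * \<bar>u\<bar>" by linarith
    also have "\<bar>u\<bar> = \<bar>(a (s * 2) / a s - 2 powr \<gamma>) / A s\<bar> * \<bar>A s\<bar> * 2 powr (- \<gamma>)"
      by (simp only: u_def abs_mult) simp
    also have "\<dots> \<le> c * \<bar>A s\<bar> * 2 powr (- \<gamma>)"
      using elim(1) by (intro mult_right_mono) auto
    finally show ?case unfolding fe K_def by (simp add: mult_ac)
  qed
  obtain l K' where lK: "\<forall>\<^sub>F s in at_top. \<bar>l - ?f s\<bar> \<le> K' * \<bar>A s\<bar>"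
    using dyadic_bounded[OF fK \<open>K \<ge> 0\<close> A_double rho_q A_nz slow] by blast
  have K0: "((\<lambda>s. K' * \<bar>A s\<bar>) \<longlongrightarrow> K' * \<bar>0\<bar>) at_top" by (intro tendsto_intros A_null)
  have "\<forall>\<^sub>F s in at_top. K' * \<bar>A s\<bar> < 1 / 2" by (rule order_tendstoD(2)[OF K0]) simp
  with lK have "\<forall>\<^sub>F s in at_top. \<bar>a s / (exp l * s powr \<gamma>) - 1\<bar> \<le> 2 * \<bar>K'\<bar> * \<bar>A s\<bar>"
    using eventually_gt_at_top[of 1]
  proof eventually_elim
    case (elim s)
    have as: "a s > 0" using a_pos elim by simp
    have "a s / (exp l * s powr \<gamma>) = exp (?f s - l)"
      using as elim(3) by (simp add: exp_diff powr_minus field_simps)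
    moreover have "\<bar>exp (?f s - l) - 1\<bar> \<le> 2 * \<bar>?f s - l\<bar>"
      using elim by (intro abs_exp_minus_one_le) linarith
    moreover have "K' * \<bar>A s\<bar> \<le> \<bar>K'\<bar> * \<bar>A s\<bar>" by (intro mult_right_mono) auto
    ultimately have "\<bar>a s / (exp l * s powr \<gamma>) - 1\<bar> \<le> 2 * (\<bar>K'\<bar> * \<bar>A s\<bar>)"
      using order_trans[OF elim(1)] by (simp only: abs_minus_commute[of l]) (meson mult_left_mono order_trans zero_le_numeral)
    then show ?case by (simp only: mult.assoc)
  qed
  then show ?thesis using that[of "exp l" "2 * \<bar>K'\<bar>"] by simp
qed

text \<open>The expansion of \<open>a\<close> is inserted in
  \<open>xs - U s = a s * (d * A s - 1 / \<gamma>)\<close> with bounded \<open>d\<close>. One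
  constant \<open>K\<close> serves both estimates.\<close>

lemma second_order_expansion:
  obtains C K where "C > 0" "K \<ge> 0"
    "\<forall>\<^sub>F s in at_top. \<bar>a s / (C * s powr \<gamma>) - 1\<bar> \<le> K * \<bar>A s\<bar>"
    "\<forall>\<^sub>F s in at_top. \<bar>(xs - U s) / (- C / \<gamma> * s powr \<gamma>) - 1\<bar> \<le> K * \<bar>A s\<bar>"
proof -
  obtain C K where CK: "C > 0" "K \<ge> 0" "\<forall>\<^sub>F s in at_top. \<bar>a s / (C * s powr \<gamma>) - 1\<bar> \<le> K * \<bar>A s\<bar>"
    by (rule a_expansion)
  define c where "c = \<bar>1 / (\<gamma> * (\<gamma> + \<rho>))\<bar> + 1"
  have "\<forall>\<^sub>F s in at_top. \<bar>(xs - U s + a s / \<gamma>) / (a s * A s)\<bar> < c"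
    unfolding c_def by (intro order_tendstoD(2)[OF tendsto_rabs[OF endpoint_second_order]]) simp
  moreover have "\<forall>\<^sub>F s in at_top. K * \<bar>A s\<bar> < 1"
  proof -
    have K0: "((\<lambda>s. K * \<bar>A s\<bar>) \<longlongrightarrow> K * \<bar>0\<bar>) at_top" by (intro tendsto_intros A_null)
    show ?thesis by (rule order_tendstoD(2)[OF K0]) simp
  qed
  ultimately have "\<forall>\<^sub>F s in at_top. \<bar>(xs - U s) / (- C / \<gamma> * s powr \<gamma>) - 1\<bar> \<le> (- 2 * \<gamma> * c + K) * \<bar>A s\<bar>"
    using CK(3) A_nz eventually_gt_at_top[of 1]
  proof eventually_elim
    case (elim s)
    have as: "a s > 0" using a_pos elim by simp
    define d where "d = (xs - U s + a s / \<gamma>) / (a s * A s)"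
    define e where "e = a s / (C * s powr \<gamma>) - 1"
    have d: "xs - U s = a s * (d * A s - 1 / \<gamma>)" using as elim by (simp add: d_def field_simps)
    have e1: "a s = (C * s powr \<gamma>) * (1 + e)" using CK(1) elim by (simp add: e_def)
    have "xs - U s = (C * s powr \<gamma>) * (1 + e) * (d * A s - 1 / \<gamma>)"
      using d by (subst (asm) e1)
    then have eq: "(xs - U s) / (- C / \<gamma> * s powr \<gamma>) - 1 = (1 + e) * (1 - \<gamma> * d * A s) - 1"
      using CK(1) elim(5) gamma_neg by (simp add: field_simps)
    have "\<bar>e\<bar> \<le> K * \<bar>A s\<bar>" "\<bar>e\<bar> \<le> 1" using elim by (simp_all add: e_def)
    have "\<bar>(1 + e) * (1 - \<gamma> * d * A s) - 1\<bar> = \<bar>e + (1 + e) * (- \<gamma>) * d * A s\<bar>"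
      by (simp add: algebra_simps)
    also have "\<dots> \<le> \<bar>e\<bar> + \<bar>(1 + e) * (- \<gamma>) * d * A s\<bar>" by (rule abs_triangle_ineq)
    also have "\<bar>(1 + e) * (- \<gamma>) * d * A s\<bar> = \<bar>1 + e\<bar> * (- \<gamma>) * \<bar>d\<bar> * \<bar>A s\<bar>"
      using gamma_neg by (simp add: abs_mult)
    also have "\<dots> \<le> 2 * (- \<gamma>) * c * \<bar>A s\<bar>"
      using gamma_neg elim(1) \<open>\<bar>e\<bar> \<le> 1\<close> unfolding d_def[symmetric]
      by (intro mult_right_mono mult_mono) auto
    finally show ?case using \<open>\<bar>e\<bar> \<le> K * \<bar>A s\<bar>\<close> unfolding eq by (simp add: algebra_simps)
  qed
  moreover have "c \<ge> 0" by (simp add: c_def)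
  then have c0: "- 2 * \<gamma> * c \<ge> 0" using gamma_neg by (simp add: mult_nonpos_nonneg)
  moreover have "\<forall>\<^sub>F s in at_top. \<bar>a s / (C * s powr \<gamma>) - 1\<bar> \<le> (- 2 * \<gamma> * c + K) * \<bar>A s\<bar>"
    using CK(3)
  proof eventually_elim
    case (elim s)
    have "K * \<bar>A s\<bar> \<le> (- 2 * \<gamma> * c + K) * \<bar>A s\<bar>" using c0 by (intro mult_right_mono) auto
    then show ?case using elim by linarith
  qed
  ultimately show ?thesis using CK(1,2) by (intro that[of C "- 2 * \<gamma> * c + K"]) auto
qed

end

section \<open>Coupling weakly convergent laws\<close>

text \<open>The density of a coupling with respect to the product measure. Both marginal conditions
  are demanded at every point rather than almost everywhere, so that each conditional law is a
  probability measure.\<close>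

definition coupling_density :: "'b measure \<Rightarrow> 'c measure \<Rightarrow> ('b \<Rightarrow> 'c \<Rightarrow> real) \<Rightarrow> bool" where
  "coupling_density L N h \<longleftrightarrow>
     case_prod h \<in> borel_measurable (L \<Otimes>\<^sub>M N) \<and> (\<forall>z y. 0 \<le> h z y) \<and>
     (\<forall>z. (\<integral>\<^sup>+y. h z y \<partial>N) = 1) \<and> (\<forall>y. (\<integral>\<^sup>+z. h z y \<partial>L) = 1)"

lemma nn_integral_eq_oneI:
  assumes "integrable M f" "\<And>x. 0 \<le> f x" "(\<integral>x. f x \<partial>M) = (1::real)"
  shows "(\<integral>\<^sup>+x. f x \<partial>M) = 1"
  using assms by (subst nn_integral_eq_integral) auto

text \<open>The density puts mass \<open>(1 - d) min (l i) (r i)\<close> on each product cell \<open>u i \<otimes> v i\<close> and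
  spreads the rest as a product of the residual marginals.\<close>
lemma coupling_density_exists:
  fixes u :: "nat \<Rightarrow> 'b \<Rightarrow> real" and v :: "nat \<Rightarrow> 'c \<Rightarrow> real"
  assumes L: "prob_space L" and N: "prob_space N"
    and u[measurable]: "\<And>i. u i \<in> borel_measurable L" and v[measurable]: "\<And>i. v i \<in> borel_measurable N"
    and u0: "\<And>i z. 0 \<le> u i z" and v0: "\<And>i y. 0 \<le> v i y"
    and u1: "\<And>z. (\<Sum>i<m. u i z) \<le> 1" and v1: "\<And>y. (\<Sum>i<m. v i y) \<le> 1"
    and d: "0 < d" "d < 1"
  obtains h where "coupling_density L N h"
    "\<And>B. B \<in> sets (L \<Otimes>\<^sub>M N) \<Longrightarrow> (\<And>z y i. (z, y) \<in> B \<Longrightarrow> i < m \<Longrightarrow> u i z * v i y = 0) \<Longrightarrow>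
      (\<integral>\<^sup>+z. \<integral>\<^sup>+y. ennreal (h z y) * indicator B (z, y) \<partial>N \<partial>L)
        \<le> ennreal (1 - (1 - d) * (\<Sum>i<m. min (\<integral>z. u i z \<partial>L) (\<integral>y. v i y \<partial>N)))"
proof -
  interpret L: prob_space L by fact
  interpret N: prob_space N by fact
  define l where "l i = (\<integral>z. u i z \<partial>L)" for i
  define r where "r i = (\<integral>y. v i y \<partial>N)" for i
  have ui1: "u i z \<le> 1" if "i < m" for i z
    using u1[of z] u0 that member_le_sum[of i "{..<m}" "\<lambda>i. u i z"] by force
  have vi1: "v i y \<le> 1" if "i < m" for i y
    using v1[of y] v0 that member_le_sum[of i "{..<m}" "\<lambda>i. v i y"] by force
  have iu: "integrable L (u i)" if "i < m" for i
    using that ui1 u0 by (intro L.integrable_const_bound[of _ 1]) auto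
  have iv: "integrable N (v i)" if "i < m" for i
    using that vi1 v0 by (intro N.integrable_const_bound[of _ 1]) auto
  have l0: "0 \<le> l i" for i unfolding l_def using u0 by (intro integral_nonneg_AE) auto
  have r0: "0 \<le> r i" for i unfolding r_def using v0 by (intro integral_nonneg_AE) auto
  \<comment> \<open>Then \<open>c i * l i * r i = (1 - d) * min (l i) (r i)\<close>, also for a cell
    of zero mass, where division by zero makes \<open>c i\<close> vanish.\<close>
  define c where "c i = (1 - d) * min (l i) (r i) / (l i * r i)" for i
  have c0: "0 \<le> c i" for i unfolding c_def using d l0[of i] r0[of i] by simp
  have cr: "c i * r i \<le> 1 - d" for i
  proof (cases "l i > 0 \<and> r i > 0")
    case True
    then have "c i * r i = (1 - d) * (min (l i) (r i) / l i)" by (simp add: c_def)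
    also have "\<dots> \<le> (1 - d) * 1" using True d by (intro mult_left_mono) auto
    finally show ?thesis by simp
  qed (use d l0[of i] r0[of i] in \<open>auto simp: c_def not_less\<close>)
  have cl: "c i * l i \<le> 1 - d" for i
  proof (cases "l i > 0 \<and> r i > 0")
    case True
    then have "c i * l i = (1 - d) * (min (l i) (r i) / r i)" by (simp add: c_def)
    also have "\<dots> \<le> (1 - d) * 1" using True d by (intro mult_left_mono) auto
    finally show ?thesis by simp
  qed (use d l0[of i] r0[of i] in \<open>auto simp: c_def not_less\<close>)
  have clr: "c i * l i * r i = (1 - d) * min (l i) (r i)" for i
    using l0[of i] r0[of i] by (cases "l i = 0 \<or> r i = 0") (auto simp: c_def)
  \<comment> \<open>The mass left over by the cells. Withholding the fraction \<open>d\<close> keeps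
    \<open>D\<close> positive even when the cells exhaust both laws, so that the residual product
    can be normalised by it.\<close>
  define D where "D = 1 - (\<Sum>i<m. c i * l i * r i)"
  have D_eq: "D = 1 - (1 - d) * (\<Sum>i<m. min (l i) (r i))"
    by (simp add: D_def clr sum_distrib_left)
  define p where "p z = (\<Sum>i<m. c i * r i * u i z)" for z
  define s where "s y = (\<Sum>i<m. c i * l i * v i y)" for y
  have [measurable]: "p \<in> borel_measurable L" "s \<in> borel_measurable N"
    unfolding p_def s_def by measurable
  have p1: "p z \<le> 1 - d" for z
  proof -
    have "p z \<le> (\<Sum>i<m. (1 - d) * u i z)" unfolding p_def by (intro sum_mono mult_right_mono cr u0)
    also have "\<dots> \<le> (1 - d) * 1" unfolding sum_distrib_left[symmetric] using d u1 by (intro mult_left_mono) auto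
    finally show ?thesis by simp
  qed
  have s1: "s y \<le> 1 - d" for y
  proof -
    have "s y \<le> (\<Sum>i<m. (1 - d) * v i y)" unfolding s_def by (intro sum_mono mult_right_mono cl v0)
    also have "\<dots> \<le> (1 - d) * 1" unfolding sum_distrib_left[symmetric] using d v1 by (intro mult_left_mono) auto
    finally show ?thesis by simp
  qed
  have ip: "integrable L p" unfolding p_def by (intro Bochner_Integration.integrable_sum integrable_mult_right) (auto intro: iu)
  have ss: "integrable N s" unfolding s_def by (intro Bochner_Integration.integrable_sum integrable_mult_right) (auto intro: iv)
  have Ip: "(\<integral>z. p z \<partial>L) = 1 - D"
    unfolding p_def D_def by (subst Bochner_Integration.integral_sum) (auto intro!: sum.cong iu simp: l_def)
  have Is: "(\<integral>y. s y \<partial>N) = 1 - D"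
    unfolding s_def D_def by (subst Bochner_Integration.integral_sum) (auto intro!: sum.cong iv simp: r_def)
  have Dd: "D > 0"
  proof -
    have "(\<integral>z. p z \<partial>L) \<le> (\<integral>z. 1 - d \<partial>L)" using p1 by (intro integral_mono ip) auto
    then show ?thesis using Ip d by (simp add: L.prob_space)
  qed
  define h where "h z y = (\<Sum>i<m. c i * u i z * v i y) + (1 - p z) * (1 - s y) / D" for z y
  have hm: "case_prod h \<in> borel_measurable (L \<Otimes>\<^sub>M N)" unfolding h_def by measurable
  have tail0: "0 \<le> (1 - p z) * (1 - s y) / D" for z y
    using p1[of z] s1[of y] d Dd by simp
  have h0: "0 \<le> h z y" for z y
    unfolding h_def using c0 u0 v0 tail0 by (intro add_nonneg_nonneg sum_nonneg mult_nonneg_nonneg) auto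
  have hN: "integrable N (h z) \<and> (\<integral>y. h z y \<partial>N) = 1" for z
  proof
    have 1: "integrable N (\<lambda>y. \<Sum>i<m. c i * u i z * v i y)"
      by (intro Bochner_Integration.integrable_sum integrable_mult_right) (auto intro: iv)
    have 2: "integrable N (\<lambda>y. (1 - p z) * (1 - s y) / D)"
      by (intro integrable_divide integrable_mult_right Bochner_Integration.integrable_diff ss) auto
    show "integrable N (h z)" unfolding h_def by (rule Bochner_Integration.integrable_add[OF 1 2])
    have "(\<integral>y. h z y \<partial>N) = (\<Sum>i<m. c i * u i z * r i) + (1 - p z) * (1 - (1 - D)) / D"
      unfolding h_def Is[symmetric] using ss
      by (subst Bochner_Integration.integral_add[OF 1 2], subst Bochner_Integration.integral_sum)
        (auto intro!: iv simp: r_def N.prob_space)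
    also have "\<dots> = 1" using Dd by (simp add: p_def mult_ac)
    finally show "(\<integral>y. h z y \<partial>N) = 1" .
  qed
  have hL: "integrable L (\<lambda>z. h z y) \<and> (\<integral>z. h z y \<partial>L) = 1" for y
  proof
    have 1: "integrable L (\<lambda>z. \<Sum>i<m. c i * u i z * v i y)"
      by (intro Bochner_Integration.integrable_sum integrable_mult_right integrable_mult_left) (auto intro: iu)
    have 2: "integrable L (\<lambda>z. (1 - p z) * (1 - s y) / D)"
      by (intro integrable_divide integrable_mult_left Bochner_Integration.integrable_diff ip) auto
    show "integrable L (\<lambda>z. h z y)" unfolding h_def by (rule Bochner_Integration.integrable_add[OF 1 2])
    have "(\<integral>z. h z y \<partial>L) = (\<Sum>i<m. c i * l i * v i y) + (1 - (1 - D)) * (1 - s y) / D"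
      unfolding h_def Ip[symmetric] using ip
      by (subst Bochner_Integration.integral_add[OF 1 2], subst Bochner_Integration.integral_sum)
        (auto intro!: iu simp: l_def L.prob_space)
    also have "\<dots> = 1" using Dd by (simp add: s_def mult_ac)
    finally show "(\<integral>z. h z y \<partial>L) = 1" .
  qed
  show ?thesis
  proof (rule that[of h])
    show "coupling_density L N h"
      unfolding coupling_density_def using hm h0 hN hL by (auto intro!: nn_integral_eq_oneI)
    \<comment> \<open>On \<open>B\<close> all cell terms vanish, so \<open>B\<close> receives at
      most the residual mass \<open>D\<close>.\<close>
    fix B assume B[measurable]: "B \<in> sets (L \<Otimes>\<^sub>M N)" and zero: "\<And>z y i. (z, y) \<in> B \<Longrightarrow> i < m \<Longrightarrow> u i z * v i y = 0"
    have i1: "(\<integral>\<^sup>+y. ennreal ((1 - p z) * (1 - s y) / D) \<partial>N) = ennreal (1 - p z)" for z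
    proof -
      have "(\<integral>\<^sup>+y. ennreal ((1 - p z) * (1 - s y) / D) \<partial>N) = ennreal (\<integral>y. (1 - p z) * (1 - s y) / D \<partial>N)"
        using tail0 ss by (intro nn_integral_eq_integral) auto
      also have "(\<integral>y. (1 - p z) * (1 - s y) / D \<partial>N) = (1 - p z) * (1 - (1 - D)) / D"
        unfolding Is[symmetric] using ss by (simp add: N.prob_space)
      finally show ?thesis using Dd by simp
    qed
    have "(\<integral>\<^sup>+z. \<integral>\<^sup>+y. ennreal (h z y) * indicator B (z, y) \<partial>N \<partial>L)
        \<le> (\<integral>\<^sup>+z. \<integral>\<^sup>+y. ennreal ((1 - p z) * (1 - s y) / D) \<partial>N \<partial>L)"
    proof (intro nn_integral_mono)
      fix z y
      show "ennreal (h z y) * indicator B (z, y) \<le> ennreal ((1 - p z) * (1 - s y) / D)"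
      proof (cases "(z, y) \<in> B")
        case True
        have "(\<Sum>i<m. c i * u i z * v i y) = 0"
          using zero[OF True] by (intro sum.neutral) (auto simp: mult.assoc)
        then show ?thesis using True by (simp add: h_def)
      qed simp
    qed
    also have "\<dots> = (\<integral>\<^sup>+z. ennreal (1 - p z) \<partial>L)" by (simp only: i1)
    also have "\<dots> = ennreal (\<integral>z. 1 - p z \<partial>L)"
      using ip by (intro nn_integral_eq_integral) (use p1 d in \<open>auto intro!: AE_I2 order_trans[OF p1]\<close>)
    also have "(\<integral>z. 1 - p z \<partial>L) = D" using ip Ip by (simp add: L.prob_space)
    finally show "(\<integral>\<^sup>+z. \<integral>\<^sup>+y. ennreal (h z y) * indicator B (z, y) \<partial>N \<partial>L)
        \<le> ennreal (1 - (1 - d) * (\<Sum>i<m. min (\<integral>z. u i z \<partial>L) (\<integral>y. v i y \<partial>N)))"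
      by (simp add: D_eq l_def r_def)
  qed
qed

text \<open>Tents \<open>t i\<close> around a countable dense set are multiplied by the product of
  the earlier \<open>1 - t j\<close>, and the partial sums telescope. Continuity of the cells lets
  weak convergence see their masses, and finitely many of them carry nearly all of
  \<open>L\<close>.\<close>

lemma small_partition_of_unity:
  fixes L :: "'b::{metric_space, second_countable_topology} measure"
  assumes L: "prob_space L" and setsL: "sets L = sets borel" and e: "e > 0" and \<eta>: "\<eta> > 0"
  obtains m :: nat and u :: "nat \<Rightarrow> 'b \<Rightarrow> real"
  where "\<And>i. continuous_on UNIV (u i)" "\<And>i z. 0 \<le> u i z" "\<And>i z. u i z \<le> 1"
    "\<And>z. (\<Sum>i<m. u i z) \<le> 1" "\<And>i z w. u i z \<noteq> 0 \<Longrightarrow> u i w \<noteq> 0 \<Longrightarrow> dist z w < e"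
    "(\<Sum>i<m. \<integral>z. u i z \<partial>L) \<ge> 1 - \<eta>"
proof -
  interpret L: prob_space L by fact
  obtain D :: "'b set" where D: "countable D" "\<And>X. open X \<Longrightarrow> X \<noteq> {} \<Longrightarrow> \<exists>d\<in>D. d \<in> X"
    by (rule countable_dense_setE) blast
  then have "D \<noteq> {}" by (metis UNIV_not_empty equals0D open_UNIV)
  define c where "c = from_nat_into D"
  \<comment> \<open>A tent is 1 within \<delta> of its centre and 0 beyond
    \<open>2 * \<delta>\<close>, so two points of one cell are closer than
    \<open>4 * \<delta> = e\<close>.\<close>
  define \<delta> where "\<delta> = e / 4"
  have \<delta>: "\<delta> > 0" using e by (simp add: \<delta>_def)
  have dense: "\<exists>i. dist z (c i) < \<delta>" for z
  proof -
    obtain d where "d \<in> D" "d \<in> ball z \<delta>" using D(2)[of "ball z \<delta>"] \<delta> by auto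
    then show ?thesis unfolding c_def using from_nat_into_surj[OF D(1)] by (metis mem_ball)
  qed
  define t where "t i z = max 0 (min 1 (2 - dist z (c i) / \<delta>))" for i z
  have t01: "0 \<le> t i z" "t i z \<le> 1" for i z by (simp_all add: t_def)
  have t_one: "t i z = 1" if "dist z (c i) < \<delta>" for i z
    using that \<delta> by (simp add: t_def field_simps)
  have t_pos: "dist z (c i) < 2 * \<delta>" if "t i z \<noteq> 0" for i z
  proof (rule ccontr)
    assume "\<not> ?thesis"
    then have "2 - dist z (c i) / \<delta> \<le> 0" using \<delta> by (simp add: field_simps)
    with that show False by (simp add: t_def)
  qed
  have t_cont: "continuous_on UNIV (t i)" for i unfolding t_def using \<delta> by (intro continuous_intros) auto
  define u where "u i z = t i z * (\<Prod>j<i. 1 - t j z)" for i z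
  have sum_u: "(\<Sum>i<m. u i z) = 1 - (\<Prod>i<m. 1 - t i z)" for m z
    by (induction m) (simp_all add: u_def algebra_simps)
  have prod01: "0 \<le> (\<Prod>j<i. 1 - t j z)" "(\<Prod>j<i. 1 - t j z) \<le> 1" for i z
    using t01 by (auto intro!: prod_nonneg prod_le_1)
  have u_cont: "continuous_on UNIV (u i)" for i
    unfolding u_def by (intro continuous_intros t_cont)
  have u0: "0 \<le> u i z" for i z unfolding u_def using t01 prod01 by simp
  have u1: "u i z \<le> 1" for i z unfolding u_def using t01 prod01 by (simp add: mult_le_one)
  have um[measurable]: "u i \<in> borel_measurable L" for i
    using borel_measurable_continuous_onI[OF u_cont[of i]] setsL measurable_cong_sets by blast
  define B where "B m = (\<Union>i<m. {z. dist z (c i) < \<delta>})" for m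
  have Bs: "B m \<in> sets L" for m unfolding B_def setsL by (intro sets.finite_UN) (auto intro!: borel_open open_Collect_less continuous_intros)
  have "(\<lambda>m. L.prob (B m)) \<longlonglongrightarrow> L.prob (\<Union>m. B m)"
  proof (intro L.finite_Lim_measure_incseq)
    show "incseq B" unfolding B_def by (intro monoI UN_mono) auto
  qed (use Bs in auto)
  moreover have "(\<Union>m. B m) = space L"
    using dense sets_eq_imp_space_eq[OF setsL] unfolding B_def by (auto, meson lessThan_iff lessI)
  ultimately have "(\<lambda>m. L.prob (B m)) \<longlonglongrightarrow> 1" by (simp add: L.prob_space)
  then have "\<forall>\<^sub>F m in sequentially. L.prob (B m) > 1 - \<eta>" using \<eta> by (intro order_tendstoD(1)) auto
  then obtain m where m: "L.prob (B m) > 1 - \<eta>"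
    using eventually_happens'[OF sequentially_bot] by blast
  have iu: "integrable L (u i)" for i
    using u0 u1 by (intro L.integrable_const_bound[of _ 1]) auto
  have "1 - \<eta> \<le> (\<integral>z. indicator (B m) z \<partial>L)" using m Bs by simp
  also have "\<dots> \<le> (\<integral>z. (\<Sum>i<m. u i z) \<partial>L)"
  proof (rule integral_mono)
    show "integrable L (indicat_real (B m))" using Bs by (simp add: L.emeasure_eq_measure)
    show "integrable L (\<lambda>z. \<Sum>i<m. u i z)" using iu by simp
    fix z
    show "indicat_real (B m) z \<le> (\<Sum>i<m. u i z)"
    proof (cases "z \<in> B m")
      case True
      then obtain i where "i < m" "t i z = 1" using t_one by (auto simp: B_def)
      then have "(\<Prod>i<m. 1 - t i z) = 0" by (intro prod_zero) auto
      then have "(\<Sum>i<m. u i z) = 1" by (simp only: sum_u)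
      then show ?thesis by (simp add: indicator_def)
    qed (simp add: sum_nonneg u0)
  qed
  also have "\<dots> = (\<Sum>i<m. \<integral>z. u i z \<partial>L)" using iu by (intro Bochner_Integration.integral_sum) auto
  finally have "(\<Sum>i<m. \<integral>z. u i z \<partial>L) \<ge> 1 - \<eta>" .
  moreover have "dist z w < e" if "u i z \<noteq> 0" "u i w \<noteq> 0" for i z w
  proof -
    have "t i z \<noteq> 0" "t i w \<noteq> 0" using that by (auto simp: u_def)
    then have "dist z (c i) < 2 * \<delta>" "dist w (c i) < 2 * \<delta>" using t_pos by auto
    then show ?thesis using dist_triangle2[of z w "c i"] by (simp add: \<delta>_def)
  qed
  moreover have "(\<Sum>i<m. u i z) \<le> 1" for z using prod01 by (simp add: sum_u)
  ultimately show ?thesis using u_cont u0 u1 by (intro that[of u m]) auto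
qed

text \<open>The cells on the approximating side are the same functions composed with
  \<open>f n\<close>. Matching cells force \<open>z\<close> and \<open>f n y\<close> closer than
  \<open>e\<close>, and by weak convergence the masses of the cells tend to those under
  \<open>L\<close>.\<close>

lemma coupling_close:
  fixes L :: "'b::{metric_space, second_countable_topology} measure"
    and N :: "nat \<Rightarrow> 'c measure" and f :: "nat \<Rightarrow> 'c \<Rightarrow> 'b"
  assumes L: "prob_space L" and setsL: "sets L = sets borel"
    and N: "\<And>n. prob_space (N n)" and f[measurable]: "\<And>n. f n \<in> borel_measurable (N n)"
    and weak: "\<And>g :: 'b \<Rightarrow> real. continuous_on UNIV g \<Longrightarrow> bounded (range g) \<Longrightarrow>
      (\<lambda>n. \<integral>y. g (f n y) \<partial>N n) \<longlonglongrightarrow> (\<integral>z. g z \<partial>L)"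
    and e: "e > 0"
  shows "\<forall>\<^sub>F n in sequentially. \<exists>h. coupling_density L (N n) h \<and>
    (\<integral>\<^sup>+z. \<integral>\<^sup>+y. ennreal (h z y) * indicator {(z, y). e < dist (f n y) z} (z, y) \<partial>N n \<partial>L) \<le> ennreal e"
proof -
  interpret L: prob_space L by fact
  note setsL[measurable_cong]
  obtain m and u :: "nat \<Rightarrow> 'b \<Rightarrow> real"
    where u: "\<And>i. continuous_on UNIV (u i)" "\<And>i z. 0 \<le> u i z" "\<And>i z. u i z \<le> 1"
    "\<And>z. (\<Sum>i<m. u i z) \<le> 1" "\<And>i z w. u i z \<noteq> 0 \<Longrightarrow> u i w \<noteq> 0 \<Longrightarrow> dist z w < e"
    "(\<Sum>i<m. \<integral>z. u i z \<partial>L) \<ge> 1 - e / 4"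
    by (rule small_partition_of_unity[OF L setsL e, of "e / 4"]) (use e in \<open>simp, blast\<close>)
  have um[measurable]: "u i \<in> borel_measurable borel" for i
    using borel_measurable_continuous_onI[OF u(1)[of i]] .
  \<comment> \<open>\<open>1 - (1 - d) * (1 - e / 2)\<close> is at most \<open>e / 2 + d\<close>, so
    \<open>d \<le> e / 4\<close> suffices; the other bound keeps \<open>d\<close> below 1.\<close>
  define d where "d = min (1/2) (e / 4)"
  have d: "0 < d" "d < 1" "d \<le> e / 4" using e by (auto simp: d_def)
  let ?S = "\<lambda>n. \<Sum>i<m. min (\<integral>z. u i z \<partial>L) (\<integral>y. u i (f n y) \<partial>N n)"
  have "(\<lambda>n. \<integral>y. u i (f n y) \<partial>N n) \<longlonglongrightarrow> (\<integral>z. u i z \<partial>L)" for i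
    using u(1,2,3) by (intro weak) (auto simp: bounded_iff intro!: exI[of _ 1])
  then have "?S \<longlonglongrightarrow> (\<Sum>i<m. min (\<integral>z. u i z \<partial>L) (\<integral>z. u i z \<partial>L))"
    by (intro tendsto_intros)
  then have "?S \<longlonglongrightarrow> (\<Sum>i<m. \<integral>z. u i z \<partial>L)" by simp
  then have "\<forall>\<^sub>F n in sequentially. ?S n > 1 - e / 2"
    using u(6) e by (intro order_tendstoD(1)) auto
  then show ?thesis
  proof eventually_elim
    case (elim n)
    interpret N: prob_space "N n" by (rule N)
    obtain h where h: "coupling_density L (N n) h"
      "\<And>B. B \<in> sets (L \<Otimes>\<^sub>M N n) \<Longrightarrow> (\<And>z y i. (z, y) \<in> B \<Longrightarrow> i < m \<Longrightarrow> u i z * u i (f n y) = 0) \<Longrightarrow>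
      (\<integral>\<^sup>+z. \<integral>\<^sup>+y. ennreal (h z y) * indicator B (z, y) \<partial>N n \<partial>L) \<le> ennreal (1 - (1 - d) * ?S n)"
    proof (rule coupling_density_exists[OF L N[of n], of u "\<lambda>i y. u i (f n y)" m d])
      show "u i \<in> borel_measurable L" for i by measurable
      show "(\<lambda>y. u i (f n y)) \<in> borel_measurable (N n)" for i by measurable
    qed (use u d in auto)
    have "{(z, y). e < dist (f n y) z} \<inter> space (L \<Otimes>\<^sub>M N n) \<in> sets (L \<Otimes>\<^sub>M N n)"
      by (simp add: Int_def Collect_conj_eq[symmetric] conj_commute case_prod_beta) measurable
    define B where "B = {(z, y). e < dist (f n y) z} \<inter> space (L \<Otimes>\<^sub>M N n)"
    have B: "B \<in> sets (L \<Otimes>\<^sub>M N n)" unfolding B_def by fact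
    have "(\<integral>\<^sup>+z. \<integral>\<^sup>+y. ennreal (h z y) * indicator {(z, y). e < dist (f n y) z} (z, y) \<partial>N n \<partial>L)
      = (\<integral>\<^sup>+z. \<integral>\<^sup>+y. ennreal (h z y) * indicator B (z, y) \<partial>N n \<partial>L)"
      by (intro nn_integral_cong) (auto simp: B_def space_pair_measure indicator_def)
    also have "\<dots> \<le> ennreal (1 - (1 - d) * ?S n)"
    proof (rule h(2)[OF B])
      fix z y i assume "(z, y) \<in> B"
      then have "e < dist z (f n y)" by (simp add: B_def dist_commute)
      then show "u i z * u i (f n y) = 0" using u(5)[of i z "f n y"] by auto
    qed
    also have "1 - (1 - d) * ?S n \<le> e"
    proof -
      have "(1 - d) * (1 - e / 2) \<le> (1 - d) * ?S n" using elim d by (intro mult_left_mono) auto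
      moreover have "(1 - d) * (1 - e / 2) = 1 - e / 2 - d + d * (e / 2)" by (simp add: field_simps)
      moreover have "d * (e / 2) \<ge> 0" using d e by simp
      ultimately show ?thesis using d e by linarith
    qed
    finally show ?case using h(1) by (auto simp: ennreal_leI)
  qed
qed

lemma coupling_density_product:
  "prob_space L \<Longrightarrow> prob_space N \<Longrightarrow> coupling_density L N (\<lambda>_ _. 1)"
  by (auto simp: coupling_density_def prob_space.emeasure_space_1)

text \<open>A diagonal choice: at stage \<open>n\<close> the coupling has the finest accuracy
  \<open>1 / Suc k\<close> with \<open>k \<le> n\<close> that is attainable there.\<close>

lemma coupling_sequence:
  fixes L :: "'b::{metric_space, second_countable_topology} measure"
    and N :: "nat \<Rightarrow> 'c measure" and f :: "nat \<Rightarrow> 'c \<Rightarrow> 'b"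
  assumes L: "prob_space L" and setsL: "sets L = sets borel"
    and N: "\<And>n. prob_space (N n)" and f: "\<And>n. f n \<in> borel_measurable (N n)"
    and weak: "\<And>g :: 'b \<Rightarrow> real. continuous_on UNIV g \<Longrightarrow> bounded (range g) \<Longrightarrow>
      (\<lambda>n. \<integral>y. g (f n y) \<partial>N n) \<longlonglongrightarrow> (\<integral>z. g z \<partial>L)"
  obtains h where "\<And>n. coupling_density L (N n) (h n)"
    "\<And>e. e > 0 \<Longrightarrow> \<forall>\<^sub>F n in sequentially.
      (\<integral>\<^sup>+z. \<integral>\<^sup>+y. ennreal (h n z y) * indicator {(z, y). e < dist (f n y) z} (z, y) \<partial>N n \<partial>L) \<le> ennreal e"
proof -
  define mass where "mass n h e =
    (\<integral>\<^sup>+z. \<integral>\<^sup>+y. ennreal (h z y) * indicator {(z, y). e < dist (f n y) z} (z, y) \<partial>N n \<partial>L)" for n h e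
  define Q where "Q n k h \<longleftrightarrow> coupling_density L (N n) h \<and> mass n h (1 / real (Suc k)) \<le> ennreal (1 / real (Suc k))" for n k h
  \<comment> \<open>The cap \<open>k \<le> n\<close> makes the set finite, so that
    \<open>Max\<close> is attained; a fixed \<open>k\<close> respects it from stage \<open>k\<close>
    on.\<close>
  define K where "K n = {k. k \<le> n \<and> (\<exists>h. Q n k h)}" for n
  \<comment> \<open>As long as no accuracy is attainable, the independent coupling stands
    in.\<close>
  define h where "h n = (if K n = {} then (\<lambda>_ _. 1) else (SOME h. Q n (Max (K n)) h))" for n
  have fin: "finite (K n)" for n unfolding K_def by (rule finite_subset[of _ "{..n}"]) auto
  have Qh: "Q n (Max (K n)) (h n)" if "K n \<noteq> {}" for n
  proof -
    have "Max (K n) \<in> K n" using that fin by simp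
    then obtain h' where "Q n (Max (K n)) h'" unfolding K_def by blast
    then have "Q n (Max (K n)) (SOME h. Q n (Max (K n)) h)"
      by (rule someI[of "Q n (Max (K n))"])
    then show ?thesis using that by (simp add: h_def)
  qed
  have mono: "mass n h' e \<le> mass n h' e'" if "e' \<le> e" for n h' e e'
    unfolding mass_def using that
    by (intro nn_integral_mono mult_left_mono) (auto simp: indicator_def)
  have 1: "coupling_density L (N n) (h n)" for n
  proof (cases "K n = {}")
    case True
    then show ?thesis using coupling_density_product[OF L N[of n]] by (simp add: h_def)
  next
    case False
    from Qh[OF this] show ?thesis by (simp add: Q_def)
  qed
  have 2: "\<forall>\<^sub>F n in sequentially. mass n (h n) e \<le> ennreal e" if e: "e > 0" for e
  proof -
    obtain k where k: "1 / real (Suc k) < e"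
      using reals_Archimedean[OF e] by (auto simp: inverse_eq_divide)
    have "\<forall>\<^sub>F n in sequentially. \<exists>h. Q n k h"
      unfolding Q_def mass_def by (rule coupling_close[OF L setsL N f weak]) auto
    then show ?thesis using eventually_ge_at_top[of k]
    proof eventually_elim
      case (elim n)
      then have kK: "k \<in> K n" by (simp add: K_def)
      then have le: "k \<le> Max (K n)" using fin by simp
      then have le': "1 / real (Suc (Max (K n))) \<le> 1 / real (Suc k)" by (intro divide_left_mono) auto
      have "mass n (h n) e \<le> mass n (h n) (1 / real (Suc (Max (K n))))"
        using le' k by (intro mono) linarith
      also have "\<dots> \<le> ennreal (1 / real (Suc (Max (K n))))"
        using Qh[of n] kK unfolding Q_def by blast
      also have "\<dots> \<le> ennreal e" using le' k by (intro ennreal_leI) linarith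
      finally show ?case .
    qed
  qed
  show ?thesis using that[OF 1 2[unfolded mass_def]] .
qed

section \<open>Gluing the couplings along the limit variable\<close>

text \<open>Given the limit variable, the approximating variables are made conditionally independent.\<close>
definition coupling_kernel ::
    "(nat \<Rightarrow> 'c measure) \<Rightarrow> (nat \<Rightarrow> 'c \<Rightarrow> 'c \<Rightarrow> real) \<Rightarrow> 'c::topological_space \<Rightarrow> nat \<Rightarrow> 'c measure" where
  "coupling_kernel N h z n = (case n of 0 \<Rightarrow> return borel z | Suc i \<Rightarrow> density (N i) (\<lambda>y. ennreal (h i z y)))"

context
  fixes L :: "'c::topological_space measure" and N :: "nat \<Rightarrow> 'c measure" and h :: "nat \<Rightarrow> 'c \<Rightarrow> 'c \<Rightarrow> real"
  assumes L: "prob_space L" and setsL[measurable_cong, simp]: "sets L = sets borel"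
    and N: "\<And>n. prob_space (N n)" and setsN[measurable_cong, simp]: "\<And>n. sets (N n) = sets borel"
    and h: "\<And>n. coupling_density L (N n) (h n)"
begin

lemma coupling_measurable [measurable]: "(\<lambda>(z, y). h n z y) \<in> borel_measurable (L \<Otimes>\<^sub>M N n)"
  using h[of n] unfolding coupling_density_def by simp

lemma spaceL: "space L = UNIV" and spaceN: "space (N n) = UNIV"
  using sets_eq_imp_space_eq[OF setsL] sets_eq_imp_space_eq[OF setsN] by auto

lemma coupling_measurable2 [measurable]: "h n z \<in> borel_measurable (N n)"
  using measurable_compose[OF measurable_Pair1'[of z L "N n"] coupling_measurable[of n]] by (simp add: spaceL)

lemma sets_coupling_kernel: "sets (coupling_kernel N h z i) = sets borel"
  by (cases i) (auto simp: coupling_kernel_def)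

lemma prob_space_coupling_kernel: "prob_space (coupling_kernel N h z i)"
proof (cases i)
  case 0
  then show ?thesis by (simp add: coupling_kernel_def prob_space_return)
next
  case (Suc n)
  have "emeasure (density (N n) (\<lambda>y. ennreal (h n z y))) UNIV = (\<integral>\<^sup>+y. h n z y \<partial>N n)"
    using spaceN[of n] by (subst emeasure_density) (auto intro!: nn_integral_cong)
  then show ?thesis
    using h[of n] spaceN[of n] Suc unfolding coupling_density_def coupling_kernel_def
    by (intro prob_spaceI) auto
qed

lemma emeasure_coupling_kernel_measurable:
  assumes [measurable]: "A \<in> sets borel"
  shows "(\<lambda>z. emeasure (coupling_kernel N h z i) A) \<in> borel_measurable L"
proof (cases i)
  case 0
  then show ?thesis by (simp add: coupling_kernel_def)
next
  case (Suc n)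
  interpret N: prob_space "N n" by (rule N)
  have "(\<lambda>z. \<integral>\<^sup>+y. ennreal (h n z y) * indicator A y \<partial>N n) \<in> borel_measurable L"
    by measurable
  then show ?thesis unfolding Suc coupling_kernel_def by (simp add: emeasure_density)
qed

text \<open>The conditional law of the whole sequence given the limit value \<open>z\<close>: the
  point mass at \<open>z\<close> in coordinate 0 and the conditional densities in the others,
  independently.\<close>

definition product_kernel :: "'c \<Rightarrow> (nat \<Rightarrow> 'c) measure" where
  "product_kernel z = PiM UNIV (coupling_kernel N h z)"

lemma sets_product_kernel: "sets (product_kernel z) = sets (PiM UNIV (\<lambda>_::nat. borel :: 'c measure))"
  unfolding product_kernel_def by (intro sets_PiM_cong) (auto simp: sets_coupling_kernel)

lemma product_kernel_prob: "product_prob_space (coupling_kernel N h z)"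
  by (simp add: product_prob_space_def product_prob_space_axioms_def product_sigma_finite_def
      prob_space_coupling_kernel prob_space_imp_sigma_finite)

text \<open>Measurability in \<open>z\<close> is tested on finite cylinders, an intersection-stable
  generator, where the measure is a finite product of measurable functions.\<close>

lemma product_kernel_measurable:
  "product_kernel \<in> L \<rightarrow>\<^sub>M prob_algebra (PiM UNIV (\<lambda>_::nat. borel :: 'c measure))"
proof (rule measurable_prob_algebra_generated[OF sets_PiM Int_stable_prod_algebra prod_algebra_sets_into_space])
  fix z
  interpret product_prob_space "coupling_kernel N h z" UNIV by (rule product_kernel_prob)
  show "prob_space (product_kernel z)" unfolding product_kernel_def by unfold_locales
  show "sets (product_kernel z) = sets (PiM UNIV (\<lambda>_. borel))" by (rule sets_product_kernel)
next
  fix A assume "A \<in> prod_algebra UNIV (\<lambda>_::nat. borel :: 'c measure)"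
  then obtain J E where A: "A = prod_emb UNIV (\<lambda>_. borel) J (\<Pi>\<^sub>E j\<in>J. E j)" "finite J"
      "\<And>i. i \<in> J \<Longrightarrow> E i \<in> sets (borel :: 'c measure)"
    by (rule prod_algebraE) auto
  have "emeasure (product_kernel z) A = (\<Prod>j\<in>J. emeasure (coupling_kernel N h z j) (E j))" for z
  proof -
    interpret product_prob_space "coupling_kernel N h z" UNIV by (rule product_kernel_prob)
    have "A = prod_emb UNIV (coupling_kernel N h z) J (\<Pi>\<^sub>E j\<in>J. E j)"
      unfolding A(1) prod_emb_def using sets_eq_imp_space_eq[OF sets_coupling_kernel[of z]] by simp
    then show ?thesis unfolding product_kernel_def
      using A(2,3) by (simp add: emeasure_PiM_emb sets_coupling_kernel)
  qed
  then show "(\<lambda>z. emeasure (product_kernel z) A) \<in> borel_measurable L"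
    using A(3) emeasure_coupling_kernel_measurable by simp
qed

lemma product_kernel_subprob [measurable]:
  "product_kernel \<in> L \<rightarrow>\<^sub>M subprob_algebra (PiM UNIV (\<lambda>_::nat. borel :: 'c measure))"
  using product_kernel_measurable by (rule measurable_prob_algebraD)

lemma distr_product_kernel: "distr (product_kernel z) borel (\<lambda>\<omega>. \<omega> i) = coupling_kernel N h z i"
proof -
  interpret product_prob_space "coupling_kernel N h z" UNIV by (rule product_kernel_prob)
  have "distr (product_kernel z) borel (\<lambda>\<omega>. \<omega> i) = distr (product_kernel z) (coupling_kernel N h z i) (\<lambda>\<omega>. \<omega> i)"
    by (intro distr_cong) (simp_all add: sets_coupling_kernel)
  also have "\<dots> = coupling_kernel N h z i"
    unfolding product_kernel_def by (rule PiM_component) simp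
  finally show ?thesis .
qed

definition coupled :: "(nat \<Rightarrow> 'c) measure" where "coupled = L \<bind> product_kernel"

lemma sets_coupled: "sets coupled = sets (PiM UNIV (\<lambda>_::nat. borel :: 'c measure))"
  unfolding coupled_def by (intro sets_bind) (auto simp: sets_product_kernel spaceL)

lemma prob_space_coupled: "prob_space coupled"
proof -
  interpret L: prob_space L by (rule L)
  have "prob_space (product_kernel z)" for z
    using product_kernel_prob[of z] unfolding product_kernel_def
    by (intro prob_space_PiM prob_space_coupling_kernel)
  then show ?thesis unfolding coupled_def by (intro L.prob_space_bind[OF _ product_kernel_subprob]) simp
qed

lemma emeasure_coupled:
  "X \<in> sets (PiM UNIV (\<lambda>_::nat. borel :: 'c measure)) \<Longrightarrow>
    emeasure coupled X = (\<integral>\<^sup>+z. emeasure (product_kernel z) X \<partial>L)"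
  unfolding coupled_def by (intro emeasure_bind product_kernel_subprob) (auto simp: spaceL)

lemma emeasure_product_kernel_component:
  assumes [measurable]: "A \<in> sets borel"
  shows "emeasure (product_kernel z) {\<omega>. \<omega> i \<in> A} = emeasure (coupling_kernel N h z i) A"
proof -
  have "emeasure (distr (product_kernel z) borel (\<lambda>\<omega>. \<omega> i)) A = emeasure (product_kernel z) {\<omega>. \<omega> i \<in> A}"
    using sets_eq_imp_space_eq[OF sets_product_kernel[of z]]
    by (subst emeasure_distr) (auto simp: measurable_cong_sets[OF sets_product_kernel] space_PiM vimage_def)
  then show ?thesis by (simp add: distr_product_kernel)
qed

lemma component_sets: "A \<in> sets borel \<Longrightarrow> {\<omega>. \<omega> i \<in> A} \<in> sets (PiM UNIV (\<lambda>_::nat. borel :: 'c measure))"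
  using measurable_sets[OF measurable_component_singleton[of i UNIV "\<lambda>_. borel :: 'c measure"], of A]
  by (simp add: vimage_def space_PiM)

lemma measurable_coupled: "(\<lambda>\<omega>. \<omega> i) \<in> coupled \<rightarrow>\<^sub>M borel"
  by (simp add: measurable_cong_sets[OF sets_coupled])

lemma emeasure_distr_coupled:
  assumes "A \<in> sets borel"
  shows "emeasure (distr coupled borel (\<lambda>\<omega>. \<omega> i)) A = (\<integral>\<^sup>+z. emeasure (coupling_kernel N h z i) A \<partial>L)"
proof -
  have "emeasure (distr coupled borel (\<lambda>\<omega>. \<omega> i)) A = emeasure coupled {\<omega>. \<omega> i \<in> A}"
    using assms sets_eq_imp_space_eq[OF sets_coupled] measurable_coupled
    by (subst emeasure_distr) (auto simp: space_PiM vimage_def)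
  also have "\<dots> = (\<integral>\<^sup>+z. emeasure (product_kernel z) {\<omega>. \<omega> i \<in> A} \<partial>L)"
    by (intro emeasure_coupled component_sets assms)
  finally show ?thesis by (simp only: emeasure_product_kernel_component[OF assms])
qed

lemma distr_coupled_0: "distr coupled borel (\<lambda>\<omega>. \<omega> 0) = L"
proof (rule measure_eqI)
  fix A assume "A \<in> sets (distr coupled borel (\<lambda>\<omega>. \<omega> 0))"
  then have A: "A \<in> sets borel" by simp
  show "emeasure (distr coupled borel (\<lambda>\<omega>. \<omega> 0)) A = emeasure L A"
    unfolding emeasure_distr_coupled[OF A] using A by (simp add: coupling_kernel_def)
qed simp

text \<open>After the integrals are exchanged, the inner one is 1 by the second marginal condition
  of \<open>coupling_density\<close>.\<close>

lemma distr_coupled_Suc: "distr coupled borel (\<lambda>\<omega>. \<omega> (Suc n)) = N n"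
proof (rule measure_eqI)
  fix A assume "A \<in> sets (distr coupled borel (\<lambda>\<omega>. \<omega> (Suc n)))"
  then have A[measurable]: "A \<in> sets borel" by simp
  interpret N: prob_space "N n" by (rule N)
  interpret L: prob_space L by (rule L)
  interpret P: pair_sigma_finite L "N n" ..
  have "emeasure (distr coupled borel (\<lambda>\<omega>. \<omega> (Suc n))) A = (\<integral>\<^sup>+z. \<integral>\<^sup>+y. ennreal (h n z y) * indicator A y \<partial>N n \<partial>L)"
    unfolding emeasure_distr_coupled[OF A] by (simp add: coupling_kernel_def emeasure_density)
  also have "\<dots> = (\<integral>\<^sup>+y. \<integral>\<^sup>+z. ennreal (h n z y) * indicator A y \<partial>L \<partial>N n)"
    by (rule P.Fubini'[symmetric]) measurable
  also have "\<dots> = (\<integral>\<^sup>+y. (\<integral>\<^sup>+z. ennreal (h n z y) \<partial>L) * indicator A y \<partial>N n)"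
  proof (intro nn_integral_cong nn_integral_multc)
    fix y
    have "(\<lambda>z. h n z y) \<in> borel_measurable L"
      using measurable_compose[OF measurable_Pair2'[of y "N n" L] coupling_measurable[of n]] by (simp add: spaceN)
    then show "(\<lambda>z. ennreal (h n z y)) \<in> borel_measurable L" by measurable
  qed
  also have "\<dots> = (\<integral>\<^sup>+y. indicator A y \<partial>N n)"
    using h[of n] unfolding coupling_density_def by simp
  finally show "emeasure (distr coupled borel (\<lambda>\<omega>. \<omega> (Suc n))) A = emeasure (N n) A" by simp
qed simp

text \<open>Given \<open>z\<close>, coordinate 0 equals \<open>z\<close> almost surely, so the joint
  event reduces to its section at \<open>z\<close>; measurable singletons make this precise.\<close>

lemma emeasure_coupled_pair:
  assumes B: "{\<omega>. (\<omega> 0, \<omega> (Suc n)) \<in> B} \<in> sets (PiM UNIV (\<lambda>_::nat. borel :: 'c measure))"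
    and sec: "\<And>z. {y. (z, y) \<in> B} \<in> sets borel"
    and T1: "\<And>z :: 'c. {z} \<in> sets borel"
  shows "emeasure coupled {\<omega>. (\<omega> 0, \<omega> (Suc n)) \<in> B}
    = (\<integral>\<^sup>+z. \<integral>\<^sup>+y. ennreal (h n z y) * indicator B (z, y) \<partial>N n \<partial>L)"
proof -
  have "emeasure (product_kernel z) {\<omega>. (\<omega> 0, \<omega> (Suc n)) \<in> B}
      = (\<integral>\<^sup>+y. ennreal (h n z y) * indicator B (z, y) \<partial>N n)" for z
  proof -
    have null: "emeasure (product_kernel z) {\<omega>. \<omega> 0 \<in> - {z}} = 0"
      using T1[of z] by (subst emeasure_product_kernel_component) (auto simp: coupling_kernel_def)
    have ae: "AE \<omega> in product_kernel z. \<omega> 0 = z"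
    proof (rule AE_I[OF _ null])
      show "{\<omega>. \<omega> 0 \<in> - {z}} \<in> sets (product_kernel z)"
        unfolding sets_product_kernel using T1[of z] by (intro component_sets) auto
    qed auto
    have "emeasure (product_kernel z) {\<omega>. (\<omega> 0, \<omega> (Suc n)) \<in> B} = emeasure (product_kernel z) {\<omega>. \<omega> (Suc n) \<in> {y. (z, y) \<in> B}}"
      by (rule emeasure_eq_AE) (use ae in eventually_elim, simp, use B component_sets[OF sec] sets_product_kernel in auto)
    also have "\<dots> = emeasure (coupling_kernel N h z (Suc n)) {y. (z, y) \<in> B}"
      by (rule emeasure_product_kernel_component[OF sec])
    also have "\<dots> = (\<integral>\<^sup>+y. ennreal (h n z y) * indicator {y. (z, y) \<in> B} y \<partial>N n)"
      using sec[of z] by (simp add: coupling_kernel_def emeasure_density)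
    finally show ?thesis by (simp add: indicator_def)
  qed
  then show ?thesis by (simp add: emeasure_coupled[OF B])
qed

end

text \<open>Coordinate \<open>Suc n\<close> carries \<open>N n\<close> itself rather than its image
  under \<open>f n\<close>: the copies keep their exact law, and only their standardised images are
  close to the limit.\<close>

lemma skorokhod_in_probability:
  fixes L :: "'c::{metric_space, second_countable_topology} measure" and f :: "nat \<Rightarrow> 'c \<Rightarrow> 'c"
  assumes L: "prob_space L" "sets L = sets borel"
    and N: "\<And>n. prob_space (N n)" "\<And>n. sets (N n) = sets borel"
    and f: "\<And>n. f n \<in> borel_measurable borel"
    and weak: "\<And>g :: 'c \<Rightarrow> real. continuous_on UNIV g \<Longrightarrow> bounded (range g) \<Longrightarrow>
      (\<lambda>n. \<integral>y. g (f n y) \<partial>N n) \<longlonglongrightarrow> (\<integral>z. g z \<partial>L)"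
  obtains P :: "(nat \<Rightarrow> 'c) measure" where "prob_space P" "sets P = sets (PiM UNIV (\<lambda>_. borel))"
    "distr P borel (\<lambda>\<omega>. \<omega> 0) = L" "\<And>n. distr P borel (\<lambda>\<omega>. \<omega> (Suc n)) = N n"
    "\<And>e. e > 0 \<Longrightarrow> (\<lambda>n. measure P {\<omega> \<in> space P. e < dist (f n (\<omega> (Suc n))) (\<omega> 0)}) \<longlonglongrightarrow> 0"
proof -
  have fN: "f n \<in> borel_measurable (N n)" for n
    using f[of n] measurable_cong_sets[OF N(2)[of n] refl] by blast
  obtain h where h: "\<And>n. coupling_density L (N n) (h n)"
    "\<And>e. e > 0 \<Longrightarrow> \<forall>\<^sub>F n in sequentially.
      (\<integral>\<^sup>+z. \<integral>\<^sup>+y. ennreal (h n z y) * indicator {(z, y). e < dist (f n y) z} (z, y) \<partial>N n \<partial>L) \<le> ennreal e"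
    by (rule coupling_sequence[OF L N(1) fN weak]) blast+
  note ctx = L N h(1)
  define P where "P = coupled L N h"
  interpret P: prob_space P unfolding P_def by (rule prob_space_coupled[OF ctx])
  have setsP: "sets P = sets (PiM UNIV (\<lambda>_. borel))" unfolding P_def by (rule sets_coupled[OF ctx])
  have spaceP: "space P = UNIV" using sets_eq_imp_space_eq[OF setsP] by (simp add: space_PiM)
  have mass: "emeasure P {\<omega>. e < dist (f n (\<omega> (Suc n))) (\<omega> 0)}
      = (\<integral>\<^sup>+z. \<integral>\<^sup>+y. ennreal (h n z y) * indicator {(z, y). e < dist (f n y) z} (z, y) \<partial>N n \<partial>L)" for e n
  proof -
    note f[of n, measurable]
    have "{\<omega> \<in> space (PiM UNIV (\<lambda>_. borel)). e < dist (f n (\<omega> (Suc n))) (\<omega> 0)} \<in> sets (PiM UNIV (\<lambda>_::nat. borel :: 'c measure))"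
      by measurable
    then have B: "{\<omega>. (\<omega> 0, \<omega> (Suc n)) \<in> {(z, y). e < dist (f n y) z}} \<in> sets (PiM UNIV (\<lambda>_::nat. borel :: 'c measure))"
      by (simp add: space_PiM)
    have "{y \<in> space borel. e < dist (f n y) z} \<in> sets borel" for z by measurable
    then have sec: "{y. (z, y) \<in> {(z, y). e < dist (f n y) z}} \<in> sets borel" for z by simp
    have T1: "{z} \<in> sets borel" for z :: 'c by simp
    show ?thesis using emeasure_coupled_pair[OF ctx B sec T1] unfolding P_def by simp
  qed
  have lim: "(\<lambda>n. measure P {\<omega> \<in> space P. e < dist (f n (\<omega> (Suc n))) (\<omega> 0)}) \<longlonglongrightarrow> 0" if e: "e > 0" for e
  proof (rule tendstoI)
    fix r :: real assume "r > 0"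
    \<comment> \<open>One accuracy serves both as distance threshold, by \<open>s \<le> e\<close>,
      and as bound of the mass, by \<open>s < r\<close>.\<close>
    define s where "s = min e (r / 2)"
    have s: "s > 0" "s \<le> e" "s < r" using e \<open>r > 0\<close> by (auto simp: s_def)
    show "\<forall>\<^sub>F n in sequentially. dist (measure P {\<omega> \<in> space P. e < dist (f n (\<omega> (Suc n))) (\<omega> 0)}) 0 < r"
      using h(2)[OF s(1)]
    proof eventually_elim
      case (elim n)
      note f[of n, measurable]
      have ms: "{\<omega> \<in> space P. s < dist (f n (\<omega> (Suc n))) (\<omega> 0)} \<in> sets P"
        unfolding setsP sets_eq_imp_space_eq[OF setsP] by measurable
      have "emeasure P {\<omega> \<in> space P. s < dist (f n (\<omega> (Suc n))) (\<omega> 0)} \<le> ennreal s"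
        using elim mass[of s n] by (simp add: spaceP)
      then have "P.prob {\<omega> \<in> space P. s < dist (f n (\<omega> (Suc n))) (\<omega> 0)} \<le> s"
        using s by (simp add: P.emeasure_eq_measure)
      moreover have "P.prob {\<omega> \<in> space P. e < dist (f n (\<omega> (Suc n))) (\<omega> 0)} \<le> P.prob {\<omega> \<in> space P. s < dist (f n (\<omega> (Suc n))) (\<omega> 0)}"
        using ms s by (intro P.finite_measure_mono) auto
      ultimately show ?case using s by simp
    qed
  qed
  show ?thesis
  proof (rule that[of P])
    show "distr P borel (\<lambda>\<omega>. \<omega> 0) = L" unfolding P_def by (rule distr_coupled_0[OF ctx])
    show "distr P borel (\<lambda>\<omega>. \<omega> (Suc n)) = N n" for n unfolding P_def by (rule distr_coupled_Suc[OF ctx])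
  qed (fact P.prob_space_axioms setsP lim)+
qed

section \<open>Convergence in probability\<close>

text \<open>Joint convergence at the diagonal points \<open>(w, w)\<close> is made uniform by a
  finite subcover. The radii are doubled so that a point near some \<open>y\<close> in the ball of
  radius \<open>r w\<close> stays in the larger ball.\<close>

lemma uniform_null_on_compact:
  fixes \<psi> :: "nat \<Rightarrow> 'c::metric_space \<Rightarrow> 'c \<Rightarrow> real"
  assumes K: "compact K" and e: "e > 0"
    and lim: "\<And>w. ((\<lambda>(n, x, y). \<psi> n x y) \<longlongrightarrow> 0) (sequentially \<times>\<^sub>F (nhds w \<times>\<^sub>F nhds w))"
  obtains N \<delta> where "\<delta> > 0" "\<And>n x y. n \<ge> N \<Longrightarrow> y \<in> K \<Longrightarrow> dist x y < \<delta> \<Longrightarrow> \<bar>\<psi> n x y\<bar> < e"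
proof -
  have ex: "\<exists>N r. r > 0 \<and> (\<forall>n\<ge>N. \<forall>x y. dist w x < 2 * r \<longrightarrow> dist w y < 2 * r \<longrightarrow> \<bar>\<psi> n x y\<bar> < e)" for w
  proof -
    have "\<forall>\<^sub>F z in sequentially \<times>\<^sub>F (nhds w \<times>\<^sub>F nhds w). \<bar>\<psi> (fst z) (fst (snd z)) (snd (snd z))\<bar> < e"
      using tendstoD[OF lim[of w] e] by (simp add: case_prod_beta)
    then obtain P Q where P: "\<forall>\<^sub>F n in sequentially. P n" and Q: "\<forall>\<^sub>F z in nhds w \<times>\<^sub>F nhds w. Q z"
        and PQ: "\<And>n z. P n \<Longrightarrow> Q z \<Longrightarrow> \<bar>\<psi> n (fst z) (snd z)\<bar> < e"
      unfolding eventually_prod_filter[of _ sequentially] by auto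
    obtain N where N: "\<And>n. n \<ge> N \<Longrightarrow> P n" using P by (auto simp: eventually_sequentially)
    obtain Q1 Q2 where Q12: "\<forall>\<^sub>F x in nhds w. Q1 x" "\<forall>\<^sub>F x in nhds w. Q2 x" "\<And>x y. Q1 x \<Longrightarrow> Q2 y \<Longrightarrow> Q (x, y)"
      using Q unfolding eventually_prod_filter by blast
    have "\<forall>\<^sub>F x in nhds w. Q1 x \<and> Q2 x" using Q12 by (intro eventually_conj)
    then obtain d where d: "d > 0" "\<And>x. dist x w < d \<Longrightarrow> Q1 x \<and> Q2 x"
      by (auto simp: eventually_nhds_metric)
    show ?thesis
    proof (intro exI[of _ N] exI[of _ "d / 2"] conjI allI impI)
      fix n x y assume "n \<ge> N" "dist w x < 2 * (d / 2)" "dist w y < 2 * (d / 2)"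
      then show "\<bar>\<psi> n x y\<bar> < e"
        using PQ[OF N, of n "(x, y)"] Q12(3) d(2)[of x] d(2)[of y] by (simp add: dist_commute)
    qed (use d in simp)
  qed
  obtain N r where r: "\<And>w. r w > (0::real)"
      "\<And>w n x y. n \<ge> N w \<Longrightarrow> dist w x < 2 * r w \<Longrightarrow> dist w y < 2 * r w \<Longrightarrow> \<bar>\<psi> n x y\<bar> < e"
    using ex by metis
  have "K \<subseteq> (\<Union>w\<in>K. ball w (r w))" using r(1) by force
  then obtain C where C: "C \<subseteq> K" "finite C" "K \<subseteq> (\<Union>w\<in>C. ball w (r w))"
    using compactE_image[OF K, of K "\<lambda>w. ball w (r w)"] by auto
  define \<delta> where "\<delta> = Min (insert 1 (r ` C))"
  have \<delta>: "\<delta> > 0" "\<And>w. w \<in> C \<Longrightarrow> \<delta> \<le> r w" using C(2) r(1) by (auto simp: \<delta>_def)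
  define M where "M = Max (insert 0 (N ` C))"
  have M: "\<And>w. w \<in> C \<Longrightarrow> N w \<le> M" using C(2) by (simp add: M_def)
  show ?thesis
  proof (rule that[OF \<delta>(1), of M])
    fix n x y assume n: "n \<ge> M" and "y \<in> K" and xy: "dist x y < \<delta>"
    then obtain w where w: "w \<in> C" "dist w y < r w" using C(3) by (auto simp: subset_iff)
    have "dist w x \<le> dist w y + dist x y" by (rule dist_triangle2)
    then have "dist w x < 2 * r w" using w \<delta>(2)[OF w(1)] xy by linarith
    moreover have "dist w y < 2 * r w" using w r(1)[of w] by linarith
    ultimately show "\<bar>\<psi> n x y\<bar> < e" using r(2) M[OF w(1)] n by (meson order_trans)
  qed
qed

text \<open>A continuous mapping theorem for maps that change with \<open>n\<close> and also see the
  limit variable. The single variable \<open>W0\<close> is tight, and on a large closed ball,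
  compact by the Heine-Borel property, the maps vanish uniformly near the diagonal.\<close>

lemma small_o_prob_continuous_mapping:
  fixes W :: "nat \<Rightarrow> 'a \<Rightarrow> 'c::{heine_borel, second_countable_topology}" and W0 :: "'a \<Rightarrow> 'c"
  assumes P: "prob_space P"
    and W[measurable]: "\<And>n. W n \<in> borel_measurable P" "W0 \<in> borel_measurable P"
    and conv: "\<And>e. e > 0 \<Longrightarrow> (\<lambda>n. measure P {\<omega> \<in> space P. e < dist (W n \<omega>) (W0 \<omega>)}) \<longlonglongrightarrow> 0"
    and lim: "\<And>w. ((\<lambda>(n, x, y). \<psi> n x y) \<longlongrightarrow> 0) (sequentially \<times>\<^sub>F (nhds w \<times>\<^sub>F nhds w))"
    and R: "\<And>n. R n \<in> borel_measurable P"
    and eq: "\<forall>\<^sub>F n in sequentially. \<forall>\<omega>\<in>space P. R n \<omega> = \<psi> n (W n \<omega>) (W0 \<omega>) * c n"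
  shows "small_o_prob P R c"
  unfolding small_o_prob_def
proof (intro conjI allI impI R)
  interpret prob_space P by fact
  fix e :: real assume e: "e > 0"
  show "(\<lambda>n. measure P {\<omega> \<in> space P. \<bar>R n \<omega>\<bar> > e * \<bar>c n\<bar>}) \<longlonglongrightarrow> 0"
  proof (rule tendstoI)
    fix \<eta> :: real assume \<eta>: "\<eta> > 0"
    \<comment> \<open>\<open>undefined\<close> is merely some centre; the balls exhaust the
      space.\<close>
    define T where "T m = {\<omega> \<in> space P. dist undefined (W0 \<omega>) \<le> real m}" for m
    have T[measurable]: "T m \<in> events" for m unfolding T_def by measurable
    have "(\<lambda>m. prob (T m)) \<longlonglongrightarrow> prob (\<Union>m. T m)"
      by (intro finite_Lim_measure_incseq incseq_SucI) (auto simp: T_def)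
    moreover have "(\<Union>m. T m) = space P" unfolding T_def by (auto intro: real_arch_simple)
    ultimately have "(\<lambda>m. prob (T m)) \<longlonglongrightarrow> 1" by (simp add: prob_space)
    then have "\<forall>\<^sub>F m in sequentially. prob (T m) > 1 - \<eta> / 2" using \<eta> by (intro order_tendstoD(1)) auto
    then obtain m where m: "prob (T m) > 1 - \<eta> / 2"
      using eventually_happens'[OF sequentially_bot] by blast
    obtain N \<delta> where N: "\<delta> > 0" "\<And>n x y. n \<ge> N \<Longrightarrow> y \<in> cball undefined (real m) \<Longrightarrow> dist x y < \<delta> \<Longrightarrow> \<bar>\<psi> n x y\<bar> < e"
      using uniform_null_on_compact[OF compact_cball e lim] by metis
    have "\<forall>\<^sub>F n in sequentially. prob {\<omega> \<in> space P. \<delta> / 2 < dist (W n \<omega>) (W0 \<omega>)} < \<eta> / 2"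
      using conv[of "\<delta> / 2"] N(1) \<eta> by (intro order_tendstoD(2)) auto
    then show "\<forall>\<^sub>F n in sequentially. dist (measure P {\<omega> \<in> space P. \<bar>R n \<omega>\<bar> > e * \<bar>c n\<bar>}) 0 < \<eta>"
      using eq eventually_ge_at_top[of N]
    proof eventually_elim
      case (elim n)
      have "{\<omega> \<in> space P. \<bar>R n \<omega>\<bar> > e * \<bar>c n\<bar>} \<subseteq> (space P - T m) \<union> {\<omega> \<in> space P. \<delta> / 2 < dist (W n \<omega>) (W0 \<omega>)}"
      proof
        fix \<omega> assume \<omega>: "\<omega> \<in> {\<omega> \<in> space P. \<bar>R n \<omega>\<bar> > e * \<bar>c n\<bar>}"
        show "\<omega> \<in> (space P - T m) \<union> {\<omega> \<in> space P. \<delta> / 2 < dist (W n \<omega>) (W0 \<omega>)}"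
        proof (rule ccontr)
          assume "\<not> ?thesis"
          then have "W0 \<omega> \<in> cball undefined (real m)" "dist (W n \<omega>) (W0 \<omega>) < \<delta>"
            using \<omega> N(1) by (auto simp: T_def)
          then have "\<bar>\<psi> n (W n \<omega>) (W0 \<omega>)\<bar> < e" using N(2) elim(3) by blast
          then have "\<bar>\<psi> n (W n \<omega>) (W0 \<omega>)\<bar> * \<bar>c n\<bar> \<le> e * \<bar>c n\<bar>" by (intro mult_right_mono) auto
          then have "\<bar>R n \<omega>\<bar> \<le> e * \<bar>c n\<bar>" using elim(2) \<omega> by (simp add: abs_mult)
          then show False using \<omega> by simp
        qed
      qed
      then have "prob {\<omega> \<in> space P. \<bar>R n \<omega>\<bar> > e * \<bar>c n\<bar>}
          \<le> prob ((space P - T m) \<union> {\<omega> \<in> space P. \<delta> / 2 < dist (W n \<omega>) (W0 \<omega>)})"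
        by (intro finite_measure_mono) auto
      also have "\<dots> \<le> prob (space P - T m) + prob {\<omega> \<in> space P. \<delta> / 2 < dist (W n \<omega>) (W0 \<omega>)}"
        by (intro measure_Un_le) auto
      also have "prob (space P - T m) = 1 - prob (T m)" by (intro prob_compl) simp
      finally show ?case using m elim(1) by simp
    qed
  qed
qed

section \<open>Measurability of order statistics\<close>

lemma sorted_nth_le_iff:
  fixes x :: "'a::linorder"
  assumes "sorted xs" "j < length xs"
  shows "xs ! j \<le> x \<longleftrightarrow> j < length (filter (\<lambda>y. y \<le> x) xs)"
  using assms
proof (induction xs arbitrary: j)
  case (Cons y ys)
  show ?case
  proof (cases "y \<le> x")
    case True
    then show ?thesis using Cons by (cases j) auto
  next
    case False
    have all: "z > x" if "z \<in> set (y # ys)" for z using that Cons.prems(1) False by auto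
    then have "filter (\<lambda>y. y \<le> x) (y # ys) = []"
      using all unfolding filter_empty_conv not_le by blast
    moreover have "(y # ys) ! j > x" by (rule all[OF nth_mem[OF Cons.prems(2)]])
    ultimately show ?thesis by simp
  qed
qed simp

text \<open>A sublevel set of an order statistic is described by the number of entries that are at
  most \<open>x\<close>, and this count is measurable by recursion on the list.\<close>

lemma sort_nth_measurable:
  assumes "\<And>t. t \<in> set ts \<Longrightarrow> X t \<in> borel_measurable M"
  shows "(\<lambda>\<omega>. sort (map (\<lambda>t. X t \<omega> :: real) ts) ! j) \<in> borel_measurable M"
proof (cases "j < length ts")
  case True
  have cnt: "(\<lambda>\<omega>. length (filter (\<lambda>y. y \<le> x) (map (\<lambda>t. X t \<omega>) ts))) \<in> measurable M (count_space UNIV)" for x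
    using assms
  proof (induction ts)
    case (Cons t ts)
    have [measurable]: "X t \<in> borel_measurable M" using Cons.prems by simp
    have [measurable]: "(\<lambda>\<omega>. length (filter (\<lambda>y. y \<le> x) (map (\<lambda>t. X t \<omega>) ts))) \<in> measurable M (count_space UNIV)"
      using Cons by simp
    have "(\<lambda>\<omega>. length (filter (\<lambda>y. y \<le> x) (map (\<lambda>t. X t \<omega>) (t # ts)))) =
      (\<lambda>\<omega>. if X t \<omega> \<le> x then Suc (length (filter (\<lambda>y. y \<le> x) (map (\<lambda>t. X t \<omega>) ts)))
         else length (filter (\<lambda>y. y \<le> x) (map (\<lambda>t. X t \<omega>) ts)))"
      by auto
    then show ?case by simp
  qed simp
  have "sort (map (\<lambda>t. X t \<omega>) ts) ! j \<le> x \<longleftrightarrow> j < length (filter (\<lambda>y. y \<le> x) (map (\<lambda>t. X t \<omega>) ts))" for x \<omega>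
    using True sorted_nth_le_iff[of "sort (map (\<lambda>t. X t \<omega>) ts)" j x] by (simp add: filter_sort)
  note iff = this
  show ?thesis
  proof (rule borel_measurableI_le)
    fix x
    note cnt[of x, measurable]
    have "{\<omega> \<in> space M. j < length (filter (\<lambda>y. y \<le> x) (map (\<lambda>t. X t \<omega>) ts))} \<in> sets M" by measurable
    then show "{\<omega> \<in> space M. sort (map (\<lambda>t. X t \<omega>) ts) ! j \<le> x} \<in> sets M" by (simp only: iff)
  qed
next
  case False
  \<comment> \<open>An index outside the list yields a value that depends on the index and the
    length only, hence a constant in \<omega>.\<close>
  have "xs ! j = undefined (j - length xs)" if "length xs \<le> j" for xs :: "real list" and j
    using that
  proof (induction xs arbitrary: j)
    case Nil
    then show ?case by (simp add: nth_def)
  next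
    case (Cons x xs)
    then show ?case by (cases j) auto
  qed
  then have "(\<lambda>\<omega>. sort (map (\<lambda>t. X t \<omega> :: real) ts) ! j) = (\<lambda>_. undefined (j - length ts))" using False by (simp add: fun_eq_iff)
  then show ?thesis by simp
qed

lemma order_stat_measurable:
  assumes "\<And>t. t \<ge> 1 \<Longrightarrow> X t \<in> borel_measurable M"
  shows "order_stat X i n \<in> borel_measurable M"
  unfolding order_stat_def using assms by (intro sort_nth_measurable) auto

section \<open>Expectiles near a finite right endpoint\<close>

lemma expectile_loss_eq:
  "expectile_loss \<tau> u = (if u \<le> 0 then \<bar>\<tau> - 1\<bar> else \<bar>\<tau>\<bar>) * u\<^sup>2"
  by (simp add: expectile_loss_def)

text \<open>The derivative of the loss at \<open>u\<close> is
  \<open>2 * (\<tau> * max u 0 - (1 - \<tau>) * max (- u) 0)\<close>, and its quadratic coefficient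
  is \<tau> to the right of 0 and \<open>1 - \<tau>\<close> to the left; the smaller one bounds the
  curvature from below.\<close>

lemma expectile_loss_strongly_convex:
  assumes \<tau>: "0 < \<tau>" "\<tau> < 1"
  shows "expectile_loss \<tau> (u - t) - expectile_loss \<tau> u
    \<ge> - (2 * t * (\<tau> * max u 0 - (1 - \<tau>) * max (- u) 0)) + min \<tau> (1 - \<tau>) * t\<^sup>2"
proof -
  define m where "m = min \<tau> (1 - \<tau>)"
  have m: "m \<le> \<tau>" "m \<le> 1 - \<tau>" "m = \<tau> \<or> m = 1 - \<tau>" by (auto simp: m_def)
  have sq: "t\<^sup>2 \<ge> 0" by simp
  consider "u > 0" "u - t > 0" | "u \<le> 0" "u - t \<le> 0" | "u > 0" "u - t \<le> 0" | "u \<le> 0" "u - t > 0"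
    by linarith
  then show ?thesis
  proof cases
    case 1
    have "m * t\<^sup>2 \<le> \<tau> * t\<^sup>2" using m sq by (intro mult_right_mono) auto
    then show ?thesis using 1 \<tau> unfolding m_def[symmetric]
      by (simp add: expectile_loss_eq power2_eq_square algebra_simps)
  next
    case 2
    have "m * t\<^sup>2 \<le> (1 - \<tau>) * t\<^sup>2" using m sq by (intro mult_right_mono) auto
    then show ?thesis using 2 \<tau> unfolding m_def[symmetric]
      by (simp add: expectile_loss_eq power2_eq_square algebra_simps max_def)
  next
    case 3
    \<comment> \<open>The step crosses 0, so its part beyond 0 is no longer than the whole step;
      this pays for the drop in curvature when \<tau> exceeds 1/2.\<close>
    have "(t - u)\<^sup>2 \<le> t\<^sup>2" using 3 by (intro power_mono) auto
    then have "0 \<le> (1 - 2 * \<tau>) * (t - u)\<^sup>2 + (\<tau> - m) * t\<^sup>2"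
    proof (cases "2 * \<tau> \<le> 1")
      case False
      then have "m = 1 - \<tau>" by (auto simp: m_def)
      then have "(1 - 2 * \<tau>) * (t - u)\<^sup>2 + (\<tau> - m) * t\<^sup>2 = (2 * \<tau> - 1) * (t\<^sup>2 - (t - u)\<^sup>2)"
        by (simp only:) (simp add: algebra_simps)
      moreover have "0 \<le> (2 * \<tau> - 1) * (t\<^sup>2 - (t - u)\<^sup>2)"
        using False \<open>(t - u)\<^sup>2 \<le> t\<^sup>2\<close> by (intro mult_nonneg_nonneg) auto
      ultimately show ?thesis by (simp only:)
    qed (use m sq in auto)
    then show ?thesis using 3 \<tau> unfolding m_def[symmetric]
      by (simp add: expectile_loss_eq power2_eq_square algebra_simps)
  next
    case 4
    have "(u - t)\<^sup>2 \<le> (- t)\<^sup>2" using 4 by (intro power_mono) auto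
    then have "0 \<le> (2 * \<tau> - 1) * (u - t)\<^sup>2 + (1 - \<tau> - m) * t\<^sup>2"
    proof (cases "2 * \<tau> \<ge> 1")
      case False
      then have "m = \<tau>" by (auto simp: m_def)
      then have "(2 * \<tau> - 1) * (u - t)\<^sup>2 + (1 - \<tau> - m) * t\<^sup>2 = (1 - 2 * \<tau>) * (t\<^sup>2 - (u - t)\<^sup>2)"
        by (simp only:) (simp add: algebra_simps)
      moreover have "0 \<le> (1 - 2 * \<tau>) * (t\<^sup>2 - (u - t)\<^sup>2)"
        using False \<open>(u - t)\<^sup>2 \<le> (- t)\<^sup>2\<close> by (intro mult_nonneg_nonneg) auto
      ultimately show ?thesis by (simp only:)
    qed (use m sq in auto)
    then show ?thesis using 4 \<tau> m unfolding m_def[symmetric]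
      by (simp add: expectile_loss_eq power2_eq_square algebra_simps max_def)
  qed
qed

text \<open>The convexity bound at \<open>u\<close> with step \<open>t\<close> and at
  \<open>u - t\<close> with step \<open>- t\<close> bounds the difference from both sides. The
  growth is linear in \<open>u\<close>, so a first moment makes the expectile criterion
  finite.\<close>

lemma expectile_loss_diff_bound:
  assumes \<tau>: "0 < \<tau>" "\<tau> < 1"
  shows "\<bar>expectile_loss \<tau> (u - t) - expectile_loss \<tau> u\<bar> \<le> 2 * \<bar>t\<bar> * (\<bar>u\<bar> + \<bar>t\<bar>)"
proof -
  have g: "\<bar>2 * t * (\<tau> * max v 0 - (1 - \<tau>) * max (- v) 0)\<bar> \<le> 2 * \<bar>t\<bar> * (\<bar>u\<bar> + \<bar>t\<bar>)" if "\<bar>v\<bar> \<le> \<bar>u\<bar> + \<bar>t\<bar>" for v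
  proof -
    have "\<bar>\<tau> * max v 0 - (1 - \<tau>) * max (- v) 0\<bar> \<le> \<bar>v\<bar>"
    proof (cases "v \<ge> 0")
      case True
      then show ?thesis using \<tau> mult_left_le_one_le[of "\<bar>v\<bar>" \<tau>] by (simp add: abs_mult)
    next
      case False
      then show ?thesis using \<tau> mult_left_le_one_le[of "\<bar>v\<bar>" "1 - \<tau>"] by (simp add: abs_mult max_def)
    qed
    also note that
    finally show ?thesis by (simp add: abs_mult mult_left_mono)
  qed
  have m: "min \<tau> (1 - \<tau>) * t\<^sup>2 \<ge> 0" using \<tau> by simp
  have "\<bar>u - t\<bar> \<le> \<bar>u\<bar> + \<bar>t\<bar>" by linarith
  then show ?thesis
    using expectile_loss_strongly_convex[OF \<tau>, where u = u and t = t] g[of u] m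
      expectile_loss_strongly_convex[OF \<tau>, where u = "u - t" and t = "- t"] g[of "u - t"]
    by (simp add: abs_le_iff)
qed

text \<open>The root condition removes the linear term of the integrated convexity bound, so the
  criterion exceeds its value at \<xi> by at least a multiple of the squared distance. Uniqueness is
  essential, as \<open>arg_min\<close> only chooses some minimiser.\<close>

lemma expectile_eqI:
  assumes "prob_space M" and X: "integrable M X" and \<tau>: "0 < \<tau>" "\<tau> < 1"
    and root: "\<tau> * (\<integral>\<omega>. max (X \<omega> - \<xi>) 0 \<partial>M) = (1 - \<tau>) * (\<integral>\<omega>. max (\<xi> - X \<omega>) 0 \<partial>M)"
  shows "expectile M X \<tau> = \<xi>"
proof -
  interpret prob_space M by fact
  have [measurable]: "X \<in> borel_measurable M" using X by simp
  have [measurable]: "expectile_loss \<tau> \<in> borel_measurable borel"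
    unfolding expectile_loss_def by measurable
  let ?J = "\<lambda>\<theta>. \<integral>\<omega>. (expectile_loss \<tau> (X \<omega> - \<theta>) - expectile_loss \<tau> (X \<omega>)) \<partial>M"
  have int: "integrable M (\<lambda>\<omega>. expectile_loss \<tau> (X \<omega> - \<theta>) - expectile_loss \<tau> (X \<omega>))" for \<theta>
  proof (rule Bochner_Integration.integrable_bound)
    show "integrable M (\<lambda>\<omega>. 2 * \<bar>\<theta>\<bar> * (\<bar>X \<omega>\<bar> + \<bar>\<theta>\<bar>))" using X by simp
    show "AE \<omega> in M. norm (expectile_loss \<tau> (X \<omega> - \<theta>) - expectile_loss \<tau> (X \<omega>)) \<le> norm (2 * \<bar>\<theta>\<bar> * (\<bar>X \<omega>\<bar> + \<bar>\<theta>\<bar>))"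
      using expectile_loss_diff_bound[OF \<tau>] by (intro AE_I2) (simp add: abs_mult)
  qed measurable
  have ip: "integrable M (\<lambda>\<omega>. max (X \<omega> - \<xi>) 0)" "integrable M (\<lambda>\<omega>. max (\<xi> - X \<omega>) 0)"
    using X by auto
  have J: "?J \<theta> - ?J \<xi> \<ge> min \<tau> (1 - \<tau>) * (\<theta> - \<xi>)\<^sup>2" for \<theta>
  proof -
    let ?t = "\<theta> - \<xi>"
    have "(\<integral>\<omega>. - (2 * ?t * (\<tau> * max (X \<omega> - \<xi>) 0 - (1 - \<tau>) * max (\<xi> - X \<omega>) 0)) + min \<tau> (1 - \<tau>) * ?t\<^sup>2 \<partial>M)
      \<le> (\<integral>\<omega>. (expectile_loss \<tau> (X \<omega> - \<theta>) - expectile_loss \<tau> (X \<omega>)) - (expectile_loss \<tau> (X \<omega> - \<xi>) - expectile_loss \<tau> (X \<omega>)) \<partial>M)"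
    proof (rule integral_mono)
      fix \<omega>
      show "- (2 * ?t * (\<tau> * max (X \<omega> - \<xi>) 0 - (1 - \<tau>) * max (\<xi> - X \<omega>) 0)) + min \<tau> (1 - \<tau>) * ?t\<^sup>2
        \<le> (expectile_loss \<tau> (X \<omega> - \<theta>) - expectile_loss \<tau> (X \<omega>)) - (expectile_loss \<tau> (X \<omega> - \<xi>) - expectile_loss \<tau> (X \<omega>))"
        using expectile_loss_strongly_convex[OF \<tau>, where u = "X \<omega> - \<xi>" and t = ?t] by simp
    next
      show "integrable M (\<lambda>\<omega>. (expectile_loss \<tau> (X \<omega> - \<theta>) - expectile_loss \<tau> (X \<omega>)) - (expectile_loss \<tau> (X \<omega> - \<xi>) - expectile_loss \<tau> (X \<omega>)))"
        by (intro Bochner_Integration.integrable_diff int)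
    qed (use ip in auto)
    also have "\<dots> = ?J \<theta> - ?J \<xi>" using int by (intro Bochner_Integration.integral_diff)
    also have "(\<integral>\<omega>. - (2 * ?t * (\<tau> * max (X \<omega> - \<xi>) 0 - (1 - \<tau>) * max (\<xi> - X \<omega>) 0)) + min \<tau> (1 - \<tau>) * ?t\<^sup>2 \<partial>M)
        = - (2 * ?t * (\<tau> * (\<integral>\<omega>. max (X \<omega> - \<xi>) 0 \<partial>M) - (1 - \<tau>) * (\<integral>\<omega>. max (\<xi> - X \<omega>) 0 \<partial>M))) + min \<tau> (1 - \<tau>) * ?t\<^sup>2"
      using ip by (simp add: prob_space)
    finally show ?thesis using root by simp
  qed
  have min_pos: "min \<tau> (1 - \<tau>) > 0" using \<tau> by simp
  have uniq: "\<theta> = \<xi>" if "is_arg_min ?J (\<lambda>_. True) \<theta>" for \<theta>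
  proof (rule ccontr)
    assume "\<theta> \<noteq> \<xi>"
    then have "min \<tau> (1 - \<tau>) * (\<theta> - \<xi>)\<^sup>2 > 0" using min_pos by (intro mult_pos_pos) auto
    then have "?J \<xi> < ?J \<theta>" using J[of \<theta>] by linarith
    then show False using that unfolding is_arg_min_def by blast
  qed
  have "is_arg_min ?J (\<lambda>_. True) \<xi>"
    unfolding is_arg_min_def
  proof (intro conjI notI; (elim exE conjE)?)
    fix \<theta> assume "?J \<theta> < ?J \<xi>"
    moreover have "min \<tau> (1 - \<tau>) * (\<theta> - \<xi>)\<^sup>2 \<ge> 0" using min_pos by (intro mult_nonneg_nonneg) auto
    ultimately show False using J[of \<theta>] by linarith
  qed simp
  then show ?thesis unfolding expectile_def arg_min_def using uniq by (rule someI2)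
qed

section \<open>The excess function and its tail integral\<close>

locale bounded_above = prob_space +
  fixes X :: "'a \<Rightarrow> real" and xs :: real
  assumes X_int: "integrable M X"
    and X_le: "AE \<omega> in M. X \<omega> \<le> xs"
begin

lemma X_meas [measurable]: "X \<in> borel_measurable M" using X_int by simp

definition excess :: "real \<Rightarrow> real" where "excess \<xi> = (\<integral>\<omega>. max (X \<omega> - \<xi>) 0 \<partial>M)"

lemma excess_integrable: "integrable M (\<lambda>\<omega>. max (X \<omega> - \<xi>) 0)"
  using X_int by auto

lemma excess_nonneg: "0 \<le> excess \<xi>"
  unfolding excess_def by (intro integral_nonneg_AE) auto

text \<open>A layer-cake formula in the distance \<open>t\<close> from the endpoint: for
  \<open>X \<le> xs\<close> the excess is the length of the set of \<open>t\<close> with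
  \<open>xs - X < t \<le> xs - \<xi>\<close>, and Fubini exchanges it with the expectation.\<close>

lemma excess_layer:
  assumes "\<xi> \<le> xs"
  shows "ennreal (excess \<xi>) =
    (\<integral>\<^sup>+t. ennreal (prob {\<omega> \<in> space M. xs - t < X \<omega>}) * indicator {0..xs - \<xi>} t \<partial>lborel)"
proof -
  interpret P: pair_sigma_finite M lborel ..
  have "ennreal (excess \<xi>) = (\<integral>\<^sup>+\<omega>. ennreal (max (X \<omega> - \<xi>) 0) \<partial>M)"
    unfolding excess_def by (intro nn_integral_eq_integral[symmetric] excess_integrable) auto
  also have "\<dots> = (\<integral>\<^sup>+\<omega>. \<integral>\<^sup>+t. indicator {(\<omega>, t). xs - t < X \<omega> \<and> 0 \<le> t \<and> t \<le> xs - \<xi>} (\<omega>, t) \<partial>lborel \<partial>M)"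
  proof (rule nn_integral_cong_AE)
    show "AE \<omega> in M. ennreal (max (X \<omega> - \<xi>) 0) =
        (\<integral>\<^sup>+t. indicator {(\<omega>, t). xs - t < X \<omega> \<and> 0 \<le> t \<and> t \<le> xs - \<xi>} (\<omega>, t) \<partial>lborel)"
      using X_le
    proof eventually_elim
      case (elim \<omega>)
      have "(\<integral>\<^sup>+t. indicator {(\<omega>, t). xs - t < X \<omega> \<and> 0 \<le> t \<and> t \<le> xs - \<xi>} (\<omega>, t) \<partial>lborel)
        = (\<integral>\<^sup>+t. indicator {xs - X \<omega> <.. xs - \<xi>} t \<partial>lborel)"
        using elim by (intro nn_integral_cong) (auto simp: indicator_def)
      also have "\<dots> = ennreal (max (X \<omega> - \<xi>) 0)"
        by (cases "xs - X \<omega> \<le> xs - \<xi>") auto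
      finally show ?case by simp
    qed
  qed
  also have "\<dots> = (\<integral>\<^sup>+t. \<integral>\<^sup>+\<omega>. indicator {(\<omega>, t). xs - t < X \<omega> \<and> 0 \<le> t \<and> t \<le> xs - \<xi>} (\<omega>, t) \<partial>M \<partial>lborel)"
    by (rule P.Fubini'[symmetric]) (simp add: case_prod_beta indicator_def)
  also have "\<dots> = (\<integral>\<^sup>+t. ennreal (prob {\<omega> \<in> space M. xs - t < X \<omega>}) * indicator {0..xs - \<xi>} t \<partial>lborel)"
  proof (rule nn_integral_cong)
    fix t :: real
    have "(\<integral>\<^sup>+\<omega>. indicator {(\<omega>, t). xs - t < X \<omega> \<and> 0 \<le> t \<and> t \<le> xs - \<xi>} (\<omega>, t) \<partial>M)
      = (\<integral>\<^sup>+\<omega>. indicator {\<omega> \<in> space M. xs - t < X \<omega>} \<omega> * indicator {0..xs - \<xi>} t \<partial>M)"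
      by (intro nn_integral_cong) (auto simp: indicator_def)
    also have "\<dots> = ennreal (prob {\<omega> \<in> space M. xs - t < X \<omega>}) * indicator {0..xs - \<xi>} t"
      by (subst nn_integral_multc) (auto simp: emeasure_eq_measure)
    finally show "(\<integral>\<^sup>+\<omega>. indicator {(\<omega>, t). xs - t < X \<omega> \<and> 0 \<le> t \<and> t \<le> xs - \<xi>} (\<omega>, t) \<partial>M)
      = ennreal (prob {\<omega> \<in> space M. xs - t < X \<omega>}) * indicator {0..xs - \<xi>} t" .
  qed
  finally show ?thesis .
qed

lemma powr_layer:
  assumes "c \<ge> 0" "\<theta> > 0" "y \<ge> (0::real)"
  shows "(\<integral>\<^sup>+t. ennreal (c * t powr \<theta>) * indicator {0..y} t \<partial>lborel) = ennreal (c * (y powr (1 + \<theta>) / (1 + \<theta>)))"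
proof -
  have "((\<lambda>t. c * t powr \<theta>) has_integral (c * (y powr (\<theta> + 1) / (\<theta> + 1)))) {0..y}"
    using assms by (intro has_integral_mult_right has_integral_powr_from_0) auto
  from nn_integral_has_integral_lebesgue'[OF _ this] show ?thesis using assms by (simp add: add.commute)
qed

text \<open>Bounds of the tail obtained from quantiles are available for \<open>t > 0\<close> only;
  the point 0 is dropped as a null set.\<close>

lemma excess_le:
  assumes "\<xi> \<le> xs" "c \<ge> 0" "\<theta> > 0"
    and "\<And>t. 0 < t \<Longrightarrow> t \<le> xs - \<xi> \<Longrightarrow> prob {\<omega> \<in> space M. xs - t < X \<omega>} \<le> c * t powr \<theta>"
  shows "excess \<xi> \<le> c * ((xs - \<xi>) powr (1 + \<theta>) / (1 + \<theta>))"
proof -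
  have 0: "AE t in lborel. t \<noteq> (0::real)" by (rule AE_lborel_singleton)
  have "ennreal (excess \<xi>) \<le> (\<integral>\<^sup>+t. ennreal (c * t powr \<theta>) * indicator {0..xs - \<xi>} t \<partial>lborel)"
    unfolding excess_layer[OF assms(1)]
    by (intro nn_integral_mono_AE) (use 0 in eventually_elim, auto simp: indicator_def assms intro!: ennreal_leI)
  then show ?thesis using assms by (simp add: powr_layer ennreal_le_iff)
qed

lemma excess_ge:
  assumes "\<xi> \<le> xs" "c \<ge> 0" "\<theta> > 0"
    and "\<And>t. 0 < t \<Longrightarrow> t \<le> xs - \<xi> \<Longrightarrow> c * t powr \<theta> \<le> prob {\<omega> \<in> space M. xs - t < X \<omega>}"
  shows "c * ((xs - \<xi>) powr (1 + \<theta>) / (1 + \<theta>)) \<le> excess \<xi>"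
proof -
  have 0: "AE t in lborel. t \<noteq> (0::real)" by (rule AE_lborel_singleton)
  have "(\<integral>\<^sup>+t. ennreal (c * t powr \<theta>) * indicator {0..xs - \<xi>} t \<partial>lborel) \<le> ennreal (excess \<xi>)"
    unfolding excess_layer[OF assms(1)]
    by (intro nn_integral_mono_AE) (use 0 in eventually_elim, auto simp: indicator_def assms intro!: ennreal_leI)
  then show ?thesis using assms excess_nonneg by (simp add: powr_layer ennreal_le_iff)
qed

end

section \<open>Quantiles and the right endpoint of a distribution function\<close>

context real_distribution
begin

lemma cdf_level_set:
  assumes "s > 1"
  shows "{x. 1 - 1 / s \<le> cdf M x} \<noteq> {}" "bdd_below {x. 1 - 1 / s \<le> cdf M x}"
proof -
  have "\<forall>\<^sub>F x in at_bot. cdf M x < 1 - 1 / s"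
    using assms by (intro order_tendstoD(2)[OF cdf_lim_at_bot]) auto
  then obtain b where b: "cdf M b < 1 - 1 / s" using eventually_happens'[OF trivial_limit_at_bot_linorder] by blast
  show "bdd_below {x. 1 - 1 / s \<le> cdf M x}"
  proof (rule bdd_belowI[of _ b])
    fix x assume "x \<in> {x. 1 - 1 / s \<le> cdf M x}"
    then show "b \<le> x" using b cdf_nondecreasing[of x b] by force
  qed
  have "\<forall>\<^sub>F x in at_top. cdf M x > 1 - 1 / s"
    using assms by (intro order_tendstoD(1)[OF cdf_lim_at_top_prob]) auto
  then show "{x. 1 - 1 / s \<le> cdf M x} \<noteq> {}"
    using eventually_happens'[OF trivial_limit_at_top_linorder] by (metis (mono_tags, lifting) empty_iff less_imp_le mem_Collect_eq)
qed

text \<open>Only points strictly on one side of the quantile are treated, which spares the question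
  whether the infimum is attained.\<close>

lemma cdf_tail_quantile:
  assumes "s > 1"
  shows "x < tail_quantile (cdf M) s \<Longrightarrow> cdf M x < 1 - 1 / s"
    "tail_quantile (cdf M) s < x \<Longrightarrow> 1 - 1 / s \<le> cdf M x"
proof -
  note level = cdf_level_set[OF assms]
  show "cdf M x < 1 - 1 / s" if "x < tail_quantile (cdf M) s"
    using that level unfolding tail_quantile_def quantile_def by (metis cInf_lower mem_Collect_eq not_less)
  show "1 - 1 / s \<le> cdf M x" if x: "tail_quantile (cdf M) s < x"
  proof -
    obtain y where "1 - 1 / s \<le> cdf M y" "y < x"
      using x level unfolding tail_quantile_def quantile_def by (subst (asm) cInf_less_iff) auto
    then show ?thesis using cdf_nondecreasing[of y x] by linarith
  qed
qed

lemma tail_quantile_mono: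
  assumes "1 < s" "s \<le> t"
  shows "tail_quantile (cdf M) s \<le> tail_quantile (cdf M) t"
  unfolding tail_quantile_def quantile_def
proof (rule cInf_superset_mono)
  have "1 / t \<le> 1 / s" using assms by (intro divide_left_mono) auto
  then show "{x. 1 - 1 / t \<le> cdf M x} \<subseteq> {x. 1 - 1 / s \<le> cdf M x}" by auto
qed (use cdf_level_set[of s] cdf_level_set[of t] assms in auto)

lemma right_endpoint_eq:
  assumes lim: "(tail_quantile (cdf M) \<longlongrightarrow> l) at_top"
    and le: "\<And>s. s > 1 \<Longrightarrow> tail_quantile (cdf M) s \<le> l"
  shows "x < l \<Longrightarrow> cdf M x < 1" "cdf M l = 1" "right_endpoint (cdf M) = l"
proof -
  show less: "cdf M x < 1" if "x < l" for x
  proof -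
    have "\<forall>\<^sub>F s in at_top. x < tail_quantile (cdf M) s \<and> s > 1"
      using order_tendstoD(1)[OF lim that] eventually_gt_at_top[of 1] by (rule eventually_conj)
    then obtain s where s: "x < tail_quantile (cdf M) s" "s > 1"
      using eventually_happens'[OF trivial_limit_at_top_linorder] by blast
    have "cdf M x < 1 - 1 / s" by (rule cdf_tail_quantile(1)[OF s(2,1)])
    also have "\<dots> < 1" using s by simp
    finally show ?thesis .
  qed
  have one: "cdf M x = 1" if "x > l" for x
  proof (rule ccontr)
    assume "cdf M x \<noteq> 1"
    then have lt: "cdf M x < 1" using cdf_bounded_prob[of x] by linarith
    \<comment> \<open>Then \<open>1 - 1 / s\<close> lies halfway between \<open>cdf M x\<close> and
      1, hence strictly above \<open>cdf M x\<close>.\<close>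
    define s where "s = 2 / (1 - cdf M x)"
    have "1 - cdf M x \<le> 1" using cdf_nonneg[of x] by simp
    then have s: "s > 1" "1 / s = (1 - cdf M x) / 2" using lt by (auto simp: s_def less_divide_eq)
    have "1 - 1 / s \<le> cdf M x" using le[OF s(1)] that by (intro cdf_tail_quantile(2)[OF s(1)]) linarith
    then show False using s(2) lt by (simp add: field_simps)
  qed
  \<comment> \<open>The values to the right of \<open>l\<close> are 1, and right continuity carries
    this to \<open>l\<close>.\<close>
  have "(cdf M \<longlongrightarrow> cdf M l) (at_right l)"
    using cdf_is_right_cont[of l] by (simp add: continuous_within)
  moreover have "(cdf M \<longlongrightarrow> 1) (at_right l)"
    by (rule tendsto_eventually) (use eventually_at_right_less[of l] in eventually_elim, use one in simp)
  ultimately show l: "cdf M l = 1" by (rule tendsto_unique[OF trivial_limit_at_right_real])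
  have "{x. cdf M x < 1} = {..<l}"
  proof (intro equalityI subsetI)
    fix x assume "x \<in> {x. cdf M x < 1}"
    then show "x \<in> {..<l}" using cdf_nondecreasing[of l x] l by (auto simp: not_less[symmetric])
  qed (use less in auto)
  then show "right_endpoint (cdf M) = l" by (simp add: right_endpoint_def)
qed

end

section \<open>The expectile equation and the inversion of quantile bounds\<close>

context bounded_above
begin

abbreviation "\<mu> \<equiv> expectation X"
abbreviation "F \<equiv> cdf (distr M borel X)"

lemma excess_lipschitz: "\<bar>excess x - excess y\<bar> \<le> \<bar>x - y\<bar>"
proof -
  have "\<bar>excess x - excess y\<bar> = \<bar>\<integral>\<omega>. max (X \<omega> - x) 0 - max (X \<omega> - y) 0 \<partial>M\<bar>"
    unfolding excess_def by (simp only: Bochner_Integration.integral_diff[OF excess_integrable excess_integrable])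
  also have "\<dots> \<le> (\<integral>\<omega>. \<bar>max (X \<omega> - x) 0 - max (X \<omega> - y) 0\<bar> \<partial>M)" by (rule integral_abs_bound)
  also have "\<dots> \<le> (\<integral>\<omega>. \<bar>x - y\<bar> \<partial>M)"
    using excess_integrable by (intro integral_mono) auto
  finally show ?thesis by (simp add: prob_space)
qed

lemma excess_continuous: "continuous_on S excess"
proof (rule continuous_on_subset[OF _ subset_UNIV], rule continuous_onI)
  fix x e :: real assume "e > 0"
  then show "\<exists>d>0. \<forall>x'\<in>UNIV. dist x' x < d \<longrightarrow> dist (excess x') (excess x) \<le> e"
    using excess_lipschitz order_trans unfolding dist_real_def by (metis less_imp_le)
qed

lemma excess_antimono: "x \<le> y \<Longrightarrow> excess y \<le> excess x"
  unfolding excess_def using excess_integrable by (intro integral_mono) auto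

lemma excess_pos:
  assumes "prob {\<omega> \<in> space M. x < X \<omega>} > 0"
  shows "excess x > 0"
proof (rule ccontr)
  assume "\<not> ?thesis"
  then have "excess x = 0" using excess_nonneg[of x] by simp
  then have "AE \<omega> in M. max (X \<omega> - x) 0 = 0"
    unfolding excess_def using excess_integrable[of x]
    by (subst (asm) integral_nonneg_eq_0_iff_AE) auto
  then have "AE \<omega> in M. \<omega> \<notin> {\<omega> \<in> space M. x < X \<omega>}" by eventually_elim auto
  then have "prob {\<omega> \<in> space M. x < X \<omega>} = 0"
    by (subst (asm) AE_iff_measurable[OF _ refl]) (auto simp: measure_def)
  then show False using assms by simp
qed

text \<open>The variable is dominated by a two-valued one that drops from \<open>xs\<close> to
  \<open>t\<close> where \<open>X \<le> t\<close>; the mass there makes its mean strictly smaller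
  than \<open>xs\<close>.\<close>

lemma mean_less:
  assumes "t < xs" "prob {\<omega> \<in> space M. X \<omega> \<le> t} > 0"
  shows "\<mu> < xs"
proof -
  let ?A = "{\<omega> \<in> space M. X \<omega> \<le> t}"
  have int: "integrable M (\<lambda>\<omega>. xs - (xs - t) * indicator ?A \<omega>)" by (auto simp: emeasure_eq_measure)
  have "\<mu> \<le> (\<integral>\<omega>. xs - (xs - t) * indicator ?A \<omega> \<partial>M)"
  proof (rule integral_mono_AE[OF X_int int])
    show "AE \<omega> in M. X \<omega> \<le> xs - (xs - t) * indicator ?A \<omega>"
      using X_le by eventually_elim (auto simp: indicator_def)
  qed
  also have "\<dots> = xs - (xs - t) * prob ?A" by (simp add: prob_space emeasure_eq_measure)
  finally show ?thesis using assms by (smt (verit) mult_pos_pos)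
qed

text \<open>The function \<Psi> is nonpositive at \<mu> and positive at \<open>xs\<close>, where the
  excess vanishes, so it has a root. The identity
  \<open>max (\<xi> - X) 0 = max (X - \<xi>) 0 + (\<xi> - X)\<close> shows that the root satisfies
  the first-order condition of the expectile.\<close>

lemma expectile_root:
  assumes p: "0 < p" "p < 1 / 2" and "\<mu> < xs" and "prob {\<omega> \<in> space M. \<mu> < X \<omega>} > 0"
  shows "\<mu> \<le> expectile M X (1 - p)" "expectile M X (1 - p) < xs"
    "(1 - 2 * p) * excess (expectile M X (1 - p)) = p * (expectile M X (1 - p) - \<mu>)"
proof -
  define \<Psi> where "\<Psi> \<xi> = p * (\<xi> - \<mu>) - (1 - 2 * p) * excess \<xi>" for \<xi>
  have "excess xs = 0"
    unfolding excess_def using X_le by (subst integral_cong_AE[where g = "\<lambda>_. 0"]) auto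
  then have "\<Psi> xs > 0" using p \<open>\<mu> < xs\<close> by (simp add: \<Psi>_def)
  moreover have "\<Psi> \<mu> \<le> 0" using p excess_nonneg[of \<mu>] by (simp add: \<Psi>_def)
  moreover have "continuous_on {\<mu>..xs} \<Psi>"
    unfolding \<Psi>_def by (intro continuous_intros excess_continuous)
  ultimately obtain \<xi> where \<xi>: "\<mu> \<le> \<xi>" "\<xi> \<le> xs" "\<Psi> \<xi> = 0"
    using IVT'[of \<Psi> \<mu> 0 xs] \<open>\<mu> < xs\<close> by auto
  have "\<xi> \<noteq> xs" using \<xi>(3) \<open>\<Psi> xs > 0\<close> by auto
  have "(\<integral>\<omega>. max (\<xi> - X \<omega>) 0 \<partial>M) = (\<integral>\<omega>. max (X \<omega> - \<xi>) 0 + (\<xi> - X \<omega>) \<partial>M)"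
    by (intro Bochner_Integration.integral_cong) auto
  also have "\<dots> = excess \<xi> + (\<xi> - \<mu>)"
    using excess_integrable[of \<xi>] X_int by (simp add: excess_def prob_space)
  finally have "(1 - p) * excess \<xi> = (1 - (1 - p)) * (\<integral>\<omega>. max (\<xi> - X \<omega>) 0 \<partial>M)"
    using \<xi>(3) by (simp only: \<Psi>_def) (simp add: algebra_simps)
  then have "expectile M X (1 - p) = \<xi>"
    using p unfolding excess_def by (intro expectile_eqI X_int prob_space_axioms) auto
  with \<xi> \<open>\<xi> \<noteq> xs\<close> show "\<mu> \<le> expectile M X (1 - p)" "expectile M X (1 - p) < xs"
    "(1 - 2 * p) * excess (expectile M X (1 - p)) = p * (expectile M X (1 - p) - \<mu>)"
    by (auto simp: \<Psi>_def)
qed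

lemma prob_gt_eq: "prob {\<omega> \<in> space M. x < X \<omega>} = 1 - F x"
proof -
  have "F x = prob {\<omega> \<in> space M. X \<omega> \<le> x}"
    unfolding cdf_def by (subst measure_distr) (auto intro!: arg_cong[where f = prob])
  moreover have "{\<omega> \<in> space M. x < X \<omega>} = space M - {\<omega> \<in> space M. X \<omega> \<le> x}" by auto
  ultimately show ?thesis by (simp add: prob_compl)
qed

lemma cdf_tail_quantile:
  assumes "s > 1"
  shows "x < tail_quantile F s \<Longrightarrow> F x < 1 - 1 / s" "tail_quantile F s < x \<Longrightarrow> 1 - 1 / s \<le> F x"
proof -
  interpret D: real_distribution "distr M borel X" by (rule real_distribution_distr) simp
  show "x < tail_quantile F s \<Longrightarrow> F x < 1 - 1 / s" "tail_quantile F s < x \<Longrightarrow> 1 - 1 / s \<le> F x"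
    using D.cdf_tail_quantile[OF assms] by blast+
qed

text \<open>The quantile expansion is inverted at the points where
  \<open>\<kappa> * (1 + d) * s powr \<gamma>\<close>, respectively
  \<open>\<kappa> * (1 - d) * s powr \<gamma>\<close>, equals \<open>t\<close>; the bound on
  \<open>t\<close> keeps these points above \<open>S\<close>. The strict error bound puts
  \<open>xs - t\<close> strictly on one side of the quantile.\<close>

lemma tail_bounds:
  assumes \<gamma>: "\<gamma> < 0" and \<kappa>: "\<kappa> > 0" and d: "0 \<le> d" "d < 1" and S: "S > 1"
    and V: "\<And>s. s \<ge> S \<Longrightarrow> \<bar>(xs - tail_quantile F s) / (\<kappa> * s powr \<gamma>) - 1\<bar> < d"
    and t: "0 < t" "t \<le> \<kappa> * (1 - d) * S powr \<gamma>"
  shows "(\<kappa> * (1 + d)) powr (1 / \<gamma>) * t powr (- 1 / \<gamma>) \<le> prob {\<omega> \<in> space M. xs - t < X \<omega>}"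
    and "prob {\<omega> \<in> space M. xs - t < X \<omega>} \<le> (\<kappa> * (1 - d)) powr (1 / \<gamma>) * t powr (- 1 / \<gamma>)"
proof -
  have key: "\<exists>s\<ge>S. \<kappa> * e * s powr \<gamma> = t \<and> 1 / s = (\<kappa> * e) powr (1 / \<gamma>) * t powr (- 1 / \<gamma>)" if e: "e \<ge> 1 - d" for e
  proof (intro exI conjI)
    have e0: "e > 0" "\<kappa> * e > 0" using e d \<kappa> by auto
    define s where "s = (t / (\<kappa> * e)) powr (1 / \<gamma>)"
    have "t \<le> \<kappa> * e * S powr \<gamma>"
    proof -
      have "\<kappa> * (1 - d) * S powr \<gamma> \<le> \<kappa> * e * S powr \<gamma>"
        using \<kappa> e by (intro mult_right_mono mult_left_mono) auto
      then show ?thesis using t by linarith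
    qed
    then have "t / (\<kappa> * e) \<le> S powr \<gamma>" using e0 by (simp add: field_simps)
    then have "(S powr \<gamma>) powr (1 / \<gamma>) \<le> s"
      unfolding s_def using \<gamma> t e0 by (intro powr_mono2') (auto simp: divide_simps)
    then show "S \<le> s" using \<gamma> S by (simp add: powr_powr)
    show "\<kappa> * e * s powr \<gamma> = t" using \<gamma> \<kappa> t e0 by (simp add: s_def powr_powr)
    have "1 / s = (t / (\<kappa> * e)) powr (- (1 / \<gamma>))" by (simp only: s_def powr_minus_divide)
    also have "\<dots> = t powr (- (1 / \<gamma>)) / (\<kappa> * e) powr (- (1 / \<gamma>))"
      using t e0 by (simp add: powr_divide)
    also have "\<dots> = (\<kappa> * e) powr (1 / \<gamma>) * t powr (- 1 / \<gamma>)"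
      by (simp add: powr_minus_divide)
    finally show "1 / s = (\<kappa> * e) powr (1 / \<gamma>) * t powr (- 1 / \<gamma>)" .
  qed
  have Vs: "\<kappa> * (1 - d) * s powr \<gamma> < xs - tail_quantile F s" "xs - tail_quantile F s < \<kappa> * (1 + d) * s powr \<gamma>"
    if "s \<ge> S" for s
  proof -
    have pos: "\<kappa> * s powr \<gamma> > 0" using \<kappa> that S by simp
    have "1 - d < (xs - tail_quantile F s) / (\<kappa> * s powr \<gamma>)" "(xs - tail_quantile F s) / (\<kappa> * s powr \<gamma>) < 1 + d"
      using V[OF that] by linarith+
    then have "(1 - d) * (\<kappa> * s powr \<gamma>) < xs - tail_quantile F s" "xs - tail_quantile F s < (1 + d) * (\<kappa> * s powr \<gamma>)"
      by (simp_all only: pos_less_divide_eq[OF pos] pos_divide_less_eq[OF pos])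
    then show "\<kappa> * (1 - d) * s powr \<gamma> < xs - tail_quantile F s" "xs - tail_quantile F s < \<kappa> * (1 + d) * s powr \<gamma>"
      by (simp_all only: mult_ac)
  qed
  obtain s where s: "s \<ge> S" "\<kappa> * (1 + d) * s powr \<gamma> = t" "1 / s = (\<kappa> * (1 + d)) powr (1 / \<gamma>) * t powr (- 1 / \<gamma>)"
    using key[of "1 + d"] d by auto
  have "F (xs - t) < 1 - 1 / s" using Vs(2)[OF s(1)] s S by (intro cdf_tail_quantile(1)) auto
  then show "(\<kappa> * (1 + d)) powr (1 / \<gamma>) * t powr (- 1 / \<gamma>) \<le> prob {\<omega> \<in> space M. xs - t < X \<omega>}"
    unfolding s(3)[symmetric] prob_gt_eq by simp
  obtain s where s: "s \<ge> S" "\<kappa> * (1 - d) * s powr \<gamma> = t" "1 / s = (\<kappa> * (1 - d)) powr (1 / \<gamma>) * t powr (- 1 / \<gamma>)"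
    using key[of "1 - d"] d by auto
  have "1 - 1 / s \<le> F (xs - t)" using Vs(1)[OF s(1)] s S by (intro cdf_tail_quantile(2)) auto
  then show "prob {\<omega> \<in> space M. xs - t < X \<omega>} \<le> (\<kappa> * (1 - d)) powr (1 / \<gamma>) * t powr (- 1 / \<gamma>)"
    unfolding s(3)[symmetric] prob_gt_eq by simp
qed

end

section \<open>The shortfall of the expectile below the endpoint\<close>

lemma ln_one_minus_ge:
  assumes "0 \<le> x" "x \<le> (1/2::real)"
  shows "- 2 * x \<le> ln (1 - x)"
proof -
  have "- x - 2 * x\<^sup>2 \<le> ln (1 - x)" using assms by (rule ln_one_minus_pos_lower_bound)
  moreover have "2 * x\<^sup>2 \<le> x" using assms mult_right_mono[of x "1/2" x] by (simp add: power2_eq_square)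
  ultimately show ?thesis by linarith
qed

context bounded_above
begin

text \<open>Here \<open>T\<close> is the shortfall \<open>x\<^sup>\<star> - \<xi>\<close> to leading order when the tail is exactly
  \<open>P (X > x\<^sup>\<star> - t) = (t / \<kappa>) powr \<theta>\<close>.\<close>
lemma shortfall_ratio:
  fixes \<kappa> \<theta> d p :: real
  defines "T \<equiv> ((1 + \<theta>) * \<kappa> powr \<theta> * p * (xs - \<mu>)) powr (1 / (1 + \<theta>))"
  assumes \<theta>: "\<theta> > 0" and \<kappa>: "\<kappa> > 0" and d: "0 \<le> d" and p: "0 < p" and \<xi>: "\<xi> < xs" "\<mu> < xs"
    and root: "(1 - 2 * p) * excess \<xi> = p * (\<xi> - \<mu>)"
    and lower: "\<And>t. 0 < t \<Longrightarrow> t \<le> xs - \<xi> \<Longrightarrow> (\<kappa> * (1 + d)) powr (- \<theta>) * t powr \<theta> \<le> prob {\<omega> \<in> space M. xs - t < X \<omega>}"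
    and upper: "\<And>t. 0 < t \<Longrightarrow> t \<le> xs - \<xi> \<Longrightarrow> prob {\<omega> \<in> space M. xs - t < X \<omega>} \<le> (\<kappa> * (1 - d)) powr (- \<theta>) * t powr \<theta>"
    and small: "(2 * \<theta> + 4) * (d + p + (xs - \<xi>) / (xs - \<mu>)) \<le> 1 / 2"
  shows "\<bar>(xs - \<xi>) / T - 1\<bar> \<le> 2 * ((2 * \<theta> + 4) * (d + p + (xs - \<xi>) / (xs - \<mu>)))"
proof -
  define y m where "y = xs - \<xi>" and "m = xs - \<mu>"
  define q where "q = y / m"
  have ym: "y > 0" "m > 0" "q > 0" using \<xi> by (simp_all add: y_def m_def q_def)
  define \<Sigma> where "\<Sigma> = d + p + q"
  have \<Sigma>: "(2 * \<theta> + 4) * \<Sigma> \<le> 1 / 2" "\<Sigma> \<ge> 0" using small d p ym by (simp_all add: \<Sigma>_def q_def y_def m_def)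
  have "4 * \<Sigma> \<le> (2 * \<theta> + 4) * \<Sigma>" using \<theta> \<Sigma> by (intro mult_right_mono) auto
  then have "\<Sigma> \<le> 1 / 8" using \<Sigma> by linarith
  then have b: "d \<le> 1 / 8" "p \<le> 1 / 8" "q \<le> 1 / 8" using d p ym by (simp_all add: \<Sigma>_def)
  \<comment> \<open>With \<open>d = 0\<close> and without the factor
    \<open>(1 - q) / (1 - 2 * p)\<close> the equation would be solved by \<open>y = T\<close>; these
    are the errors to be tracked.\<close>
  have e_eq: "excess \<xi> = p * m * (1 - q) / (1 - 2 * p)"
  proof -
    have "p * (\<xi> - \<mu>) = p * m * (1 - q)" using ym by (simp add: q_def y_def m_def field_simps)
    then show ?thesis using root b by (simp add: field_simps)
  qed
  define W where "W = (1 + \<theta>) * \<kappa> powr \<theta> * p * m"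
  have W: "W > 0" using \<theta> \<kappa> p ym by (simp add: W_def)
  \<comment> \<open>\<open>Q\<close> is the power of \<open>y / T\<close> with exponent
    \<open>1 + \<theta>\<close>, so it suffices to bound its logarithm.\<close>
  define Q where "Q = y powr (1 + \<theta>) / W"
  have Q: "Q > 0" using W ym by (simp add: Q_def)
  have up: "(\<kappa> * (1 + d)) powr (- \<theta>) * (y powr (1 + \<theta>) / (1 + \<theta>)) \<le> excess \<xi>"
    unfolding y_def using \<xi> \<theta> lower by (intro excess_ge) auto
  have lo: "excess \<xi> \<le> (\<kappa> * (1 - d)) powr (- \<theta>) * (y powr (1 + \<theta>) / (1 + \<theta>))"
    unfolding y_def using \<xi> \<theta> upper by (intro excess_le) auto
  have scale: "(\<kappa> * c) powr (- \<theta>) * (y powr (1 + \<theta>) / (1 + \<theta>)) = c powr (- \<theta>) * Q * (p * m)" if "c > 0" for c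
  proof -
    have 1: "Q * (p * m) = y powr (1 + \<theta>) / ((1 + \<theta>) * \<kappa> powr \<theta>)"
      using p ym \<theta> \<kappa> by (simp add: Q_def W_def)
    have 2: "(\<kappa> * c) powr (- \<theta>) = c powr (- \<theta>) / \<kappa> powr \<theta>"
      using that \<kappa> by (simp add: powr_mult powr_minus_divide)
    show ?thesis unfolding 2 mult.assoc 1 by (simp add: mult_ac)
  qed
  have up': "(1 + d) powr (- \<theta>) * Q \<le> (1 - q) / (1 - 2 * p)"
  proof -
    have "(1 + d) powr (- \<theta>) * Q * (p * m) \<le> (1 - q) / (1 - 2 * p) * (p * m)"
      using up scale[of "1 + d"] d unfolding e_eq by (simp add: mult_ac)
    then show ?thesis using p ym by (subst (asm) mult_le_cancel_right) auto
  qed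
  have lo': "(1 - q) / (1 - 2 * p) \<le> (1 - d) powr (- \<theta>) * Q"
  proof -
    have "(1 - q) / (1 - 2 * p) * (p * m) \<le> (1 - d) powr (- \<theta>) * Q * (p * m)"
      using lo scale[of "1 - d"] b unfolding e_eq by (simp add: mult_ac)
    then show ?thesis using p ym by (subst (asm) mult_le_cancel_right) auto
  qed
  have lnq: "- 2 * q \<le> ln (1 - q)" "ln (1 - q) \<le> 0" using b ym ln_one_minus_ge[of q] by simp_all
  have lnp: "- 2 * (2 * p) \<le> ln (1 - 2 * p)" "ln (1 - 2 * p) \<le> 0" using b p ln_one_minus_ge[of "2 * p"] by simp_all
  have lnd: "- 2 * d \<le> ln (1 - d)" using b d by (intro ln_one_minus_ge) auto
  have lnd': "ln (1 + d) \<le> d" using d by (rule ln_add_one_self_le_self)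
  have "ln ((1 + d) powr (- \<theta>) * Q) \<le> ln ((1 - q) / (1 - 2 * p))"
    using up' Q d by (intro ln_mono) auto
  then have "- \<theta> * ln (1 + d) + ln Q \<le> ln (1 - q) - ln (1 - 2 * p)"
    using Q d b ym p by (simp add: ln_mult ln_div ln_powr)
  moreover have "\<theta> * ln (1 + d) \<le> \<theta> * d" using lnd' \<theta> by (intro mult_left_mono) auto
  ultimately have 1: "ln Q \<le> \<theta> * d + 4 * p" using lnq lnp by linarith
  have "ln ((1 - q) / (1 - 2 * p)) \<le> ln ((1 - d) powr (- \<theta>) * Q)"
    using lo' Q d b p by (intro ln_mono) auto
  then have "ln (1 - q) - ln (1 - 2 * p) \<le> - \<theta> * ln (1 - d) + ln Q"
    using Q d b ym p by (simp add: ln_mult ln_div ln_powr)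
  moreover have "\<theta> * (- 2 * d) \<le> \<theta> * ln (1 - d)" using lnd \<theta> by (intro mult_left_mono) auto
  ultimately have 2: "- (2 * \<theta> * d) - 2 * q \<le> ln Q" using lnq lnp by linarith
  have terms: "\<theta> * d \<ge> 0" "\<theta> * p \<ge> 0" "\<theta> * q \<ge> 0" using \<theta> d p ym by simp_all
  have exp_\<Sigma>: "(2 * \<theta> + 4) * \<Sigma> = 2 * (\<theta> * d) + 2 * (\<theta> * p) + 2 * (\<theta> * q) + 4 * d + 4 * p + 4 * q"
    by (simp add: \<Sigma>_def algebra_simps)
  \<comment> \<open>The upper bound is \<open>\<theta> * d + 4 * p\<close>, the lower one
    \<open>- 2 * \<theta> * d - 2 * q\<close>; the constant \<open>2 * \<theta> + 4\<close> covers
    both.\<close>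
  have lnQ: "\<bar>ln Q\<bar> \<le> (2 * \<theta> + 4) * \<Sigma>"
    using 1 2 terms d p ym unfolding exp_\<Sigma> by linarith
  have T_eq: "T = W powr (1 / (1 + \<theta>))" by (simp add: T_def W_def m_def)
  have "y / T = Q powr (1 / (1 + \<theta>))"
    using W ym \<theta> by (simp add: T_eq Q_def powr_divide powr_powr)
  also have "\<dots> = exp (ln Q / (1 + \<theta>))" using Q by (simp add: powr_def)
  finally have yT: "y / T = exp (ln Q / (1 + \<theta>))" .
  have "\<bar>ln Q / (1 + \<theta>)\<bar> \<le> \<bar>ln Q\<bar>" using \<theta> by (simp add: abs_divide divide_le_eq mult_right_mono mult_left_mono algebra_simps)
  then have l: "\<bar>ln Q / (1 + \<theta>)\<bar> \<le> (2 * \<theta> + 4) * \<Sigma>" using lnQ by linarith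
  then have "\<bar>exp (ln Q / (1 + \<theta>)) - 1\<bar> \<le> 2 * \<bar>ln Q / (1 + \<theta>)\<bar>"
    using \<Sigma> by (intro abs_exp_minus_one_le) linarith
  then have "\<bar>y / T - 1\<bar> \<le> 2 * ((2 * \<theta> + 4) * \<Sigma>)" using l yT by linarith
  then show ?thesis by (simp add: y_def m_def q_def \<Sigma>_def)
qed

text \<open>If the expectile stayed below \<open>xs - e\<close>, its excess would be at least the
  positive number \<open>excess (xs - e)\<close>, while the root equation sends it to 0 with
  \<open>p\<close>.\<close>

lemma shortfall_tendsto_0:
  assumes tail: "\<And>t. t < xs \<Longrightarrow> prob {\<omega> \<in> space M. t < X \<omega>} > 0" and "\<mu> < xs"
    and p: "p \<longlonglongrightarrow> 0" "\<forall>\<^sub>F n in sequentially. p n > 0"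
  shows "(\<lambda>n. xs - expectile M X (1 - p n)) \<longlonglongrightarrow> 0"
proof (rule tendstoI)
  fix e :: real assume e: "e > 0"
  have pos: "excess (xs - e) > 0" using tail[of "xs - e"] e by (intro excess_pos) auto
  have lim: "(\<lambda>n. (1 - 2 * p n) * excess (xs - e) - p n * (xs - \<mu>)) \<longlonglongrightarrow> (1 - 2 * 0) * excess (xs - e) - 0 * (xs - \<mu>)"
    by (intro tendsto_intros p)
  have "\<forall>\<^sub>F n in sequentially. (1 - 2 * p n) * excess (xs - e) - p n * (xs - \<mu>) > 0"
    using order_tendstoD(1)[OF lim, of 0] pos by simp
  moreover have "\<forall>\<^sub>F n in sequentially. p n < 1 / 2" using p by (intro order_tendstoD(2)) auto
  ultimately show "\<forall>\<^sub>F n in sequentially. dist (xs - expectile M X (1 - p n)) 0 < e"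
    using p(2)
  proof eventually_elim
    case (elim n)
    let ?\<xi> = "expectile M X (1 - p n)"
    note r = expectile_root[OF elim(3,2) \<open>\<mu> < xs\<close> tail[OF \<open>\<mu> < xs\<close>]]
    have "xs - e < ?\<xi>"
    proof (rule ccontr)
      assume "\<not> ?thesis"
      then have "excess (xs - e) \<le> excess ?\<xi>" by (intro excess_antimono) auto
      then have "(1 - 2 * p n) * excess (xs - e) \<le> (1 - 2 * p n) * excess ?\<xi>"
        using elim(2) by (intro mult_left_mono) auto
      also have "\<dots> = p n * (?\<xi> - \<mu>)" by (rule r(3))
      also have "\<dots> \<le> p n * (xs - \<mu>)" using r(2) elim(3) by (intro mult_left_mono) auto
      finally show False using elim(1) by linarith
    qed
    then show ?case using r(2) by simp
  qed
qed

end

context bounded_above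
begin

text \<open>The tail bounds hold on an interval of \<open>t\<close> that must contain the shortfall,
  with an accuracy \<open>d\<close> that improves as the interval shrinks. A fixed accuracy
  \<open>d0\<close> yields the order \<tau> of the shortfall; the interval is then shrunk to a
  multiple of \<tau>, where the accuracy is of the order of \<open>A\<close> at the corresponding
  quantile level.\<close>

lemma expectile_asymptotics:
  fixes A :: "real \<Rightarrow> real" and p :: "nat \<Rightarrow> real" and \<gamma> \<rho> \<kappa> K \<beta> M0 S1 c :: real
  assumes \<gamma>: "\<gamma> < 0" and \<kappa>: "\<kappa> > 0" and K: "K \<ge> 0"
    and tail: "\<And>t. t < xs \<Longrightarrow> prob {\<omega> \<in> space M. t < X \<omega>} > 0" and mean: "\<mu> < xs"
    and V: "\<forall>\<^sub>F s in at_top. \<bar>(xs - tail_quantile F s) / (\<kappa> * s powr \<gamma>) - 1\<bar> \<le> K * \<bar>A s\<bar>"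
    and A0: "(A \<longlongrightarrow> 0) at_top" and A_nz: "\<forall>\<^sub>F s in at_top. A s \<noteq> 0"
    and M0: "M0 > 0" and A_uniform: "\<And>s t. s \<ge> S1 \<Longrightarrow> s \<le> t \<Longrightarrow> \<bar>A t\<bar> \<le> M0 * \<bar>A s\<bar>"
    and A_ratio: "\<And>w. w \<ge> 1 \<Longrightarrow> ((\<lambda>s. A (s * w) / A s) \<longlongrightarrow> w powr \<rho>) at_top"
    and \<beta>: "\<beta> > 0" and c: "c > 0" and p: "(\<lambda>n. p n / real n powr (- \<beta>)) \<longlonglongrightarrow> c"
  shows "(\<lambda>n. xs - expectile M X (1 - p n) - ((1 - 1 / \<gamma>) * \<kappa> powr (- 1 / \<gamma>) * p n * (xs - \<mu>)) powr (- \<gamma> / (1 - \<gamma>)))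
    \<in> O(\<lambda>n. real n powr (\<beta> * \<gamma> / (1 - \<gamma>)) * (real n powr (\<beta> * \<gamma> / (1 - \<gamma>)) + \<bar>A (real n powr (\<beta> / (1 - \<gamma>)))\<bar>))"
proof -
  define \<theta> where "\<theta> = - 1 / \<gamma>"
  have \<theta>: "\<theta> > 0" using \<gamma> by (simp add: \<theta>_def divide_pos_neg field_simps)
  have \<theta>_minus: "- \<theta> = 1 / \<gamma>" by (simp add: \<theta>_def)
  have \<theta>_inv: "1 / (1 + \<theta>) = - \<gamma> / (1 - \<gamma>)" using \<gamma> by (simp add: \<theta>_def divide_simps) (simp add: algebra_simps)
  define m where "m = xs - \<mu>"
  have m: "m > 0" using mean by (simp add: m_def)
  define y where "y n = xs - expectile M X (1 - p n)" for n
  define T where "T n = ((1 + \<theta>) * \<kappa> powr \<theta> * p n * (xs - \<mu>)) powr (1 / (1 + \<theta>))" for n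
  define \<tau> where "\<tau> n = real n powr (\<beta> * \<gamma> / (1 - \<gamma>))" for n
  \<comment> \<open>The quantile level that belongs to the order of the shortfall:
    \<open>\<tau> n = N n powr \<gamma>\<close>.\<close>
  define N where "N n = real n powr (\<beta> / (1 - \<gamma>))" for n
  have T_eq: "T n = ((1 - 1 / \<gamma>) * \<kappa> powr (- 1 / \<gamma>) * p n * (xs - \<mu>)) powr (- \<gamma> / (1 - \<gamma>))" for n
    unfolding T_def \<theta>_inv by (simp add: \<theta>_def)

  have "\<forall>\<^sub>F n in sequentially. p n / real n powr (- \<beta>) > c / 2"
    using c by (intro order_tendstoD(1)[OF p]) simp
  moreover have "\<forall>\<^sub>F n in sequentially. p n / real n powr (- \<beta>) < 2 * c"
    using c by (intro order_tendstoD(2)[OF p]) simp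
  ultimately have p_bounds: "\<forall>\<^sub>F n in sequentially. 0 < p n \<and> p n \<le> 2 * c * real n powr (- \<beta>)"
    using eventually_gt_at_top[of 0]
  proof eventually_elim
    case (elim n)
    then have pos: "real n powr (- \<beta>) > 0" by simp
    have "p n / real n powr (- \<beta>) > 0" using elim(1) c by linarith
    then have "p n > 0" using pos by (simp add: zero_less_divide_iff)
    then show ?case using elim(2) pos by (simp add: pos_divide_less_eq)
  qed
  then have p_pos: "\<forall>\<^sub>F n in sequentially. p n > 0" by eventually_elim simp
  have "(\<lambda>n. 2 * c * real n powr (- \<beta>)) \<longlonglongrightarrow> 2 * c * 0"
    using \<beta> by (intro tendsto_intros tendsto_neg_powr filterlim_real_sequentially) auto
  then have lim: "(\<lambda>n. 2 * c * real n powr (- \<beta>)) \<longlonglongrightarrow> 0" by simp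
  have p0: "p \<longlonglongrightarrow> 0"
    by (rule tendsto_sandwich[OF _ _ tendsto_const lim]; use p_bounds in eventually_elim; simp)
  have y0: "y \<longlonglongrightarrow> 0" unfolding y_def by (rule shortfall_tendsto_0[OF tail mean p0 p_pos])
  have p_\<tau>: "\<forall>\<^sub>F n in sequentially. p n \<le> 2 * c * \<tau> n"
    using p_bounds eventually_ge_at_top[of 1]
  proof eventually_elim
    case (elim n)
    \<comment> \<open>The error \<open>p\<close> is absorbed by \<tau>, since the two exponents
      differ by \<open>\<beta> / (1 - \<gamma>) > 0\<close>.\<close>
    have "- \<beta> \<le> \<beta> * \<gamma> / (1 - \<gamma>)" using \<gamma> \<beta> by (simp add: field_simps)
    then have "real n powr (- \<beta>) \<le> \<tau> n" unfolding \<tau>_def using elim by (intro powr_mono) auto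
    then have "2 * c * real n powr (- \<beta>) \<le> 2 * c * \<tau> n" using c by (intro mult_left_mono) auto
    then show ?case using elim by linarith
  qed
  define C1 where "C1 = ((1 + \<theta>) * \<kappa> powr \<theta> * (2 * c) * m) powr (1 / (1 + \<theta>))"
  have C1: "C1 > 0" using \<theta> \<kappa> c m by (simp add: C1_def)
  have T_bounds: "\<forall>\<^sub>F n in sequentially. 0 < T n \<and> T n \<le> C1 * \<tau> n"
    using p_bounds eventually_gt_at_top[of 0]
  proof eventually_elim
    case (elim n)
    have "(1 + \<theta>) * \<kappa> powr \<theta> * p n * m \<le> (1 + \<theta>) * \<kappa> powr \<theta> * (2 * c * real n powr (- \<beta>)) * m"
      using elim \<theta> m by (intro mult_right_mono mult_left_mono) auto
    then have "T n \<le> ((1 + \<theta>) * \<kappa> powr \<theta> * (2 * c) * m * real n powr (- \<beta>)) powr (1 / (1 + \<theta>))"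
      unfolding T_def m_def[symmetric] using elim \<theta> m by (intro powr_mono2) (auto simp: mult_ac)
    also have "\<dots> = C1 * real n powr (- \<beta> * (1 / (1 + \<theta>)))"
      using \<theta> c m \<kappa> elim by (simp add: C1_def powr_mult powr_powr)
    also have "- \<beta> * (1 / (1 + \<theta>)) = \<beta> * \<gamma> / (1 - \<gamma>)" unfolding \<theta>_inv by simp
    finally show ?case using elim \<theta> \<kappa> m by (simp add: T_def \<tau>_def m_def)
  qed

  define L where "L = 2 * \<theta> + 4"
  have L: "L > 0" using \<theta> by (simp add: L_def)
  have stage: "\<bar>y n / T n - 1\<bar> \<le> 2 * (L * (d + p n + y n / m))"
    if pn: "0 < p n" "p n < 1 / 2" and d: "0 \<le> d" "d < 1" and S: "S > 1"
      and VS: "\<And>s. s \<ge> S \<Longrightarrow> \<bar>(xs - tail_quantile F s) / (\<kappa> * s powr \<gamma>) - 1\<bar> < d"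
      and yn: "y n \<le> \<kappa> * (1 - d) * S powr \<gamma>" and small: "L * (d + p n + y n / m) \<le> 1 / 2" for n d S
  proof -
    note r = expectile_root[OF pn mean tail[OF mean]]
    note tb = tail_bounds[OF \<gamma> \<kappa> d S VS]
    have "\<bar>y n / T n - 1\<bar> \<le> 2 * ((2 * \<theta> + 4) * (d + p n + y n / m))"
      unfolding y_def T_def m_def
    proof (rule shortfall_ratio[OF \<theta> \<kappa> d(1) pn(1) r(2) mean r(3)])
      fix t assume t: "0 < t" "t \<le> xs - expectile M X (1 - p n)"
      then have t': "t \<le> \<kappa> * (1 - d) * S powr \<gamma>" using yn by (simp add: y_def)
      show "(\<kappa> * (1 + d)) powr (- \<theta>) * t powr \<theta> \<le> prob {\<omega> \<in> space M. xs - t < X \<omega>}"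
        using tb(1)[OF _ t(1) t'] unfolding \<theta>_minus by (simp add: \<theta>_def)
      show "prob {\<omega> \<in> space M. xs - t < X \<omega>} \<le> (\<kappa> * (1 - d)) powr (- \<theta>) * t powr \<theta>"
        using tb(2)[OF _ t(1) t'] unfolding \<theta>_minus by (simp add: \<theta>_def)
    next
      show "(2 * \<theta> + 4) * (d + p n + (xs - expectile M X (1 - p n)) / (xs - \<mu>)) \<le> 1 / 2"
        using small by (simp add: L_def y_def m_def)
    qed
    then show ?thesis by (simp add: L_def)
  qed

  \<comment> \<open>Three error terms of size at most \<open>d0\<close>, multiplied by
    \<open>L\<close>, sum to at most 1/2, the smallness that \<open>shortfall_ratio\<close>
    requires.\<close>
  define d0 where "d0 = 1 / (6 * L)"
  have d0: "d0 > 0" "d0 < 1 / 2" "L * d0 = 1 / 6" using L \<theta> by (auto simp: d0_def L_def field_simps)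
  have KA: "((\<lambda>s. K * \<bar>A s\<bar>) \<longlongrightarrow> K * \<bar>0\<bar>) at_top" by (intro tendsto_intros A0)
  have "\<forall>\<^sub>F s in at_top. K * \<bar>A s\<bar> < d0" by (rule order_tendstoD(2)[OF KA]) (use d0 in simp)
  with V have "\<forall>\<^sub>F s in at_top. \<bar>(xs - tail_quantile F s) / (\<kappa> * s powr \<gamma>) - 1\<bar> \<le> K * \<bar>A s\<bar> \<and> K * \<bar>A s\<bar> < d0 \<and> s > 1"
    using eventually_gt_at_top[of 1] by eventually_elim blast
  then obtain S0 where S0: "\<And>s. s \<ge> S0 \<Longrightarrow> \<bar>(xs - tail_quantile F s) / (\<kappa> * s powr \<gamma>) - 1\<bar> \<le> K * \<bar>A s\<bar> \<and> K * \<bar>A s\<bar> < d0 \<and> s > 1"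
    unfolding eventually_at_top_linorder by blast
  have S0_1: "S0 > 1" using S0[of S0] by simp

  have ym: "(\<lambda>n. y n / m) \<longlonglongrightarrow> 0 / m" using m by (intro tendsto_intros y0) auto
  have ev1: "\<forall>\<^sub>F n in sequentially. p n < d0 \<and> y n / m < d0"
    using order_tendstoD(2)[OF p0, of d0] order_tendstoD(2)[OF ym, of d0] d0 by (auto intro: eventually_conj)
  have ev2: "\<forall>\<^sub>F n in sequentially. y n \<le> \<kappa> * (1 - d0) * S0 powr \<gamma>"
  proof -
    have "0 < \<kappa> * (1 - d0) * S0 powr \<gamma>" using \<kappa> d0 S0_1 by simp
    from order_tendstoD(2)[OF y0 this] show ?thesis by eventually_elim simp
  qed
  have y_\<tau>: "\<forall>\<^sub>F n in sequentially. y n \<le> 2 * C1 * \<tau> n"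
    using ev1 ev2 p_pos T_bounds
  proof eventually_elim
    case (elim n)
    have "L * (d0 + p n + y n / m) \<le> L * (3 * d0)" using elim L by (intro mult_left_mono) auto
    also have "\<dots> = 1 / 2" using d0 by simp
    finally have small: "L * (d0 + p n + y n / m) \<le> 1 / 2" .
    have "\<bar>y n / T n - 1\<bar> \<le> 2 * (L * (d0 + p n + y n / m))"
    proof (rule stage[OF _ _ _ _ S0_1 _ _ small])
      fix s assume "s \<ge> S0"
      then show "\<bar>(xs - tail_quantile F s) / (\<kappa> * s powr \<gamma>) - 1\<bar> < d0" using S0[of s] by linarith
    qed (use elim d0 in auto)
    then have "y n / T n \<le> 2" using small by linarith
    then have "y n \<le> 2 * T n" using elim by (simp add: pos_divide_le_eq)
    then show ?case using elim by linarith
  qed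

  \<comment> \<open>Lowering the level from \<open>N n\<close> to \<open>N n / w\<close> widens the
    admissible interval by the factor \<open>w powr (- \<gamma>) \<ge> 4 * C1 / \<kappa>\<close>:
    enough for \<open>y n \<le> 2 * C1 * \<tau> n\<close>, with a factor 2 spent on
    \<open>1 - d n \<ge> 1 / 2\<close>.\<close>
  define w where "w = max 1 ((4 * C1 / \<kappa>) powr (- 1 / \<gamma>))"
  have w: "w \<ge> 1" "w > 0" by (auto simp: w_def)
  have w_powr: "4 * C1 / \<kappa> \<le> w powr (- \<gamma>)"
  proof -
    have "((4 * C1 / \<kappa>) powr (- 1 / \<gamma>)) powr (- \<gamma>) \<le> w powr (- \<gamma>)"
      unfolding w_def using \<gamma> by (intro powr_mono2) auto
    then show ?thesis using \<gamma> C1 \<kappa> by (simp add: powr_powr)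
  qed
  define s0 where "s0 n = N n / w" for n
  have N_top: "filterlim N at_top sequentially"
  proof -
    define e where "e = \<beta> / (1 - \<gamma>)"
    have "e > 0" using \<beta> \<gamma> by (simp add: e_def)
    then have "filterlim (\<lambda>n. real n powr e) at_top sequentially" by real_asymp
    then show ?thesis by (simp add: N_def[abs_def] e_def)
  qed
  have s0_top: "filterlim s0 at_top sequentially"
    unfolding s0_def divide_inverse using w
    by (intro filterlim_at_top_mult_tendsto_pos[OF tendsto_const _ N_top]) auto
  \<comment> \<open>\<open>M0\<close> carries the error at all \<open>s \<ge> s0 n\<close> back to
    \<open>s0 n\<close>; \<open>K + 1\<close> in place of \<open>K\<close> makes the bound
    strict.\<close>
  define d where "d n = (K + 1) * M0 * \<bar>A (s0 n)\<bar>" for n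
  have dlim: "d \<longlonglongrightarrow> (K + 1) * M0 * \<bar>0\<bar>"
    unfolding d_def by (intro tendsto_intros filterlim_compose[OF A0 s0_top])
  have ev_d: "\<forall>\<^sub>F n in sequentially. d n < d0" by (rule order_tendstoD(2)[OF dlim]) (use d0 in simp)
  have ev_s: "\<forall>\<^sub>F n in sequentially. s0 n \<ge> max S0 S1"
    using s0_top by (simp only: filterlim_at_top)
  have ev_nz: "\<forall>\<^sub>F n in sequentially. A (s0 n) \<noteq> 0"
    using eventually_compose_filterlim[OF A_nz s0_top] .
  have "\<forall>\<^sub>F s in at_top. A (s * w) / A s > w powr \<rho> / 2"
    using w by (intro order_tendstoD(1)[OF A_ratio]) auto
  then have ev_r: "\<forall>\<^sub>F n in sequentially. A (s0 n * w) / A (s0 n) > w powr \<rho> / 2"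
    using s0_top by (rule eventually_compose_filterlim)
  define C3 where "C3 = (K + 1) * M0 * (2 / w powr \<rho>)"
  have C3: "C3 > 0" using K M0 w by (simp add: C3_def)
  define Cf where "Cf = C1 * (2 * L) * (C3 + 2 * c + 2 * C1 / m)"
  have "\<forall>\<^sub>F n in sequentially. \<bar>y n - T n\<bar> \<le> Cf * (\<tau> n * (\<tau> n + \<bar>A (N n)\<bar>))"
    using ev_d ev_s ev_nz ev_r ev1 p_pos p_\<tau> T_bounds y_\<tau> eventually_gt_at_top[of 0]
  proof eventually_elim
    case (elim n)
    have d_pos: "d n > 0" using elim(3) K M0 by (simp add: d_def)
    have s01: "s0 n > 1" using elim(2) S0_1 by linarith
    have VS: "\<bar>(xs - tail_quantile F s) / (\<kappa> * s powr \<gamma>) - 1\<bar> < d n" if s: "s \<ge> s0 n" for s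
    proof -
      have "\<bar>A s\<bar> \<le> M0 * \<bar>A (s0 n)\<bar>" using elim(2) s by (intro A_uniform) auto
      then have "K * \<bar>A s\<bar> \<le> K * (M0 * \<bar>A (s0 n)\<bar>)" using K by (rule mult_left_mono)
      also have "\<dots> < d n" using elim(3) M0 by (simp add: d_def algebra_simps)
      finally show ?thesis using S0[of s] s elim(2) by force
    qed
    have s0\<gamma>: "s0 n powr \<gamma> = \<tau> n * w powr (- \<gamma>)"
      using w elim(10) by (simp add: s0_def N_def \<tau>_def powr_divide powr_powr powr_minus_divide)
    have "y n \<le> \<kappa> * (1 / 2) * (\<tau> n * (4 * C1 / \<kappa>))" using elim(9) \<kappa> by simp
    also have "\<dots> \<le> \<kappa> * (1 - d n) * (\<tau> n * w powr (- \<gamma>))"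
      using \<kappa> elim(1) d0 w_powr C1 by (intro mult_mono mult_left_mono mult_nonneg_nonneg) (auto simp: \<tau>_def)
    finally have yn: "y n \<le> \<kappa> * (1 - d n) * s0 n powr \<gamma>" by (simp only: s0\<gamma>)
    have "L * (d n + p n + y n / m) \<le> L * (3 * d0)" using elim L by (intro mult_left_mono) auto
    also have "\<dots> = 1 / 2" using d0 by simp
    finally have small: "L * (d n + p n + y n / m) \<le> 1 / 2" .
    have ratio: "\<bar>y n / T n - 1\<bar> \<le> 2 * (L * (d n + p n + y n / m))"
      by (rule stage[OF _ _ _ _ s01 VS yn small]) (use elim d0 d_pos in auto)
    \<comment> \<open>Regular variation at the fixed ratio \<open>w\<close> replaces
      \<open>A (s0 n)\<close> by \<open>A (N n)\<close>, the quantity in the statement.\<close>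
    have "w powr \<rho> / 2 \<le> \<bar>A (N n)\<bar> / \<bar>A (s0 n)\<bar>"
    proof -
      have "s0 n * w = N n" using w by (simp add: s0_def)
      then have "w powr \<rho> / 2 < A (N n) / A (s0 n)" using elim(4) by simp
      also have "\<dots> \<le> \<bar>A (N n) / A (s0 n)\<bar>" by (rule abs_ge_self)
      finally show ?thesis by (simp only: abs_divide less_imp_le)
    qed
    then have "\<bar>A (s0 n)\<bar> \<le> 2 / w powr \<rho> * \<bar>A (N n)\<bar>"
      using elim(3) w by (simp add: field_simps)
    then have dA: "d n \<le> C3 * \<bar>A (N n)\<bar>"
      unfolding d_def C3_def mult.assoc using K M0 by (intro mult_left_mono) auto
    have sum: "d n + p n + y n / m \<le> (C3 + 2 * c + 2 * C1 / m) * (\<tau> n + \<bar>A (N n)\<bar>)"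
    proof -
      define u where "u = 2 * C1 / m"
      have "y n / m \<le> 2 * C1 * \<tau> n / m" using elim(9) m by (intro divide_right_mono) auto
      then have "y n / m \<le> u * \<tau> n" by (simp add: u_def)
      moreover have "0 \<le> C3 * \<tau> n" "0 \<le> (2 * c + u) * \<bar>A (N n)\<bar>"
        using C3 c C1 m by (auto simp: \<tau>_def u_def)
      ultimately show ?thesis
        using dA elim(7) unfolding u_def[symmetric] distrib_left distrib_right by linarith
    qed
    have "\<bar>y n - T n\<bar> = T n * \<bar>y n / T n - 1\<bar>"
    proof -
      have "y n - T n = T n * (y n / T n - 1)" using elim(8) by (simp add: field_simps)
      then show ?thesis using elim(8) by (simp add: abs_mult)
    qed
    also have "\<dots> \<le> (C1 * \<tau> n) * (2 * (L * ((C3 + 2 * c + 2 * C1 / m) * (\<tau> n + \<bar>A (N n)\<bar>))))"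
    proof (rule mult_mono)
      have "2 * (L * (d n + p n + y n / m)) \<le> 2 * (L * ((C3 + 2 * c + 2 * C1 / m) * (\<tau> n + \<bar>A (N n)\<bar>)))"
        using sum L by (intro mult_left_mono) auto
      then show "\<bar>y n / T n - 1\<bar> \<le> 2 * (L * ((C3 + 2 * c + 2 * C1 / m) * (\<tau> n + \<bar>A (N n)\<bar>)))"
        using ratio by (rule order_trans[rotated])
      show "T n \<le> C1 * \<tau> n" using elim(8) by simp
      show "0 \<le> C1 * \<tau> n" using C1 by (simp add: \<tau>_def)
    qed simp
    finally show ?case by (simp only: Cf_def mult_ac)
  qed
  then have "(\<lambda>n. y n - T n) \<in> O(\<lambda>n. \<tau> n * (\<tau> n + \<bar>A (N n)\<bar>))"
    by (intro bigoI[of _ Cf]) (simp add: \<tau>_def abs_mult)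
  then show ?thesis by (simp only: y_def T_eq \<tau>_def N_def)
qed

end

section \<open>Expansion of the estimators\<close>

text \<open>The delta method along a filter. Caratheodory's form of the derivative avoids division
  by an increment that may be 0.\<close>

lemma scaled_increment:
  fixes \<phi> :: "real \<Rightarrow> real"
  assumes D: "DERIV \<phi> c :> D" and u: "filterlim u at_top F" and v: "(v \<longlongrightarrow> g) F"
  shows "((\<lambda>i. u i * (\<phi> (c + v i / u i) - \<phi> c)) \<longlongrightarrow> D * g) F"
proof -
  obtain q where q: "\<And>z. \<phi> z - \<phi> c = q z * (z - c)" "isCont q c" "q c = D"
    using D unfolding CARAT_DERIV by blast
  have "((\<lambda>i. c + v i / u i) \<longlongrightarrow> c + 0) F"
    by (intro tendsto_intros real_tendsto_divide_at_top[OF v u])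
  then have "((\<lambda>i. q (c + v i / u i)) \<longlongrightarrow> q c) F"
    using isCont_tendsto_compose[OF q(2)] by simp
  then have "((\<lambda>i. q (c + v i / u i) * v i) \<longlongrightarrow> D * g) F"
    unfolding q(3) by (intro tendsto_intros v)
  then show ?thesis
  proof (rule Lim_transform_eventually)
    show "\<forall>\<^sub>F i in F. q (c + v i / u i) * v i = u i * (\<phi> (c + v i / u i) - \<phi> c)"
      using u[unfolded filterlim_at_top_dense, rule_format, of 0]
      by eventually_elim (simp add: q(1))
  qed
qed

lemma asymp_proportional_powr_ln:
  assumes "asymp_proportional u (\<lambda>n. real n powr e)"
  shows "(\<lambda>n. ln (u n) / ln (real n)) \<longlonglongrightarrow> e" "\<forall>\<^sub>F n in sequentially. u n > 0"
proof -
  obtain c where c: "c > 0" "(\<lambda>n. u n / real n powr e) \<longlonglongrightarrow> c"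
    using assms by (auto simp: asymp_proportional_def)
  have pos: "\<forall>\<^sub>F n in sequentially. u n / real n powr e > 0" using order_tendstoD(1)[OF c(2,1)] .
  then show up: "\<forall>\<^sub>F n in sequentially. u n > 0"
  proof eventually_elim
    case (elim n)
    moreover have "real n powr e \<ge> 0" by simp
    ultimately show ?case by (auto simp: zero_less_divide_iff)
  qed
  have lntop: "filterlim (\<lambda>n. ln (real n)) at_top sequentially" by real_asymp
  have "(\<lambda>n. ln (u n / real n powr e)) \<longlonglongrightarrow> ln c" using c by (intro tendsto_intros) auto
  then have "(\<lambda>n. ln (u n / real n powr e) / ln (real n) + e) \<longlonglongrightarrow> 0 + e"
    by (intro tendsto_intros real_tendsto_divide_at_top lntop)
  then have *: "(\<lambda>n. ln (u n / real n powr e) / ln (real n) + e) \<longlonglongrightarrow> e" by simp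
  show "(\<lambda>n. ln (u n) / ln (real n)) \<longlonglongrightarrow> e"
  proof (rule Lim_transform_eventually[OF *])
    show "\<forall>\<^sub>F n in sequentially. ln (u n / real n powr e) / ln (real n) + e = ln (u n) / ln (real n)"
      using up eventually_gt_at_top[of 1]
    proof eventually_elim
      case (elim n)
      then have "ln (real n) > 0" by simp
      moreover have "ln (u n / real n powr e) = ln (u n) - e * ln (real n)"
        using elim by (simp add: ln_div ln_powr)
      ultimately show ?case by (simp add: field_simps)
    qed
  qed
qed

locale tail_sequences = second_order_mono +
  fixes k :: "nat \<Rightarrow> nat" and p :: "nat \<Rightarrow> real" and \<alpha> \<beta> l :: real
  assumes k_pos: "k n > 0" and \<alpha>: "0 < \<alpha>" "\<alpha> < 1"
    and k_asymp: "asymp_proportional (\<lambda>n. real (k n)) (\<lambda>n. real n powr \<alpha>)"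
    and p_asymp: "asymp_proportional p (\<lambda>n. real n powr (- \<beta>))"
    and kA: "(\<lambda>n. sqrt (k n) * A (n / k n)) \<longlonglongrightarrow> l"
begin

text \<open>A power of \<open>n\<close> beats its logarithm. Exponentials of errors of order
  \<open>ln n / sqrt (k n)\<close> can therefore be linearised.\<close>

lemma sqrt_k_ln_top: "filterlim (\<lambda>n. sqrt (k n) / ln n) at_top sequentially"
proof -
  obtain c where c: "c > 0" "(\<lambda>n. real (k n) / real n powr \<alpha>) \<longlonglongrightarrow> c"
    using k_asymp by (auto simp: asymp_proportional_def)
  have 1: "filterlim (\<lambda>n. real n powr (\<alpha> / 2) / ln n) at_top sequentially" using \<alpha> by real_asymp
  have "filterlim (\<lambda>n. sqrt (real (k n) / real n powr \<alpha>) * (real n powr (\<alpha> / 2) / ln n)) at_top sequentially"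
    by (rule filterlim_tendsto_pos_mult_at_top[OF tendsto_real_sqrt[OF c(2)] _ 1]) (use c in simp)
  moreover have "\<forall>\<^sub>F n in sequentially. sqrt (real (k n) / real n powr \<alpha>) * (real n powr (\<alpha> / 2) / ln n) = sqrt (k n) / ln n"
    using eventually_gt_at_top[of 0]
  proof eventually_elim
    case (elim n)
    have "sqrt (real n powr \<alpha>) = real n powr (\<alpha> / 2)"
      using elim by (simp add: powr_half_sqrt[symmetric] powr_powr)
    then show ?case using elim by (simp add: real_sqrt_divide)
  qed
  ultimately show ?thesis by (rule filterlim_cong[THEN iffD1, OF refl refl, rotated])
qed

lemma ln_top: "filterlim (\<lambda>n. ln (real n)) at_top sequentially" by real_asymp

lemma sqrt_k_top: "filterlim (\<lambda>n. sqrt (k n)) at_top sequentially"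
proof -
  have "filterlim (\<lambda>n. sqrt (k n) / ln n * ln n) at_top sequentially"
    by (rule filterlim_at_top_mult_at_top[OF sqrt_k_ln_top ln_top])
  then show ?thesis
  proof (rule filterlim_mono_eventually)
    show "\<forall>\<^sub>F n in sequentially. sqrt (k n) / ln n * ln n = sqrt (k n)"
      using eventually_gt_at_top[of 1] by eventually_elim simp
  qed auto
qed

lemma ratio_top: "filterlim (\<lambda>n. real n / k n) at_top sequentially"
proof -
  obtain c where c: "c > 0" "(\<lambda>n. real (k n) / real n powr \<alpha>) \<longlonglongrightarrow> c"
    using k_asymp by (auto simp: asymp_proportional_def)
  have 1: "filterlim (\<lambda>n. real n powr (1 - \<alpha>)) at_top sequentially" using \<alpha> by real_asymp
  have "filterlim (\<lambda>n. inverse (real (k n) / real n powr \<alpha>) * real n powr (1 - \<alpha>)) at_top sequentially"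
    by (rule filterlim_tendsto_pos_mult_at_top[OF tendsto_inverse[OF c(2)] _ 1]) (use c in auto)
  then show ?thesis
  proof (rule filterlim_mono_eventually)
    show "\<forall>\<^sub>F n in sequentially. inverse (real (k n) / real n powr \<alpha>) * real n powr (1 - \<alpha>) = real n / k n"
      using eventually_gt_at_top[of 0] by eventually_elim (simp add: field_simps powr_diff)
  qed auto
qed

lemma a_tendsto_0: "(a \<longlongrightarrow> 0) at_top"
proof -
  obtain C K where C: "C > 0" "K \<ge> 0" "\<forall>\<^sub>F s in at_top. \<bar>a s / (C * s powr \<gamma>) - 1\<bar> \<le> K * \<bar>A s\<bar>"
    by (rule a_expansion)
  have "((\<lambda>s. K * \<bar>A s\<bar>) \<longlongrightarrow> K * \<bar>0\<bar>) at_top" by (intro tendsto_intros A_null)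
  then have KA: "((\<lambda>s. K * \<bar>A s\<bar>) \<longlongrightarrow> 0) at_top" by simp
  have l1: "((\<lambda>s. a s / (C * s powr \<gamma>) - 1) \<longlongrightarrow> 0) at_top"
    by (rule Lim_null_comparison[OF _ KA]) (use C(3) in simp)
  have l2: "((\<lambda>s. C * s powr \<gamma>) \<longlongrightarrow> C * 0) at_top"
    using gamma_neg by (intro tendsto_intros tendsto_neg_powr filterlim_ident) auto
  from tendsto_mult[OF tendsto_add[OF l1 tendsto_const[of 1]] l2]
  have *: "((\<lambda>s. (a s / (C * s powr \<gamma>) - 1 + 1) * (C * s powr \<gamma>)) \<longlongrightarrow> 0) at_top" by simp
  show ?thesis
    by (rule Lim_transform_eventually[OF *])
      (use eventually_gt_at_top[of 0] in eventually_elim, use C(1) in simp)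
qed

end

text \<open>The estimators at stage \<open>\<nu> i\<close>, written in terms of their standardised errors, along an
  arbitrary filter; the filter will be \<open>n \<rightarrow> \<infinity>, w' \<rightarrow> w\<close>.\<close>
locale standardised_errors = tail_sequences +
  fixes Fl :: "'i filter" and \<nu> :: "'i \<Rightarrow> nat" and G Q B S :: "'i \<Rightarrow> real" and g q b s \<mu> :: real
  assumes \<nu>: "filterlim \<nu> sequentially Fl"
    and G: "(G \<longlongrightarrow> g) Fl" and Q: "(Q \<longlongrightarrow> q) Fl" and B: "(B \<longlongrightarrow> b) Fl" and S: "(S \<longlongrightarrow> s) Fl"
    and mean: "\<mu> < xs"
begin

abbreviation "t i \<equiv> sqrt (k (\<nu> i))"
abbreviation "\<sigma> i \<equiv> real (\<nu> i) / k (\<nu> i)"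
abbreviation "\<gamma>' i \<equiv> \<gamma> + G i / t i"
abbreviation "a' i \<equiv> a (\<sigma> i) * (1 + Q i / t i)"
abbreviation "x' i \<equiv> U (\<sigma> i) + a (\<sigma> i) * B i / t i"
abbreviation "m' i \<equiv> \<mu> + S i / t i"
abbreviation "R i \<equiv> real (k (\<nu> i)) / (real (\<nu> i) * p (\<nu> i))"

lemma t_top: "filterlim t at_top Fl" using filterlim_compose[OF sqrt_k_top \<nu>] .
lemma \<sigma>_top: "filterlim \<sigma> at_top Fl" using filterlim_compose[OF ratio_top \<nu>] .
lemma t_ln_top: "filterlim (\<lambda>i. t i / ln (\<nu> i)) at_top Fl" using filterlim_compose[OF sqrt_k_ln_top \<nu>] .
lemma ln_\<nu>_top: "filterlim (\<lambda>i. ln (real (\<nu> i))) at_top Fl" using filterlim_compose[OF ln_top \<nu>] .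
lemma t_pos: "t i > 0" using k_pos by simp

lemma \<gamma>'_lim: "(\<gamma>' \<longlongrightarrow> \<gamma>) Fl"
  using tendsto_add[OF tendsto_const real_tendsto_divide_at_top[OF G t_top], of \<gamma>] by simp

lemma \<gamma>'_neg: "\<forall>\<^sub>F i in Fl. \<gamma>' i < 0"
  using order_tendstoD(2)[OF \<gamma>'_lim gamma_neg] .

lemma a_\<sigma>_pos: "\<forall>\<^sub>F i in Fl. a (\<sigma> i) > 0"
  using eventually_compose_filterlim[OF eventually_gt_at_top[of 1] \<sigma>_top] by eventually_elim (rule a_pos)

text \<open>The standardised error is exactly
  \<open>B i + (G i - \<gamma> * Q i) / (\<gamma> * \<gamma>' i)\<close> minus
  \<open>t i * A (\<sigma> i)\<close> times the quotient of \<open>endpoint_second_order\<close>.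
  The last term is the bias, and \<open>kA\<close> provides its limit.\<close>

lemma endpoint_error:
  "((\<lambda>i. t i / a (\<sigma> i) * (endpoint_est (\<gamma>' i) (a' i) (x' i) - xs)) \<longlongrightarrow>
     b + (g - \<gamma> * q) / (\<gamma> * \<gamma>) - l * (1 / (\<gamma> * (\<gamma> + \<rho>)))) Fl"
proof -
  let ?E = "\<lambda>s. (xs - U s + a s / \<gamma>) / (a s * A s)"
  have "((\<lambda>i. B i + (G i - \<gamma> * Q i) / (\<gamma> * \<gamma>' i) - t i * A (\<sigma> i) * ?E (\<sigma> i)) \<longlongrightarrow>
     b + (g - \<gamma> * q) / (\<gamma> * \<gamma>) - l * (1 / (\<gamma> * (\<gamma> + \<rho>)))) Fl"
    using gamma_neg
    by (intro tendsto_add tendsto_diff tendsto_divide tendsto_mult tendsto_const B G Q \<gamma>'_lim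
        filterlim_compose[OF kA \<nu>] filterlim_compose[OF endpoint_second_order \<sigma>_top]) auto
  then show ?thesis
  proof (rule Lim_transform_eventually)
    show "\<forall>\<^sub>F i in Fl. B i + (G i - \<gamma> * Q i) / (\<gamma> * \<gamma>' i) - t i * A (\<sigma> i) * ?E (\<sigma> i)
        = t i / a (\<sigma> i) * (endpoint_est (\<gamma>' i) (a' i) (x' i) - xs)"
      using \<gamma>'_neg a_\<sigma>_pos eventually_compose_filterlim[OF A_nz \<sigma>_top]
    proof eventually_elim
      case (elim i)
      have tp: "t i > 0" by (rule t_pos)
      have 1: "t i * A (\<sigma> i) * ?E (\<sigma> i) = t i / a (\<sigma> i) * (xs - U (\<sigma> i)) + t i / \<gamma>"
        using elim gamma_neg by (simp add: field_simps)
      have 2: "(G i - \<gamma> * Q i) / (\<gamma> * \<gamma>' i) = t i / \<gamma> - t i * (1 + Q i / t i) / \<gamma>' i"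
      proof -
        have "t i * \<gamma>' i - \<gamma> * (t i * (1 + Q i / t i)) = G i - \<gamma> * Q i"
          using tp by (simp add: field_simps)
        moreover have "t i / \<gamma> - t i * (1 + Q i / t i) / \<gamma>' i = (t i * \<gamma>' i - t i * (1 + Q i / t i) * \<gamma>) / (\<gamma> * \<gamma>' i)"
          by (rule diff_frac_eq) (use elim(1) gamma_neg in auto)
        ultimately show ?thesis by (simp only: mult.commute[of \<gamma> "t i * (1 + Q i / t i)"])
      qed
      have 3: "t i / a (\<sigma> i) * (endpoint_est (\<gamma>' i) (a' i) (x' i) - xs)
        = B i - t i * (1 + Q i / t i) / \<gamma>' i - t i / a (\<sigma> i) * (xs - U (\<sigma> i))"
      proof -
        have "t i / a (\<sigma> i) * (a (\<sigma> i) * B i / t i) = B i" using elim tp by simp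
        moreover have "t i / a (\<sigma> i) * (a' i / \<gamma>' i) = t i * (1 + Q i / t i) / \<gamma>' i" using elim by simp
        moreover have "t i / a (\<sigma> i) * (endpoint_est (\<gamma>' i) (a' i) (x' i) - xs)
          = t i / a (\<sigma> i) * (a (\<sigma> i) * B i / t i) - t i / a (\<sigma> i) * (a' i / \<gamma>' i) - t i / a (\<sigma> i) * (xs - U (\<sigma> i))"
        proof -
          have "c * (u + v - w - z) = c * v - c * w - c * (z - u)" for c u v w z :: real
            by (simp add: algebra_simps)
          then show ?thesis unfolding endpoint_est_def .
        qed
        ultimately show ?thesis by simp
      qed
      show ?case unfolding 1 2 3 by simp
    qed
  qed
qed

end

section \<open>The logarithm of the estimated shortfall\<close>

context standardised_errors
begin

definition h\<gamma> :: real where "h\<gamma> = 1 / (1 - \<gamma>)"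
definition h' :: "'i \<Rightarrow> real" where "h' i = 1 / (1 - \<gamma>' i)"
definition m :: real where "m = xs - \<mu>"

text \<open>The limit of \<open>(ln (a (\<sigma> i)) + ln (R i)) / ln (\<nu> i)\<close>: the slope,
  in units of \<open>ln n\<close>, of the logarithm of the estimated shortfall as a function of
  \<open>h'\<close>.\<close>

definition log_rate :: real where "log_rate = \<gamma> * (1 - \<alpha>) + (\<alpha> - 1 + \<beta>)"

lemma h\<gamma>: "h\<gamma> > 0" "- \<gamma> / (1 - \<gamma>) = 1 - h\<gamma>" "\<gamma> * h\<gamma> = h\<gamma> - 1"
  using gamma_neg by (auto simp: h\<gamma>_def field_simps)

lemma h': "\<forall>\<^sub>F i in Fl. h' i > 0 \<and> - \<gamma>' i / (1 - \<gamma>' i) = 1 - h' i \<and> \<gamma>' i * h' i = h' i - 1"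
  using \<gamma>'_neg
proof eventually_elim
  case (elim i)
  define z where "z = \<gamma>' i"
  have "z < 0" using elim by (simp only: z_def)
  then have "1 / (1 - z) > 0 \<and> - z / (1 - z) = 1 - 1 / (1 - z) \<and> z * (1 / (1 - z)) = 1 / (1 - z) - 1"
    by (auto simp: field_simps)
  then show ?case unfolding h'_def z_def .
qed

lemma m_pos: "m > 0" using mean by (simp add: m_def)

lemma h'_lim: "(h' \<longlongrightarrow> h\<gamma>) Fl"
  unfolding h'_def[abs_def] h\<gamma>_def using gamma_neg by (intro tendsto_intros \<gamma>'_lim) auto

lemma h'_rate: "((\<lambda>i. t i * (h' i - h\<gamma>)) \<longlongrightarrow> h\<gamma>\<^sup>2 * g) Fl"
proof -
  have "DERIV (\<lambda>z. 1 / (1 - z)) \<gamma> :> h\<gamma>\<^sup>2"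
    using gamma_neg by (auto intro!: derivative_eq_intros simp: h\<gamma>_def power2_eq_square)
  from scaled_increment[OF this t_top G] show ?thesis by (simp add: h'_def h\<gamma>_def)
qed

definition D1 :: "'i \<Rightarrow> real" where
  "D1 i = t i / a (\<sigma> i) * (endpoint_est (\<gamma>' i) (a' i) (x' i) - xs)"

text \<open>The standardised error of the estimated endpoint minus the sample mean, as an estimate
  of \<open>m\<close>. The endpoint enters with the vanishing factor \<open>a (\<sigma> i)\<close>,
  so only the sample mean survives in the limit.\<close>

definition V :: "'i \<Rightarrow> real" where "V i = a (\<sigma> i) * D1 i - S i"

lemma V_lim: "(V \<longlongrightarrow> - s) Fl"
proof -
  have "((\<lambda>i. a (\<sigma> i) * D1 i - S i) \<longlongrightarrow> 0 * (b + (g - \<gamma> * q) / (\<gamma> * \<gamma>) - l * (1 / (\<gamma> * (\<gamma> + \<rho>)))) - s) Fl"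
    unfolding D1_def by (intro tendsto_diff tendsto_mult endpoint_error S filterlim_compose[OF a_tendsto_0 \<sigma>_top])
  then show ?thesis by (simp add: V_def[abs_def])
qed

lemma V_eq: "\<forall>\<^sub>F i in Fl. endpoint_est (\<gamma>' i) (a' i) (x' i) - m' i = m + V i / t i"
  using a_\<sigma>_pos
proof eventually_elim
  case (elim i)
  have "V i / t i = (endpoint_est (\<gamma>' i) (a' i) (x' i) - xs) - S i / t i"
    using elim t_pos[of i] by (simp add: V_def D1_def field_simps)
  then show ?case by (simp add: m_def)
qed

lemma mV_pos: "\<forall>\<^sub>F i in Fl. m + V i / t i > 0"
proof -
  have "((\<lambda>i. m + V i / t i) \<longlongrightarrow> m + 0) Fl"
    by (intro tendsto_intros real_tendsto_divide_at_top[OF V_lim t_top])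
  then show ?thesis using m_pos by (intro order_tendstoD(1)) auto
qed

lemma Q_pos: "\<forall>\<^sub>F i in Fl. 1 + Q i / t i > 0"
proof -
  have "((\<lambda>i. 1 + Q i / t i) \<longlongrightarrow> 1 + 0) Fl"
    by (intro tendsto_intros real_tendsto_divide_at_top[OF Q t_top])
  then show ?thesis by (intro order_tendstoD(1)) auto
qed

lemma p_pos: "\<forall>\<^sub>F i in Fl. p (\<nu> i) > 0"
  using eventually_compose_filterlim[OF asymp_proportional_powr_ln(2)[OF p_asymp] \<nu>] .

lemma \<nu>_gt_1: "\<forall>\<^sub>F i in Fl. \<nu> i > 1"
  using eventually_compose_filterlim[OF eventually_gt_at_top[of 1] \<nu>] .

lemma R_pos: "\<forall>\<^sub>F i in Fl. R i > 0"
  using p_pos \<nu>_gt_1 by eventually_elim (use k_pos in simp)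

lemma ln_k_lim: "((\<lambda>i. ln (k (\<nu> i)) / ln (\<nu> i)) \<longlongrightarrow> \<alpha>) Fl"
  using filterlim_compose[OF asymp_proportional_powr_ln(1)[OF k_asymp] \<nu>] .

lemma ln_p_lim: "((\<lambda>i. ln (p (\<nu> i)) / ln (\<nu> i)) \<longlongrightarrow> - \<beta>) Fl"
  using filterlim_compose[OF asymp_proportional_powr_ln(1)[OF p_asymp] \<nu>] .

text \<open>The part of the logarithm of the estimated shortfall that depends on the estimated index
  alone.\<close>

definition \<Phi> :: "real \<Rightarrow> real" where
  "\<Phi> z = (1 - 1 / (1 - z)) * ln (1 - 1 / z) + 1 / (1 - z) * ln (- 1 / z)"

lemma \<Phi>_deriv: "\<exists>D. DERIV \<Phi> \<gamma> :> D"
proof -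
  have "1 - 1 / \<gamma> > 0" "- 1 / \<gamma> > 0" using gamma_neg by (auto simp: field_simps)
  then show ?thesis unfolding \<Phi>_def[abs_def] using gamma_neg
    by (intro exI) (rule derivative_eq_intros refl | force)+
qed

definition est :: "'i \<Rightarrow> real" where
  "est i = ((endpoint_est (\<gamma>' i) (a' i) (x' i) - m' i) * (1 - 1 / \<gamma>' i)) powr (- \<gamma>' i / (1 - \<gamma>' i))
       * (endpoint_est (\<gamma>' i) (a' i) (x' i) - quantile_est (R i) (\<gamma>' i) (a' i) (x' i)) powr (1 / (1 - \<gamma>' i))"

text \<open>The logarithm of the estimated shortfall with all errors set to zero, thus with
  \<gamma>, \<open>a (\<sigma> i)\<close> and \<open>m\<close> in place of their estimates.\<close>

definition ln_T0 :: "'i \<Rightarrow> real" where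
  "ln_T0 i = (1 - h\<gamma>) * (ln m + ln (1 - 1 / \<gamma>)) + h\<gamma> * (ln (a (\<sigma> i)) + ln (- 1 / \<gamma>) + \<gamma> * ln (R i))"

text \<open>The deviation of the logarithm from \<open>ln_T0\<close>, multiplied by
  \<open>t i\<close>. Every summand but the last converges; in the last one the logarithms are of
  order \<open>ln (\<nu> i)\<close>. The term \<open>- ln 1\<close> matches the shape of
  \<open>scaled_increment\<close>.\<close>

definition W :: "'i \<Rightarrow> real" where
  "W i = (1 - h' i) * (t i * (ln (m + V i / t i) - ln m)) - ln m * (t i * (h' i - h\<gamma>))
    + t i * (\<Phi> (\<gamma>' i) - \<Phi> \<gamma>) + h' i * (t i * (ln (1 + Q i / t i) - ln 1))
    + t i * (h' i - h\<gamma>) * (ln (a (\<sigma> i)) + ln (R i))"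

text \<open>The estimated endpoint minus the estimated quantile collapses to
  \<open>a' i * (- 1 / \<gamma>' i) * R i powr \<gamma>' i\<close>. The relation
  \<open>\<gamma>' i * h' i = h' i - 1\<close> turns the random exponent of \<open>R i\<close> into
  a function of \<open>h' i\<close>, so that \<open>ln (a (\<sigma> i))\<close> and
  \<open>ln (R i)\<close> enter with the common factor \<open>h' i - h\<gamma>\<close>.\<close>

lemma est_eq: "\<forall>\<^sub>F i in Fl. est i = exp (ln_T0 i + W i / t i)"
  using h' V_eq mV_pos Q_pos R_pos a_\<sigma>_pos \<gamma>'_neg
proof eventually_elim
  case (elim i)
  define z where "z = \<gamma>' i"
  have z: "z < 0" using elim(7) by (simp only: z_def)
  have pos: "1 - 1 / z > 0" "- 1 / z > 0" using z by (auto simp: field_simps)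
  have h: "h' i = 1 / (1 - z)" "- z / (1 - z) = 1 - h' i" "z * h' i = h' i - 1"
    using elim(1) by (simp_all only: z_def h'_def)
  have "endpoint_est z (a' i) (x' i) - quantile_est (R i) z (a' i) (x' i) = a (\<sigma> i) * (1 + Q i / t i) * (- 1 / z) * R i powr z"
  proof -
    have "(x - c / z) - (x + c * ((r - 1) / z)) = c * (- 1 / z) * r" for x c r
      using z by (simp add: field_simps)
    then show ?thesis unfolding endpoint_est_def quantile_est_def .
  qed
  then have "est i = ((m + V i / t i) * (1 - 1 / z)) powr (1 - h' i) *
      (a (\<sigma> i) * (1 + Q i / t i) * (- 1 / z) * R i powr z) powr h' i"
    unfolding est_def z_def[symmetric] h(2) using elim(2) unfolding z_def[symmetric] h(1)[symmetric] by simp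
  also have "\<dots> = exp ((1 - h' i) * ln ((m + V i / t i) * (1 - 1 / z))
     + h' i * ln (a (\<sigma> i) * (1 + Q i / t i) * (- 1 / z) * R i powr z))"
  proof -
    have 1: "a (\<sigma> i) * (1 + Q i / t i) > 0" using elim by (intro mult_pos_pos)
    have 2: "a (\<sigma> i) * (1 + Q i / t i) * (- 1 / z) > 0" using 1 pos(2) by (rule mult_pos_pos)
    have 3: "R i powr z > 0" using elim(5) by (metis powr_gt_zero less_irrefl)
    have e: "x powr c * y powr d = exp (c * ln x + d * ln y)" if "x > 0" "y > 0" for x y c d :: real
      using that by (simp add: powr_def exp_add)
    show ?thesis by (rule e[OF mult_pos_pos[OF elim(3) pos(1)] mult_pos_pos[OF 2 3]])
  qed
  also have "ln ((m + V i / t i) * (1 - 1 / z)) = ln (m + V i / t i) + ln (1 - 1 / z)"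
    using elim(3) pos by (intro ln_mult_pos)
  also have "ln (a (\<sigma> i) * (1 + Q i / t i) * (- 1 / z) * R i powr z)
      = ln (a (\<sigma> i)) + ln (1 + Q i / t i) + ln (- 1 / z) + z * ln (R i)"
  proof -
    have 1: "a (\<sigma> i) * (1 + Q i / t i) > 0" using elim by (intro mult_pos_pos)
    have 2: "a (\<sigma> i) * (1 + Q i / t i) * (- 1 / z) > 0" using 1 pos(2) by (rule mult_pos_pos)
    have 3: "R i powr z > 0" using elim(5) by (metis powr_gt_zero less_irrefl)
    show ?thesis
      unfolding ln_mult_pos[OF 2 3] ln_mult_pos[OF 1 pos(2)] ln_mult_pos[OF elim(6,4)]
      using ln_powr[of "R i" z] elim(5) by (metis less_irrefl)
  qed
  also have "(1 - h' i) * (ln (m + V i / t i) + ln (1 - 1 / z)) + h' i * (ln (a (\<sigma> i)) + ln (1 + Q i / t i) + ln (- 1 / z) + z * ln (R i))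
      = ln_T0 i + W i / t i"
  proof -
    have "W i / t i = (1 - h' i) * (ln (m + V i / t i) - ln m) - ln m * (h' i - h\<gamma>)
      + (\<Phi> z - \<Phi> \<gamma>) + h' i * ln (1 + Q i / t i) + (h' i - h\<gamma>) * (ln (a (\<sigma> i)) + ln (R i))"
    proof -
      have "T \<noteq> 0 \<Longrightarrow> (A1 * (T * x1) - x2 * (T * x3) + T * x4 + h * (T * (x5 - ln 1)) + T * x6 * x7) / T
        = A1 * x1 - x2 * x3 + x4 + h * x5 + x6 * x7" for T A1 x1 x2 x3 x4 h x5 x6 x7 :: real
        by (simp add: field_simps)
      then show ?thesis unfolding W_def z_def[symmetric] using t_pos[of i] by (metis less_irrefl)
    qed
    moreover have "\<Phi> z = (1 - h' i) * ln (1 - 1 / z) + h' i * ln (- 1 / z)" unfolding \<Phi>_def h(1) ..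
    moreover have "\<Phi> \<gamma> = (1 - h\<gamma>) * ln (1 - 1 / \<gamma>) + h\<gamma> * ln (- 1 / \<gamma>)" unfolding \<Phi>_def h\<gamma>_def ..
    moreover have "h' i * (z * ln (R i)) = (h' i - 1) * ln (R i)" unfolding h(3)[symmetric] by (simp only: mult_ac)
    moreover have "h\<gamma> * (\<gamma> * ln (R i)) = (h\<gamma> - 1) * ln (R i)" unfolding h\<gamma>(3)[symmetric] by (simp only: mult_ac)
    ultimately show ?thesis unfolding ln_T0_def by (simp only: distrib_left) (simp add: algebra_simps)
  qed
  finally show ?case .
qed

text \<open>Since \<open>t i * A (\<sigma> i)\<close> converges, replacing \<open>a\<close> by its
  pure power costs a relative error of order \<open>1 / t i\<close>, negligible against
  \<open>ln (\<nu> i) / t i\<close>.\<close>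

lemma log_a_expansion:
  assumes C: "C > 0" "K \<ge> 0" "\<forall>\<^sub>F s in at_top. \<bar>a s / (C * s powr \<gamma>) - 1\<bar> \<le> K * \<bar>A s\<bar>"
  shows "((\<lambda>i. t i / ln (\<nu> i) * ln (a (\<sigma> i) / (C * \<sigma> i powr \<gamma>))) \<longlongrightarrow> 0) Fl"
    and "((\<lambda>i. ln (a (\<sigma> i) / (C * \<sigma> i powr \<gamma>))) \<longlongrightarrow> 0) Fl"
proof -
  let ?v = "\<lambda>i. t i * (a (\<sigma> i) / (C * \<sigma> i powr \<gamma>) - 1) / ln (\<nu> i)"
  have "((\<lambda>i. K * \<bar>t i * A (\<sigma> i)\<bar> / ln (\<nu> i)) \<longlongrightarrow> 0) Fl"
    by (rule real_tendsto_divide_at_top[OF tendsto_mult[OF tendsto_const tendsto_rabs[OF filterlim_compose[OF kA \<nu>]]] ln_\<nu>_top])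
  moreover have "\<forall>\<^sub>F i in Fl. norm (?v i) \<le> K * \<bar>t i * A (\<sigma> i)\<bar> / ln (\<nu> i)"
    using eventually_compose_filterlim[OF C(3) \<sigma>_top] \<nu>_gt_1
  proof eventually_elim
    case (elim i)
    have "\<bar>t i\<bar> * \<bar>a (\<sigma> i) / (C * \<sigma> i powr \<gamma>) - 1\<bar> \<le> \<bar>t i\<bar> * (K * \<bar>A (\<sigma> i)\<bar>)"
      using elim by (intro mult_left_mono) auto
    then show ?case using elim(2) by (simp add: abs_mult divide_right_mono mult_ac)
  qed
  ultimately have v: "(?v \<longlongrightarrow> 0) Fl" by (rule Lim_null_comparison[rotated])
  have 1: "DERIV ln (1::real) :> 1" by (auto intro!: derivative_eq_intros)
  have *: "\<forall>\<^sub>F i in Fl. 1 + ?v i / (t i / ln (\<nu> i)) = a (\<sigma> i) / (C * \<sigma> i powr \<gamma>)"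
    using \<nu>_gt_1
  proof eventually_elim
    case (elim i)
    have "t i > 0" "ln (\<nu> i) > 0" using elim t_pos by auto
    then show ?case by simp
  qed
  have "((\<lambda>i. t i / ln (\<nu> i) * (ln (1 + ?v i / (t i / ln (\<nu> i))) - ln 1)) \<longlongrightarrow> 1 * 0) Fl"
    by (rule scaled_increment[OF 1 t_ln_top v])
  then have "((\<lambda>i. t i / ln (\<nu> i) * (ln (1 + ?v i / (t i / ln (\<nu> i))) - ln 1)) \<longlongrightarrow> 0) Fl" by simp
  then show "((\<lambda>i. t i / ln (\<nu> i) * ln (a (\<sigma> i) / (C * \<sigma> i powr \<gamma>))) \<longlongrightarrow> 0) Fl"
    by (rule Lim_transform_eventually) (use * in eventually_elim, simp only: ln_one diff_zero)
  have "((\<lambda>i. 1 + ?v i / (t i / ln (\<nu> i))) \<longlongrightarrow> 1 + 0) Fl"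
    by (intro tendsto_add tendsto_const real_tendsto_divide_at_top[OF v t_ln_top])
  then have "((\<lambda>i. ln (1 + ?v i / (t i / ln (\<nu> i)))) \<longlongrightarrow> ln (1 + 0)) Fl"
    by (rule tendsto_ln) simp
  then have "((\<lambda>i. ln (1 + ?v i / (t i / ln (\<nu> i)))) \<longlongrightarrow> 0) Fl" by simp
  then show "((\<lambda>i. ln (a (\<sigma> i) / (C * \<sigma> i powr \<gamma>))) \<longlongrightarrow> 0) Fl"
    by (rule Lim_transform_eventually) (use * in eventually_elim, simp only:)
qed

lemma log_rate_lim: "((\<lambda>i. (ln (a (\<sigma> i)) + ln (R i)) / ln (\<nu> i)) \<longlongrightarrow> log_rate) Fl"
proof -
  obtain C K where C: "C > 0" "K \<ge> 0" "\<forall>\<^sub>F s in at_top. \<bar>a s / (C * s powr \<gamma>) - 1\<bar> \<le> K * \<bar>A s\<bar>"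
    by (rule a_expansion)
  let ?r = "\<lambda>i. (ln (a (\<sigma> i) / (C * \<sigma> i powr \<gamma>)) + ln C) / ln (\<nu> i)"
  have "((\<lambda>i. ?r i + \<gamma> * (1 - ln (k (\<nu> i)) / ln (\<nu> i)) + (ln (k (\<nu> i)) / ln (\<nu> i) - 1 - ln (p (\<nu> i)) / ln (\<nu> i)))
      \<longlongrightarrow> 0 + \<gamma> * (1 - \<alpha>) + (\<alpha> - 1 - (- \<beta>))) Fl"
    by (intro tendsto_add tendsto_diff tendsto_mult tendsto_const ln_k_lim ln_p_lim
        real_tendsto_divide_at_top[OF tendsto_add[OF log_a_expansion(2)[OF C] tendsto_const] ln_\<nu>_top])
  then have "((\<lambda>i. ?r i + \<gamma> * (1 - ln (k (\<nu> i)) / ln (\<nu> i)) + (ln (k (\<nu> i)) / ln (\<nu> i) - 1 - ln (p (\<nu> i)) / ln (\<nu> i)))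
      \<longlongrightarrow> log_rate) Fl" by (simp add: log_rate_def)
  then show ?thesis
  proof (rule Lim_transform_eventually)
    show "\<forall>\<^sub>F i in Fl. ?r i + \<gamma> * (1 - ln (k (\<nu> i)) / ln (\<nu> i)) + (ln (k (\<nu> i)) / ln (\<nu> i) - 1 - ln (p (\<nu> i)) / ln (\<nu> i))
        = (ln (a (\<sigma> i)) + ln (R i)) / ln (\<nu> i)"
      using a_\<sigma>_pos \<nu>_gt_1 p_pos
    proof eventually_elim
      case (elim i)
      have ln\<nu>: "ln (\<nu> i) > 0" and kp: "real (k (\<nu> i)) > 0" and \<nu>p: "real (\<nu> i) > 0" using elim k_pos by auto
      have \<sigma>p: "\<sigma> i > 0" using kp \<nu>p by simp
      have 1: "ln (a (\<sigma> i) / (C * \<sigma> i powr \<gamma>)) = ln (a (\<sigma> i)) - (ln C + \<gamma> * (ln (\<nu> i) - ln (k (\<nu> i))))"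
        using elim(1) C(1) \<sigma>p kp \<nu>p by (simp add: ln_div ln_mult ln_powr)
      have 2: "ln (R i) = ln (k (\<nu> i)) - (ln (\<nu> i) + ln (p (\<nu> i)))"
        using elim kp \<nu>p by (simp add: ln_div ln_mult)
      show ?case unfolding 1 2 using ln\<nu> by (simp add: field_simps)
    qed
  qed
qed

text \<open>Division by \<open>ln (\<nu> i)\<close> removes the convergent summands; the last one
  becomes a product of two convergent factors.\<close>

lemma W_lim: "((\<lambda>i. W i / ln (\<nu> i)) \<longlongrightarrow> h\<gamma>\<^sup>2 * g * log_rate) Fl"
proof -
  obtain D where D: "DERIV \<Phi> \<gamma> :> D" using \<Phi>_deriv by blast
  have ln1: "DERIV ln (1::real) :> 1" and lnm: "DERIV ln m :> 1 / m"
    using m_pos by (auto intro!: derivative_eq_intros)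
  let ?P = "\<lambda>i. (1 - h' i) * (t i * (ln (m + V i / t i) - ln m)) - ln m * (t i * (h' i - h\<gamma>))
    + t i * (\<Phi> (\<gamma>' i) - \<Phi> \<gamma>) + h' i * (t i * (ln (1 + Q i / t i) - ln 1))"
  have P: "(?P \<longlongrightarrow> (1 - h\<gamma>) * (1 / m * (- s)) - ln m * (h\<gamma>\<^sup>2 * g) + D * g + h\<gamma> * (1 * q)) Fl"
    by (intro tendsto_add tendsto_diff[OF tendsto_mult] tendsto_mult[OF h'_lim] tendsto_mult[OF tendsto_const] tendsto_diff[OF tendsto_const]
        scaled_increment[OF ln1 t_top Q] scaled_increment[OF lnm t_top V_lim] scaled_increment[OF D t_top G] h'_rate h'_lim)
  have "((\<lambda>i. ?P i / ln (\<nu> i) + t i * (h' i - h\<gamma>) * ((ln (a (\<sigma> i)) + ln (R i)) / ln (\<nu> i))) \<longlongrightarrow> 0 + h\<gamma>\<^sup>2 * g * log_rate) Fl"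
    by (intro tendsto_add tendsto_mult[OF h'_rate log_rate_lim] real_tendsto_divide_at_top[OF P ln_\<nu>_top])
  moreover have "W i / ln (\<nu> i) = ?P i / ln (\<nu> i) + t i * (h' i - h\<gamma>) * ((ln (a (\<sigma> i)) + ln (R i)) / ln (\<nu> i))" for i
    unfolding W_def add_divide_distrib[of _ "t i * (h' i - h\<gamma>) * (ln (a (\<sigma> i)) + ln (R i))"]
    by (simp only: times_divide_eq_right)
  ultimately show ?thesis by (simp only: add_0)
qed

end

context standardised_errors
begin

definition coef :: "'i \<Rightarrow> real" where
  "coef i = (a (\<sigma> i) * R i powr \<gamma>) powr (1 / (1 - \<gamma>)) *
     ((1 - \<gamma>) powr (- 1 / (1 - \<gamma>)) / (\<gamma> * m powr (\<gamma> / (1 - \<gamma>))))"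

text \<open>The coefficient of the expansion is the error-free shortfall
  \<open>exp (ln_T0 i)\<close> times \<open>- 1 / (1 - \<gamma>)\<close>; dividing by it leaves a
  difference of exponentials close to 1.\<close>

lemma coef_eq: "\<forall>\<^sub>F i in Fl. coef i = - h\<gamma> * exp (ln_T0 i)"
  using R_pos a_\<sigma>_pos
proof eventually_elim
  case (elim i)
  have e1: "1 / (1 - \<gamma>) = h\<gamma>" "- 1 / (1 - \<gamma>) = - h\<gamma>" by (simp_all add: h\<gamma>_def)
  have e2: "\<gamma> / (1 - \<gamma>) = - (1 - h\<gamma>)" using h\<gamma>(2) by (simp add: field_simps)
  have pos: "1 - \<gamma> > 0" "- 1 / \<gamma> > 0" using gamma_neg by (auto simp: field_simps)
  have Rp: "R i powr \<gamma> > 0" using elim(1) by (metis powr_gt_zero less_irrefl)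
  have lnR: "ln (R i powr \<gamma>) = \<gamma> * ln (R i)" using elim(1) ln_powr[of "R i" \<gamma>] by (metis less_irrefl)
  have f1: "(a (\<sigma> i) * R i powr \<gamma>) powr h\<gamma> = exp (h\<gamma> * (ln (a (\<sigma> i)) + \<gamma> * ln (R i)))"
  proof -
    have "x powr y = exp (y * ln x)" if "x > 0" for x y :: real using that by (simp add: powr_def)
    from this[OF mult_pos_pos[OF elim(2) Rp]] show ?thesis
      by (simp only: ln_mult_pos[OF elim(2) Rp] lnR)
  qed
  have f2: "(1 - \<gamma>) powr (- h\<gamma>) = exp (- h\<gamma> * ln (1 - \<gamma>))" using pos by (simp add: powr_def)
  have f3: "m powr (- (1 - h\<gamma>)) = exp (- (1 - h\<gamma>) * ln m)" using m_pos by (simp add: powr_def)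
  have c1: "coef i = (1 / \<gamma>) * exp (h\<gamma> * (ln (a (\<sigma> i)) + \<gamma> * ln (R i)) - h\<gamma> * ln (1 - \<gamma>) + (1 - h\<gamma>) * ln m)"
    unfolding coef_def e1 e2 f1 f2 f3 by (simp add: exp_add exp_diff exp_minus field_simps)
  have g1: "- 1 / \<gamma> = exp (ln (- 1 / \<gamma>))" by (rule exp_ln[symmetric, OF pos(2)])
  have "ln (1 - 1 / \<gamma>) = ln ((1 - \<gamma>) * (- 1 / \<gamma>))"
    using gamma_neg by (intro arg_cong[where f = ln]) (simp add: field_simps)
  also have "\<dots> = ln (1 - \<gamma>) + ln (- 1 / \<gamma>)" by (rule ln_mult_pos[OF pos])
  finally have ln_split: "ln (1 - 1 / \<gamma>) = ln (1 - \<gamma>) + ln (- 1 / \<gamma>)" .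
  have T0: "ln_T0 i = ln (- 1 / \<gamma>) + ln (1 - \<gamma>)
      + (h\<gamma> * (ln (a (\<sigma> i)) + \<gamma> * ln (R i)) - h\<gamma> * ln (1 - \<gamma>) + (1 - h\<gamma>) * ln m)"
  proof -
    have "(1 - c) * (x + (y + z)) + c * (w + z + v) = z + y + (c * (w + v) - c * y + (1 - c) * x)" for c x y z w v :: real
      by (simp add: algebra_simps)
    then show ?thesis unfolding ln_T0_def ln_split .
  qed
  have "h\<gamma> * exp (ln (- 1 / \<gamma>) + ln (1 - \<gamma>)) = - 1 / \<gamma>"
    unfolding exp_add g1[symmetric] using pos by (simp add: h\<gamma>_def)
  then have "(1 / \<gamma>) * exp x = - h\<gamma> * exp (ln (- 1 / \<gamma>) + ln (1 - \<gamma>) + x)" for x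
    unfolding exp_add[of _ x] by (simp only: mult.assoc[symmetric] mult_minus_left)
  then show ?case unfolding c1 T0 .
qed

lemma coef_nz: "\<forall>\<^sub>F i in Fl. coef i \<noteq> 0"
  using coef_eq by eventually_elim (use h\<gamma>(1) in simp)

text \<open>The leading-order shortfall of \<open>expectile_asymptotics\<close>, with
  \<open>- C / \<gamma>\<close> for \<kappa>.\<close>

definition target :: "real \<Rightarrow> 'i \<Rightarrow> real" where
  "target C i = ((1 - 1 / \<gamma>) * (- C / \<gamma>) powr (- 1 / \<gamma>) * p (\<nu> i) * m) powr (- \<gamma> / (1 - \<gamma>))"

text \<open>Replacing \<open>a (\<sigma> i)\<close> by its pure power is all that separates the
  target from \<open>exp (ln_T0 i)\<close>: the ratio \<open>n / k\<close> cancels between that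
  power and \<open>R i powr \<gamma>\<close>.\<close>

lemma target_eq:
  assumes C: "C > 0"
  shows "\<forall>\<^sub>F i in Fl. target C i = exp (ln_T0 i - h\<gamma> * ln (a (\<sigma> i) / (C * \<sigma> i powr \<gamma>)))"
  using a_\<sigma>_pos p_pos \<nu>_gt_1
proof eventually_elim
  case (elim i)
  have kp: "real (k (\<nu> i)) > 0" and \<nu>p: "real (\<nu> i) > 0" using elim k_pos by auto
  then have \<sigma>p: "\<sigma> i > 0" by simp
  have pos: "1 - 1 / \<gamma> > 0" "- 1 / \<gamma> > 0" "- C / \<gamma> > 0" using gamma_neg C by (auto simp: field_simps)
  have 1: "ln (a (\<sigma> i) / (C * \<sigma> i powr \<gamma>)) = ln (a (\<sigma> i)) - (ln C + \<gamma> * (ln (\<nu> i) - ln (k (\<nu> i))))"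
    using elim(1) C \<sigma>p kp \<nu>p by (simp add: ln_div ln_mult ln_powr)
  have 2: "ln (R i) = ln (k (\<nu> i)) - (ln (\<nu> i) + ln (p (\<nu> i)))"
    using elim kp \<nu>p by (simp add: ln_div ln_mult)
  have \<kappa>p: "(- C / \<gamma>) powr (- 1 / \<gamma>) > 0" using pos(3) by (metis powr_gt_zero less_irrefl)
  have ln\<kappa>: "ln ((- C / \<gamma>) powr (- 1 / \<gamma>)) = (- 1 / \<gamma>) * (ln C + ln (- 1 / \<gamma>))"
  proof -
    have "ln ((- C / \<gamma>) powr (- 1 / \<gamma>)) = (- 1 / \<gamma>) * ln (- C / \<gamma>)"
      using pos(3) ln_powr[of "- C / \<gamma>" "- 1 / \<gamma>"] by (metis less_irrefl)
    moreover have "- C / \<gamma> = C * (- 1 / \<gamma>)" by simp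
    ultimately show ?thesis by (simp only: ln_mult_pos[OF C pos(2)])
  qed
  have P1: "(1 - 1 / \<gamma>) * (- C / \<gamma>) powr (- 1 / \<gamma>) > 0" using pos(1) \<kappa>p by (rule mult_pos_pos)
  have P2: "(1 - 1 / \<gamma>) * (- C / \<gamma>) powr (- 1 / \<gamma>) * p (\<nu> i) > 0" using P1 elim(2) by (rule mult_pos_pos)
  have P3: "(1 - 1 / \<gamma>) * (- C / \<gamma>) powr (- 1 / \<gamma>) * p (\<nu> i) * m > 0" using P2 m_pos by (rule mult_pos_pos)
  have "target C i = exp ((1 - h\<gamma>) * ln ((1 - 1 / \<gamma>) * (- C / \<gamma>) powr (- 1 / \<gamma>) * p (\<nu> i) * m))"
  proof -
    have "x powr y = exp (y * ln x)" if "x > 0" for x y :: real using that by (simp add: powr_def)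
    from this[OF P3] show ?thesis unfolding target_def h\<gamma>(2) .
  qed
  also have "ln ((1 - 1 / \<gamma>) * (- C / \<gamma>) powr (- 1 / \<gamma>) * p (\<nu> i) * m)
      = ln (1 - 1 / \<gamma>) + (- 1 / \<gamma>) * (ln C + ln (- 1 / \<gamma>)) + ln (p (\<nu> i)) + ln m"
    unfolding ln_mult_pos[OF P2 m_pos] ln_mult_pos[OF P1 elim(2)] ln_mult_pos[OF pos(1) \<kappa>p] ln\<kappa> ..
  also have "(1 - h\<gamma>) * (ln (1 - 1 / \<gamma>) + (- 1 / \<gamma>) * (ln C + ln (- 1 / \<gamma>)) + ln (p (\<nu> i)) + ln m)
      = ln_T0 i - h\<gamma> * ln (a (\<sigma> i) / (C * \<sigma> i powr \<gamma>))"
  proof -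
    have h1: "(1 - h\<gamma>) * (- 1 / \<gamma>) = h\<gamma>" using h\<gamma>(3) gamma_neg by (simp add: field_simps)
    have "(1 - h\<gamma>) * (x1 + (- 1 / \<gamma>) * y1 + z1 + w1) = (1 - h\<gamma>) * x1 + h\<gamma> * y1 + (1 - h\<gamma>) * z1 + (1 - h\<gamma>) * w1" for x1 y1 z1 w1
      by (simp only: distrib_left mult.assoc[symmetric] h1)
    moreover have "h\<gamma> * (\<gamma> * x1) = (h\<gamma> - 1) * x1" for x1 unfolding h\<gamma>(3)[symmetric] by (simp only: mult_ac)
    ultimately show ?thesis unfolding ln_T0_def 1 2
      by (simp only: distrib_left right_diff_distrib) (simp only: left_diff_distrib, simp)
  qed
  finally show ?case .
qed

text \<open>On the scale \<open>t i / ln (\<nu> i)\<close> both exponentials are linearised: after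
  division by the coefficient the random one contributes \<open>- h\<gamma> * log_rate * g\<close>
  and the deterministic one nothing. As
  \<open>- h\<gamma> * log_rate = 1 - \<alpha> - h\<gamma> * \<beta>\<close> is also the limit of
  the subtracted logarithm divided by \<open>ln n\<close>, the terms cancel. \<open>G2\<close>
  stands for the limit variable, which shares its limit with \<open>G\<close>.\<close>

lemma expectile_error:
  assumes C: "C > 0" "K \<ge> 0" "\<forall>\<^sub>F s in at_top. \<bar>a s / (C * s powr \<gamma>) - 1\<bar> \<le> K * \<bar>A s\<bar>"
    and G2: "(G2 \<longlongrightarrow> g) Fl"
  shows "((\<lambda>i. t i / ln (\<nu> i) * ((est i - target C i) / coef i
      - ln (\<nu> i * p (\<nu> i) powr (1 / (1 - \<gamma>)) / k (\<nu> i)) / t i * G2 i)) \<longlongrightarrow> 0) Fl"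
proof -
  let ?u = "\<lambda>i. t i / ln (\<nu> i)"
  let ?y = "\<lambda>i. ln (a (\<sigma> i) / (C * \<sigma> i powr \<gamma>))"
  let ?z = "\<lambda>i. ?u i * ?y i * (- h\<gamma>)"
  have exp0: "DERIV exp (0::real) :> 1" by (auto intro!: derivative_eq_intros)
  have l1: "((\<lambda>i. ?u i * (exp (0 + (W i / ln (\<nu> i)) / ?u i) - exp 0)) \<longlongrightarrow> 1 * (h\<gamma>\<^sup>2 * g * log_rate)) Fl"
    by (rule scaled_increment[OF exp0 t_ln_top W_lim])
  have l2: "((\<lambda>i. ?u i * (exp (0 + ?z i / ?u i) - exp 0)) \<longlongrightarrow> 1 * (0 * (- h\<gamma>))) Fl"
    by (rule scaled_increment[OF exp0 t_ln_top tendsto_mult[OF log_a_expansion(1)[OF C] tendsto_const]])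
  have l3: "((\<lambda>i. (1 + h\<gamma> * (ln (p (\<nu> i)) / ln (\<nu> i)) - ln (k (\<nu> i)) / ln (\<nu> i)) * G2 i)
      \<longlongrightarrow> (1 + h\<gamma> * (- \<beta>) - \<alpha>) * g) Fl"
    by (intro tendsto_mult[OF tendsto_diff[OF tendsto_add[OF tendsto_const tendsto_mult[OF tendsto_const]]]] ln_p_lim ln_k_lim G2)
  have "((\<lambda>i. - (1 / h\<gamma>) * (?u i * (exp (0 + (W i / ln (\<nu> i)) / ?u i) - exp 0) - ?u i * (exp (0 + ?z i / ?u i) - exp 0))
      - (1 + h\<gamma> * (ln (p (\<nu> i)) / ln (\<nu> i)) - ln (k (\<nu> i)) / ln (\<nu> i)) * G2 i)
      \<longlongrightarrow> - (1 / h\<gamma>) * (1 * (h\<gamma>\<^sup>2 * g * log_rate) - 1 * (0 * (- h\<gamma>))) - (1 + h\<gamma> * (- \<beta>) - \<alpha>) * g) Fl"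
    by (rule tendsto_diff[OF tendsto_mult[OF tendsto_const tendsto_diff[OF l1 l2]] l3])
  moreover have "- (1 / h\<gamma>) * (1 * (h\<gamma>\<^sup>2 * g * log_rate) - 1 * (0 * (- h\<gamma>))) - (1 + h\<gamma> * (- \<beta>) - \<alpha>) * g = 0"
  proof -
    have "h\<gamma> * log_rate = - (1 - \<alpha>) + h\<gamma> * \<beta>"
      using gamma_neg unfolding h\<gamma>_def log_rate_def by (simp add: field_simps)
    moreover have "- (1 / h\<gamma>) * (1 * (h\<gamma>\<^sup>2 * g * log_rate) - 1 * (0 * (- h\<gamma>))) = - (h\<gamma> * log_rate) * g"
      using h\<gamma>(1) by (simp add: power2_eq_square)
    ultimately show ?thesis by (simp only:) (simp add: algebra_simps)
  qed
  ultimately have "((\<lambda>i. - (1 / h\<gamma>) * (?u i * (exp (0 + (W i / ln (\<nu> i)) / ?u i) - exp 0) - ?u i * (exp (0 + ?z i / ?u i) - exp 0))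
      - (1 + h\<gamma> * (ln (p (\<nu> i)) / ln (\<nu> i)) - ln (k (\<nu> i)) / ln (\<nu> i)) * G2 i) \<longlongrightarrow> 0) Fl"
    by (simp only:)
  then show ?thesis
  proof (rule Lim_transform_eventually)
    show "\<forall>\<^sub>F i in Fl. - (1 / h\<gamma>) * (?u i * (exp (0 + (W i / ln (\<nu> i)) / ?u i) - exp 0) - ?u i * (exp (0 + ?z i / ?u i) - exp 0))
      - (1 + h\<gamma> * (ln (p (\<nu> i)) / ln (\<nu> i)) - ln (k (\<nu> i)) / ln (\<nu> i)) * G2 i
      = ?u i * ((est i - target C i) / coef i - ln (\<nu> i * p (\<nu> i) powr (1 / (1 - \<gamma>)) / k (\<nu> i)) / t i * G2 i)"
      using est_eq target_eq[OF C(1)] coef_eq \<nu>_gt_1 p_pos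
    proof eventually_elim
      case (elim i)
      define u where "u = ?u i"
      define L where "L = ln (real (\<nu> i))"
      have L: "L > 0" using elim(4) by (simp add: L_def)
      have tp: "t i > 0" by (rule t_pos)
      have u: "u > 0" "u = t i / L" using L tp by (simp_all add: u_def L_def)
      have 1: "0 + (W i / L) / u = W i / t i" using L tp by (simp add: u(2))
      have 2: "0 + (u * ?y i * (- h\<gamma>)) / u = - h\<gamma> * ?y i" using u(1) by simp
      have 3: "(est i - target C i) / coef i = - (1 / h\<gamma>) * (exp (W i / t i) - exp (- h\<gamma> * ?y i))"
      proof -
        have "est i - target C i = exp (ln_T0 i) * (exp (W i / t i) - exp (- h\<gamma> * ?y i))"
          unfolding elim(1,2) by (simp add: exp_add exp_diff exp_minus field_simps)
        moreover have "x \<noteq> 0 \<Longrightarrow> (x * d) / (- h\<gamma> * x) = - (1 / h\<gamma>) * d" for x d :: real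
          using h\<gamma>(1) by simp
        ultimately show ?thesis unfolding elim(3) by (simp only: exp_not_eq_zero not_False_eq_True)
      qed
      have 4: "ln (\<nu> i * p (\<nu> i) powr (1 / (1 - \<gamma>)) / k (\<nu> i)) = L + h\<gamma> * ln (p (\<nu> i)) - ln (k (\<nu> i))"
        using elim(4,5) k_pos[of "\<nu> i"] by (simp add: ln_div ln_mult ln_powr h\<gamma>_def L_def)
      have 5: "u * ((L + h\<gamma> * ln (p (\<nu> i)) - ln (k (\<nu> i))) / t i * G2 i)
          = (1 + h\<gamma> * (ln (p (\<nu> i)) / L) - ln (k (\<nu> i)) / L) * G2 i"
        using L tp unfolding u(2) by (simp add: field_simps)
      have gen: "- c * (u * (e1 - 1) - u * (e2 - 1)) - z = u * (- c * (e1 - e2) - y)"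
        if "u * y = z" for c e1 e2 y z
        unfolding that[symmetric] by (simp add: algebra_simps)
      show ?case
        unfolding L_def[symmetric] u(2)[symmetric] 1 2 3 4 exp_zero by (rule gen[OF 5])
    qed
  qed
qed

end

section \<open>Remainders as functions of the standardised errors and of the limit vector\<close>

type_synonym real4 = "real \<times> real \<times> real \<times> real"

context tail_sequences
begin

text \<open>The first tuple is the vector of standardised errors, the second the limit vector; the
  formula is the expansion of the endpoint error solved for its remainder.\<close>

definition endpoint_remainder :: "nat \<Rightarrow> real4 \<Rightarrow> real4 \<Rightarrow> real" where
  "endpoint_remainder n = (\<lambda>(G, Q, B, S) (g, q, b, s).
     \<gamma>\<^sup>2 * (sqrt (k n) / a (n / k n) *
       (endpoint_est (\<gamma> + G / sqrt (k n)) (a (n / k n) * (1 + Q / sqrt (k n)))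
         (U (n / k n) + a (n / k n) * B / sqrt (k n)) - xs))
     - (g + \<gamma>\<^sup>2 * b - \<gamma> * q - l * \<gamma> / (\<gamma> + \<rho>)))"

definition expectile_coef :: "real \<Rightarrow> nat \<Rightarrow> real" where
  "expectile_coef \<mu> n = (a (n / k n) * (k n / (n * p n)) powr \<gamma>) powr (1 / (1 - \<gamma>)) *
     ((1 - \<gamma>) powr (- 1 / (1 - \<gamma>)) / (\<gamma> * (xs - \<mu>) powr (\<gamma> / (1 - \<gamma>))))"

definition expectile_target :: "real \<Rightarrow> real \<Rightarrow> nat \<Rightarrow> real" where
  "expectile_target C \<mu> n = ((1 - 1 / \<gamma>) * (- C / \<gamma>) powr (- 1 / \<gamma>) * p n * (xs - \<mu>)) powr (- \<gamma> / (1 - \<gamma>))"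

definition shortfall_est :: "real \<Rightarrow> real \<Rightarrow> real \<Rightarrow> real \<Rightarrow> real \<Rightarrow> real" where
  "shortfall_est r g b x m = ((endpoint_est g b x - m) * (1 - 1 / g)) powr (- g / (1 - g))
     * (endpoint_est g b x - quantile_est r g b x) powr (1 / (1 - g))"

definition expectile_remainder :: "real \<Rightarrow> real \<Rightarrow> nat \<Rightarrow> real4 \<Rightarrow> real4 \<Rightarrow> real" where
  "expectile_remainder C \<mu> n = (\<lambda>(G, Q, B, S) (g, q, b, s).
     sqrt (k n) / ln n *
      ((shortfall_est (k n / (n * p n)) (\<gamma> + G / sqrt (k n)) (a (n / k n) * (1 + Q / sqrt (k n)))
          (U (n / k n) + a (n / k n) * B / sqrt (k n)) (\<mu> + S / sqrt (k n))
        - expectile_target C \<mu> n) / expectile_coef \<mu> n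
       - ln (n * p n powr (1 / (1 - \<gamma>)) / k n) / sqrt (k n) * g))"

text \<open>The errors are read off the first of the two points; \<open>F'\<close> is the filter of
  the second, the limit vector.\<close>

lemma standardised_errors_filter:
  assumes "\<mu> < xs"
  shows "standardised_errors U a A \<gamma> \<rho> k p \<alpha> \<beta> l
    (sequentially \<times>\<^sub>F (nhds (g, q, b, s) \<times>\<^sub>F F')) fst (\<lambda>i. fst (fst (snd i))) (\<lambda>i. fst (snd (fst (snd i))))
    (\<lambda>i. fst (snd (snd (fst (snd i))))) (\<lambda>i. snd (snd (snd (fst (snd i))))) g q b s \<mu>"
proof -
  let ?F = "sequentially \<times>\<^sub>F (nhds (g, q, b, s) \<times>\<^sub>F F')"
  have "filterlim (\<lambda>i. fst (snd i)) (nhds (g, q, b, s)) ?F"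
    by (rule filterlim_compose[OF filterlim_fst filterlim_snd])
  then have w: "((\<lambda>i. fst (snd i)) \<longlongrightarrow> (g, q, b, s)) ?F" .
  from tendsto_fst[OF w] tendsto_fst[OF tendsto_snd[OF w]] tendsto_fst[OF tendsto_snd[OF tendsto_snd[OF w]]]
    tendsto_snd[OF tendsto_snd[OF tendsto_snd[OF w]]]
  show ?thesis using assms by unfold_locales (simp_all add: filterlim_fst)
qed

lemma endpoint_remainder_lim:
  assumes "\<mu> < xs"
  shows "((\<lambda>(n, x, y). endpoint_remainder n x y) \<longlongrightarrow> 0) (sequentially \<times>\<^sub>F (nhds w \<times>\<^sub>F nhds w))"
proof -
  obtain g q b s where w: "w = (g, q, b, s)" by (metis prod.collapse)
  let ?F = "sequentially \<times>\<^sub>F (nhds (g, q, b, s) \<times>\<^sub>F nhds (g, q, b, s))"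
  interpret standardised_errors U a A \<gamma> \<rho> k p \<alpha> \<beta> l ?F fst "\<lambda>i. fst (fst (snd i))" "\<lambda>i. fst (snd (fst (snd i)))"
    "\<lambda>i. fst (snd (snd (fst (snd i))))" "\<lambda>i. snd (snd (snd (fst (snd i))))" g q b s \<mu>
    by (rule standardised_errors_filter[OF assms])
  have "filterlim (\<lambda>i. snd (snd i)) (nhds (g, q, b, s)) ?F"
    by (rule filterlim_compose[OF filterlim_snd filterlim_snd])
  then have y: "((\<lambda>i. snd (snd i)) \<longlongrightarrow> (g, q, b, s)) ?F" .
  note y1 = tendsto_fst[OF y] and y2 = tendsto_fst[OF tendsto_snd[OF y]] and y3 = tendsto_fst[OF tendsto_snd[OF tendsto_snd[OF y]]]
  have "((\<lambda>i. \<gamma>\<^sup>2 * (t i / a (\<sigma> i) * (endpoint_est (\<gamma>' i) (a' i) (x' i) - xs))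
      - (fst (snd (snd i)) + \<gamma>\<^sup>2 * fst (snd (snd (snd (snd i)))) - \<gamma> * fst (snd (snd (snd i))) - l * \<gamma> / (\<gamma> + \<rho>)))
     \<longlongrightarrow> \<gamma>\<^sup>2 * (b + (g - \<gamma> * q) / (\<gamma> * \<gamma>) - l * (1 / (\<gamma> * (\<gamma> + \<rho>))))
      - (fst (g, q, b, s) + \<gamma>\<^sup>2 * fst (snd (snd (g, q, b, s))) - \<gamma> * fst (snd (g, q, b, s)) - l * \<gamma> / (\<gamma> + \<rho>))) ?F"
    by (intro tendsto_diff[OF tendsto_mult[OF tendsto_const endpoint_error]] tendsto_diff tendsto_add
        tendsto_mult[OF tendsto_const] tendsto_const y1 y2 y3)
  moreover have "\<gamma>\<^sup>2 * (b + (g - \<gamma> * q) / (\<gamma> * \<gamma>) - l * (1 / (\<gamma> * (\<gamma> + \<rho>))))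
      - (fst (g, q, b, s) + \<gamma>\<^sup>2 * fst (snd (snd (g, q, b, s))) - \<gamma> * fst (snd (g, q, b, s)) - l * \<gamma> / (\<gamma> + \<rho>)) = 0"
  proof -
    have 1: "\<gamma>\<^sup>2 * ((g - \<gamma> * q) / (\<gamma> * \<gamma>)) = g - \<gamma> * q"
      using gamma_neg by (simp add: power2_eq_square)
    have 2: "\<gamma>\<^sup>2 * (l * (1 / (\<gamma> * (\<gamma> + \<rho>)))) = l * \<gamma> / (\<gamma> + \<rho>)"
      using gamma_neg by (simp add: power2_eq_square)
    show ?thesis by (simp only: right_diff_distrib[of "\<gamma>\<^sup>2"] distrib_left[of "\<gamma>\<^sup>2"] 1 2 fst_conv snd_conv)
  qed
  ultimately show ?thesis
    unfolding w by (simp only: endpoint_remainder_def case_prod_beta case_prod_beta')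
qed

lemma expectile_remainder_lim:
  assumes "\<mu> < xs" and C: "C > 0" "K \<ge> 0" "\<forall>\<^sub>F s in at_top. \<bar>a s / (C * s powr \<gamma>) - 1\<bar> \<le> K * \<bar>A s\<bar>"
  shows "((\<lambda>(n, x, y). expectile_remainder C \<mu> n x y) \<longlongrightarrow> 0) (sequentially \<times>\<^sub>F (nhds w \<times>\<^sub>F nhds w))"
proof -
  obtain g q b s where w: "w = (g, q, b, s)" by (metis prod.collapse)
  let ?F = "sequentially \<times>\<^sub>F (nhds (g, q, b, s) \<times>\<^sub>F nhds (g, q, b, s))"
  interpret standardised_errors U a A \<gamma> \<rho> k p \<alpha> \<beta> l ?F fst "\<lambda>i. fst (fst (snd i))" "\<lambda>i. fst (snd (fst (snd i)))"
    "\<lambda>i. fst (snd (snd (fst (snd i))))" "\<lambda>i. snd (snd (snd (fst (snd i))))" g q b s \<mu>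
    by (rule standardised_errors_filter[OF assms(1)])
  have "filterlim (\<lambda>i. snd (snd i)) (nhds (g, q, b, s)) ?F"
    by (rule filterlim_compose[OF filterlim_snd filterlim_snd])
  then have y: "((\<lambda>i. snd (snd i)) \<longlongrightarrow> (g, q, b, s)) ?F" .
  have y1: "((\<lambda>i. fst (snd (snd i))) \<longlongrightarrow> g) ?F" using tendsto_fst[OF y] by simp
  from expectile_error[OF C y1] show ?thesis
    unfolding w by (simp only: expectile_remainder_def case_prod_beta case_prod_beta' est_def target_def coef_def m_def
        shortfall_est_def expectile_target_def expectile_coef_def)
qed

text \<open>The coefficient is deterministic, so the locale is instantiated with all errors equal to
  0.\<close>

lemma expectile_coef_nz:
  assumes "\<mu> < xs"
  shows "\<forall>\<^sub>F n in sequentially. expectile_coef \<mu> n \<noteq> 0"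
proof -
  interpret standardised_errors U a A \<gamma> \<rho> k p \<alpha> \<beta> l sequentially "\<lambda>n. n" "\<lambda>_. 0" "\<lambda>_. 0" "\<lambda>_. 0" "\<lambda>_. 0" 0 0 0 0 \<mu>
    using assms by unfold_locales (auto simp: filterlim_ident)
  show ?thesis using coef_nz by (simp only: coef_def m_def expectile_coef_def)
qed

lemma expectile_est_eq: "expectile_est r g b x m = endpoint_est g b x - shortfall_est r g b x m"
  by (simp add: expectile_est_def shortfall_est_def)

end

section \<open>Versions of the estimators and the final expansion\<close>

lemma measurable_real4:
  fixes f :: "'a \<Rightarrow> real4"
  assumes "f \<in> borel_measurable M"
  shows "(\<lambda>x. fst (f x)) \<in> borel_measurable M" "(\<lambda>x. fst (snd (f x))) \<in> borel_measurable M"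
    "(\<lambda>x. fst (snd (snd (f x)))) \<in> borel_measurable M" "(\<lambda>x. snd (snd (snd (f x)))) \<in> borel_measurable M"
  using borel_measurable_continuous_on[OF _ assms, of "\<lambda>x. fst x"] borel_measurable_continuous_on[OF _ assms, of "\<lambda>x. fst (snd x)"]
    borel_measurable_continuous_on[OF _ assms, of "\<lambda>x. fst (snd (snd x))"] borel_measurable_continuous_on[OF _ assms, of "\<lambda>x. snd (snd (snd x))"]
  by (simp_all add: continuous_on_fst continuous_on_snd continuous_on_id)

text \<open>The coupling controls the first three coordinates; the fourth, with limit 0, is added at
  the cost of its modulus.\<close>

lemma dist_real4_le:
  fixes x y z s g q b d :: real
  shows "dist (x, y, z, s) (g, q, b, 0) \<le> dist (x, y, z, 0::real) (g, q, b, d) + \<bar>s\<bar>"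
proof -
  have "dist (x, y, z, s) (g, q, b, 0) \<le> dist (x, y, z, s) (x, y, z, 0) + dist (x, y, z, 0::real) (g, q, b, 0::real)"
    by (rule dist_triangle)
  also have "dist (x, y, z, s) (x, y, z, 0) = \<bar>s\<bar>" by (simp add: dist_Pair_Pair)
  also have "dist (x, y, z, 0::real) (g, q, b, 0::real) \<le> dist (x, y, z, 0::real) (g, q, b, d)"
    by (simp add: dist_Pair_Pair)
  finally show ?thesis by simp
qed

theorem theorem3:
  fixes M :: "'a measure"
    and X :: "'a \<Rightarrow> real"
    and Xs :: "nat \<Rightarrow> 'a \<Rightarrow> real"
    and F U a A :: "real \<Rightarrow> real"
    and \<gamma> \<rho> \<alpha> \<beta> \<mu> xstar l :: real
    and k :: "nat \<Rightarrow> nat"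
    and p :: "nat \<Rightarrow> real"
    and ghat ahat :: "nat \<Rightarrow> 'a \<Rightarrow> real"
    and L :: "(real \<times> real \<times> real) measure"
  assumes "prob_space M"
    and "X \<in> borel_measurable M"
    and "F = cdf (distr M borel X)"
    and "\<And>t. t \<ge> 1 \<Longrightarrow> Xs t \<in> borel_measurable M"
    and "\<And>t. t \<ge> 1 \<Longrightarrow> cdf (distr M borel (Xs t)) = F"
    and "integrable M (\<lambda>\<omega>. \<bar>min (X \<omega>) 0\<bar>)"
    and "\<mu> = (\<integral>\<omega>. X \<omega> \<partial>M)"
    and "U = tail_quantile F"
    and "second_order_cond U \<gamma> a \<rho> A"
    and "\<rho> < 0"
    and "xstar = right_endpoint F"
    and "\<And>n. k n > 0"
    and "0 < \<alpha>" "\<alpha> < 1"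
    and "asymp_proportional (\<lambda>n. real (k n)) (\<lambda>n. real n powr \<alpha>)"
    and "\<And>n. ghat n \<in> borel_measurable M"
    and "\<And>n. ahat n \<in> borel_measurable M"
    and "prob_space L" "sets L = sets borel"
    and "L \<noteq> return borel 0"
    and "conv_in_distr M
           (\<lambda>n \<omega>. (sqrt (k n) * (ghat n \<omega> - \<gamma>),
                   sqrt (k n) * (ahat n \<omega> / a (n / k n) - 1),
                   sqrt (k n) * ((order_stat Xs (n - k n) n \<omega> - U (n / k n)) / a (n / k n)))) L"
    and "small_o_prob M (\<lambda>n \<omega>. sqrt (k n) * (sample_mean Xs n \<omega> - \<mu>)) (\<lambda>_. 1)"
    and "\<beta> > 0" "\<alpha> + \<beta> - 1 > 0"
    and "asymp_proportional p (\<lambda>n. real n powr (- \<beta>))"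
    and "(\<lambda>n. sqrt (k n) * A (n / k n)) \<longlonglongrightarrow> l"
  shows "\<exists>(M' :: (nat \<Rightarrow> real \<times> real \<times> real \<times> real) measure) \<Gamma> \<Lambda> B g' a' x' m' R1 R2 r.
    prob_space M' \<and>
    \<Gamma> \<in> borel_measurable M' \<and> \<Lambda> \<in> borel_measurable M' \<and> B \<in> borel_measurable M' \<and>
    distr M' borel (\<lambda>\<omega>. (\<Gamma> \<omega>, \<Lambda> \<omega>, B \<omega>)) = L \<and>
    (\<forall>n. g' n \<in> borel_measurable M' \<and> a' n \<in> borel_measurable M' \<and>
         x' n \<in> borel_measurable M' \<and> m' n \<in> borel_measurable M' \<and>
         distr M' borel (\<lambda>\<omega>. (g' n \<omega>, a' n \<omega>, x' n \<omega>, m' n \<omega>)) =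
         distr M borel (\<lambda>\<omega>. (ghat n \<omega>, ahat n \<omega>, order_stat Xs (n - k n) n \<omega>, sample_mean Xs n \<omega>))) \<and>
    small_o_prob M' R1 (\<lambda>_. 1) \<and>
    small_o_prob M' R2 (\<lambda>n. ln n / sqrt (k n)) \<and>
    r \<in> O(\<lambda>n. n powr (\<beta> * \<gamma> / (1 - \<gamma>)) *
              (n powr (\<beta> * \<gamma> / (1 - \<gamma>)) + \<bar>A (n powr (\<beta> / (1 - \<gamma>)))\<bar>)) \<and>
    (\<forall>\<^sub>F n in sequentially. \<forall>\<omega>\<in>space M'.
       expectile_est (k n / (n * p n)) (g' n \<omega>) (a' n \<omega>) (x' n \<omega>) (m' n \<omega>)
         - expectile M X (1 - p n) =
       a (n / k n) / sqrt (k n) * (1 / \<gamma>\<^sup>2) *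
         (\<Gamma> \<omega> + \<gamma>\<^sup>2 * B \<omega> - \<gamma> * \<Lambda> \<omega> - l * \<gamma> / (\<gamma> + \<rho>) + R1 n \<omega>)
       - (a (n / k n) * (k n / (n * p n)) powr \<gamma>) powr (1 / (1 - \<gamma>)) *
         ((1 - \<gamma>) powr (- 1 / (1 - \<gamma>)) / (\<gamma> * (xstar - \<mu>) powr (\<gamma> / (1 - \<gamma>)))) *
         (ln (n * p n powr (1 / (1 - \<gamma>)) / k n) / sqrt (k n) * \<Gamma> \<omega> + R2 n \<omega>)
       + r n)"
proof -
  interpret M: prob_space M by fact
  have Xm[measurable]: "X \<in> borel_measurable M" by fact
  interpret D: real_distribution "distr M borel X" by (rule M.real_distribution_distr) simp
  have F: "F = cdf (distr M borel X)" by fact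
  have U: "U = tail_quantile (cdf (distr M borel X))" using assms(3,8) by simp
  have SO: "second_order_mono U a A \<gamma> \<rho>"
  proof
    show "U s \<le> U t" if "1 < s" "s \<le> t" for s t unfolding U by (rule D.tail_quantile_mono[OF that])
  qed (rule assms(9), rule assms(10))
  interpret T: tail_sequences U a A \<gamma> \<rho> k p \<alpha> \<beta> l
    by (intro tail_sequences.intro SO tail_sequences_axioms.intro) (rule assms(12-15,25,26))+
  have endpoint: "\<And>x. x < T.xs \<Longrightarrow> cdf (distr M borel X) x < 1" "cdf (distr M borel X) T.xs = 1"
    "right_endpoint (cdf (distr M borel X)) = T.xs"
  proof -
    have lim: "(tail_quantile (cdf (distr M borel X)) \<longlongrightarrow> T.xs) at_top"
      unfolding U[symmetric] by (rule T.U_lim)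
    have le: "tail_quantile (cdf (distr M borel X)) s \<le> T.xs" if "s > 1" for s
      unfolding U[symmetric] by (rule T.U_le_xs[OF that])
    show "\<And>x. x < T.xs \<Longrightarrow> cdf (distr M borel X) x < 1" "cdf (distr M borel X) T.xs = 1"
      "right_endpoint (cdf (distr M borel X)) = T.xs"
      by (rule D.right_endpoint_eq[OF lim le]; assumption)+
  qed
  have xstar: "xstar = T.xs" using endpoint(3) assms(3,11) by simp
  have gt: "M.prob {\<omega> \<in> space M. x < X \<omega>} = 1 - cdf (distr M borel X) x"
    and le: "M.prob {\<omega> \<in> space M. X \<omega> \<le> x} = cdf (distr M borel X) x" for x
  proof -
    show le: "M.prob {\<omega> \<in> space M. X \<omega> \<le> x} = cdf (distr M borel X) x"
      unfolding cdf_def by (subst measure_distr) (auto intro!: arg_cong[where f = M.prob])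
    have "{\<omega> \<in> space M. x < X \<omega>} = space M - {\<omega> \<in> space M. X \<omega> \<le> x}" by auto
    then show "M.prob {\<omega> \<in> space M. x < X \<omega>} = 1 - cdf (distr M borel X) x"
      by (simp add: M.prob_compl le)
  qed
  have X_le: "AE \<omega> in M. X \<omega> \<le> T.xs"
  proof -
    have "M.prob {\<omega> \<in> space M. X \<omega> \<le> T.xs} = 1" unfolding le by (rule endpoint(2))
    then have "AE \<omega> in M. \<omega> \<in> {\<omega> \<in> space M. X \<omega> \<le> T.xs}" by (subst (asm) M.prob_eq_1) auto
    then show ?thesis by eventually_elim simp
  qed
  \<comment> \<open>The negative part is integrable by assumption, and the finite endpoint bounds
    the positive part.\<close>
  have X_int: "integrable M X"
  proof (rule Bochner_Integration.integrable_bound)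
    show "integrable M (\<lambda>\<omega>. \<bar>min (X \<omega>) 0\<bar> + \<bar>T.xs\<bar>)" using assms(6) by simp
    show "AE \<omega> in M. norm (X \<omega>) \<le> norm (\<bar>min (X \<omega>) 0\<bar> + \<bar>T.xs\<bar>)"
      using X_le by eventually_elim (auto simp: min_def)
  qed fact
  interpret BA: bounded_above M X T.xs by unfold_locales (fact X_int X_le)+
  have \<mu>: "\<mu> = BA.\<mu>" by fact
  have tail: "M.prob {\<omega> \<in> space M. t < X \<omega>} > 0" if "t < T.xs" for t
    unfolding gt using endpoint(1)[OF that] by simp
  \<comment> \<open>\<open>endpoint_first_order\<close> has a positive limit, so some quantile lies
    strictly below the endpoint; the mass there pulls the mean below the endpoint as well.\<close>
  have mean: "BA.\<mu> < T.xs"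
  proof -
    have "\<forall>\<^sub>F s in at_top. (T.xs - U s) / a s > 0"
      using T.gamma_neg by (intro order_tendstoD(1)[OF T.endpoint_first_order]) (simp add: divide_neg_neg)
    then have "\<forall>\<^sub>F s in at_top. (T.xs - U s) / a s > 0 \<and> s > 1"
      using eventually_gt_at_top[of 1] by (rule eventually_conj)
    then obtain s where s: "(T.xs - U s) / a s > 0" "s > 1"
      using eventually_happens'[OF trivial_limit_at_top_linorder] by blast
    then have "U s < T.xs" using T.a_pos[of s] by (simp add: zero_less_divide_iff)
    then obtain t where t: "U s < t" "t < T.xs" using dense by blast
    have "0 < 1 - 1 / s" using s by simp
    also have "\<dots> \<le> cdf (distr M borel X) t"
      using t(1) unfolding U by (rule D.cdf_tail_quantile(2)[OF s(2)])
    finally show ?thesis using t(2) by (intro BA.mean_less[of t]) (simp_all add: le)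
  qed
  obtain C K where C: "C > 0" "K \<ge> 0"
    "\<forall>\<^sub>F s in at_top. \<bar>a s / (C * s powr \<gamma>) - 1\<bar> \<le> K * \<bar>A s\<bar>"
    "\<forall>\<^sub>F s in at_top. \<bar>(T.xs - U s) / (- C / \<gamma> * s powr \<gamma>) - 1\<bar> \<le> K * \<bar>A s\<bar>"
    by (rule T.second_order_expansion)
  obtain M0 S1 where M0: "M0 > 0" "S1 > 1" "\<And>s t. s \<ge> S1 \<Longrightarrow> s \<le> t \<Longrightarrow> \<bar>A t\<bar> \<le> M0 * \<bar>A s\<bar>"
    by (rule T.A_uniform) blast
  obtain c where c: "c > 0" "(\<lambda>n. p n / real n powr (- \<beta>)) \<longlonglongrightarrow> c"
    using T.p_asymp by (auto simp: asymp_proportional_def)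
  have \<kappa>: "- C / \<gamma> > 0" using C(1) T.gamma_neg by (simp add: divide_pos_neg)
  have V: "\<forall>\<^sub>F s in at_top. \<bar>(T.xs - tail_quantile (cdf (distr M borel X)) s) / (- C / \<gamma> * s powr \<gamma>) - 1\<bar> \<le> K * \<bar>A s\<bar>"
    unfolding U[symmetric] by (rule C(4))
  \<comment> \<open>The deterministic bias between the shortfall of the expectile and the power that
    the estimator targets.\<close>
  define r where "r n = T.xs - expectile M X (1 - p n) - T.expectile_target C \<mu> n" for n
  have r: "r \<in> O(\<lambda>n. real n powr (\<beta> * \<gamma> / (1 - \<gamma>)) *
              (real n powr (\<beta> * \<gamma> / (1 - \<gamma>)) + \<bar>A (real n powr (\<beta> / (1 - \<gamma>)))\<bar>))"
    unfolding r_def[abs_def] T.expectile_target_def \<mu>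
    by (rule BA.expectile_asymptotics[OF T.gamma_neg \<kappa> C(2) tail mean V T.A_null T.A_nz
          M0(1,3) T.A_ratio \<open>\<beta> > 0\<close> c])

  define Z where "Z n \<omega> = (ghat n \<omega>, ahat n \<omega>, order_stat Xs (n - k n) n \<omega>, sample_mean Xs n \<omega>)" for n \<omega>
  have mean_meas[measurable]: "sample_mean Xs n \<in> borel_measurable M" for n
    unfolding sample_mean_def[abs_def] using assms(4) by (intro borel_measurable_divide borel_measurable_sum) auto
  have os_meas[measurable]: "order_stat Xs i n \<in> borel_measurable M" for i n
    by (rule order_stat_measurable) (rule assms(4))
  have [measurable]: "ghat n \<in> borel_measurable M" "ahat n \<in> borel_measurable M" for n by fact+
  have Zm[measurable]: "Z n \<in> borel_measurable M" for n
    unfolding Z_def[abs_def] by (intro borel_measurable_Pair) measurable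
  define N where "N n = distr M borel (Z n)" for n
  \<comment> \<open>The limit law is embedded in dimension four, as the coupling keeps the limit and
    its approximations in one space; a constant 0 fills the place of the sample mean.\<close>
  define e :: "real \<times> real \<times> real \<Rightarrow> real4" where "e = (\<lambda>(g, q, b). (g, q, b, 0))"
  have e_cont: "continuous_on UNIV e" unfolding e_def case_prod_beta by (intro continuous_intros)
  have em: "e \<in> borel_measurable L"
    using borel_measurable_continuous_onI[OF e_cont] measurable_cong_sets[OF \<open>sets L = sets borel\<close> refl] by blast
  define L0 where "L0 = distr L borel e"
  \<comment> \<open>The map forgets the sample mean, which is nevertheless part of
    \<open>N n\<close>; the copies therefore have the joint law of all four statistics.\<close>
  define f :: "nat \<Rightarrow> real4 \<Rightarrow> real4" where
    "f n = (\<lambda>(g, q, b, s). (sqrt (real (k n)) * (g - \<gamma>), sqrt (real (k n)) * (q / a (real n / real (k n)) - 1),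
       sqrt (real (k n)) * ((b - U (real n / real (k n))) / a (real n / real (k n))), 0))" for n
  have f_cont: "continuous_on UNIV (f n)" for n
  proof (cases "a (real n / real (k n)) = 0")
    case True
    then show ?thesis unfolding f_def case_prod_beta by (simp, intro continuous_intros)
  next
    case False
    then show ?thesis unfolding f_def case_prod_beta by (intro continuous_intros) auto
  qed
  have fm: "f n \<in> borel_measurable borel" for n by (rule borel_measurable_continuous_onI[OF f_cont])
  have weak: "(\<lambda>n. \<integral>y. \<phi> (f n y) \<partial>N n) \<longlonglongrightarrow> (\<integral>z. \<phi> z \<partial>L0)"
    if \<phi>: "continuous_on UNIV \<phi>" "bounded (range \<phi>)" for \<phi> :: "real4 \<Rightarrow> real"
  proof -
    have \<phi>m: "\<phi> \<in> borel_measurable borel" by (rule borel_measurable_continuous_onI[OF \<phi>(1)])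
    have "continuous_on UNIV (\<lambda>x. \<phi> (e x))"
      using continuous_on_compose2[OF \<phi>(1) e_cont] by auto
    moreover have "bounded (range (\<lambda>x. \<phi> (e x)))" using \<phi>(2) by (rule bounded_subset) auto
    ultimately have "(\<lambda>n. \<integral>\<omega>. \<phi> (e (sqrt (real (k n)) * (ghat n \<omega> - \<gamma>), sqrt (real (k n)) * (ahat n \<omega> / a (real n / real (k n)) - 1),
                   sqrt (real (k n)) * ((order_stat Xs (n - k n) n \<omega> - U (real n / real (k n))) / a (real n / real (k n))))) \<partial>M) \<longlonglongrightarrow> (\<integral>x. \<phi> (e x) \<partial>L)"
      using assms(21)[unfolded conv_in_distr_def, rule_format, of "\<lambda>x. \<phi> (e x)"] by simp
    moreover have "(\<integral>y. \<phi> (f n y) \<partial>N n) = (\<integral>\<omega>. \<phi> (e (sqrt (real (k n)) * (ghat n \<omega> - \<gamma>), sqrt (real (k n)) * (ahat n \<omega> / a (real n / real (k n)) - 1),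
                   sqrt (real (k n)) * ((order_stat Xs (n - k n) n \<omega> - U (real n / real (k n))) / a (real n / real (k n))))) \<partial>M)" for n
      unfolding N_def by (subst integral_distr[OF Zm measurable_compose[OF fm \<phi>m]]) (simp add: Z_def f_def e_def)
    moreover have "(\<integral>z. \<phi> z \<partial>L0) = (\<integral>x. \<phi> (e x) \<partial>L)"
      unfolding L0_def by (rule integral_distr[OF em \<phi>m])
    ultimately show ?thesis by simp
  qed
  interpret L: prob_space L by fact
  have N_prob: "prob_space (N n)" and N_sets: "sets (N n) = sets borel" for n
    unfolding N_def by (auto intro: M.prob_space_distr Zm)
  have L0_prob: "prob_space L0" and L0_sets: "sets L0 = sets borel"
    unfolding L0_def by (auto intro: L.prob_space_distr em)
  obtain P :: "(nat \<Rightarrow> real4) measure" where P: "prob_space P" "sets P = sets (PiM UNIV (\<lambda>_. borel))"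
    "distr P borel (\<lambda>\<omega>. \<omega> 0) = L0" "\<And>n. distr P borel (\<lambda>\<omega>. \<omega> (Suc n)) = N n"
    "\<And>\<epsilon>. \<epsilon> > 0 \<Longrightarrow> (\<lambda>n. measure P {\<omega> \<in> space P. \<epsilon> < dist (f n (\<omega> (Suc n))) (\<omega> 0)}) \<longlonglongrightarrow> 0"
    by (rule skorokhod_in_probability[OF L0_prob L0_sets N_prob N_sets fm weak]) blast+
  interpret P: prob_space P by fact
  have comp: "(\<lambda>\<omega>. \<omega> i) \<in> borel_measurable P" for i
    using measurable_component_singleton[of i UNIV "\<lambda>_. borel :: real4 measure"] measurable_cong_sets[OF P(2) refl] by blast
  define \<Gamma> \<Lambda> B where "\<Gamma> \<omega> = fst (\<omega> 0)" and "\<Lambda> \<omega> = fst (snd (\<omega> 0))" and "B \<omega> = fst (snd (snd (\<omega> 0)))" for \<omega> :: "nat \<Rightarrow> real4"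
  define g' a' x' m' where "g' n \<omega> = fst (\<omega> (Suc n))" and "a' n \<omega> = fst (snd (\<omega> (Suc n)))"
    and "x' n \<omega> = fst (snd (snd (\<omega> (Suc n))))" and "m' n \<omega> = snd (snd (snd (\<omega> (Suc n))))" for n and \<omega> :: "nat \<Rightarrow> real4"
  have lim_meas[measurable]: "\<Gamma> \<in> borel_measurable P" "\<Lambda> \<in> borel_measurable P" "B \<in> borel_measurable P"
    unfolding \<Gamma>_def[abs_def] \<Lambda>_def[abs_def] B_def[abs_def] using measurable_real4[OF comp] by auto
  have est_meas[measurable]: "g' n \<in> borel_measurable P" "a' n \<in> borel_measurable P" "x' n \<in> borel_measurable P" "m' n \<in> borel_measurable P" for n
    unfolding g'_def[abs_def] a'_def[abs_def] x'_def[abs_def] m'_def[abs_def] using measurable_real4[OF comp] by auto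
  have law: "distr P borel (\<lambda>\<omega>. (\<Gamma> \<omega>, \<Lambda> \<omega>, B \<omega>)) = L"
  proof -
    define \<pi> :: "real4 \<Rightarrow> real \<times> real \<times> real" where "\<pi> = (\<lambda>x. (fst x, fst (snd x), fst (snd (snd x))))"
    have "continuous_on UNIV \<pi>" unfolding \<pi>_def by (intro continuous_intros)
    then have \<pi>m: "\<pi> \<in> borel_measurable borel" by (rule borel_measurable_continuous_onI)
    have "distr P borel (\<lambda>\<omega>. (\<Gamma> \<omega>, \<Lambda> \<omega>, B \<omega>)) = distr (distr P borel (\<lambda>\<omega>. \<omega> 0)) borel \<pi>"
      by (subst distr_distr[OF \<pi>m comp]) (simp add: \<pi>_def o_def \<Gamma>_def \<Lambda>_def B_def)
    also have "\<dots> = distr L borel (\<pi> \<circ> e)" unfolding P(3) L0_def by (rule distr_distr[OF \<pi>m em])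
    also have "\<pi> \<circ> e = (\<lambda>x. x)" by (auto simp: \<pi>_def e_def)
    also have "distr L borel (\<lambda>x. x) = L" by (rule distr_id2) (simp add: \<open>sets L = sets borel\<close>)
    finally show ?thesis .
  qed
  have law': "distr P borel (\<lambda>\<omega>. (g' n \<omega>, a' n \<omega>, x' n \<omega>, m' n \<omega>)) =
         distr M borel (\<lambda>\<omega>. (ghat n \<omega>, ahat n \<omega>, order_stat Xs (n - k n) n \<omega>, sample_mean Xs n \<omega>))" for n
    using P(4)[of n] by (simp add: g'_def a'_def x'_def m'_def N_def Z_def[abs_def])

  define W0 :: "(nat \<Rightarrow> real4) \<Rightarrow> real4" where "W0 \<omega> = (\<Gamma> \<omega>, \<Lambda> \<omega>, B \<omega>, 0)" for \<omega>
  define W :: "nat \<Rightarrow> (nat \<Rightarrow> real4) \<Rightarrow> real4" where "W n \<omega> = (sqrt (real (k n)) * (g' n \<omega> - \<gamma>), sqrt (real (k n)) * (a' n \<omega> / a (real n / real (k n)) - 1),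
       sqrt (real (k n)) * ((x' n \<omega> - U (real n / real (k n))) / a (real n / real (k n))), sqrt (real (k n)) * (m' n \<omega> - \<mu>))" for n \<omega>
  have Wm: "W n \<in> borel_measurable P" for n unfolding W_def[abs_def] by (intro borel_measurable_Pair) measurable
  have W0m: "W0 \<in> borel_measurable P" unfolding W0_def[abs_def] by (intro borel_measurable_Pair) measurable
  \<comment> \<open>Convergence in probability to a constant depends on the laws only, so it
    transfers to the copies of the sample mean.\<close>
  have mean_conv: "(\<lambda>n. P.prob {\<omega> \<in> space P. \<epsilon> < \<bar>sqrt (real (k n)) * (m' n \<omega> - \<mu>)\<bar>}) \<longlonglongrightarrow> 0" if "\<epsilon> > 0" for \<epsilon>
  proof -
    have "P.prob {\<omega> \<in> space P. \<epsilon> < \<bar>sqrt (real (k n)) * (m' n \<omega> - \<mu>)\<bar>}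
        = M.prob {\<omega> \<in> space M. \<epsilon> < \<bar>sqrt (real (k n)) * (sample_mean Xs n \<omega> - \<mu>)\<bar>}" for n
    proof -
      let ?S = "{x :: real4. \<epsilon> < \<bar>sqrt (real (k n)) * (snd (snd (snd x)) - \<mu>)\<bar>}"
      have S: "?S \<in> sets borel" by (intro borel_open open_Collect_less continuous_intros)
      have "P.prob {\<omega> \<in> space P. \<epsilon> < \<bar>sqrt (real (k n)) * (m' n \<omega> - \<mu>)\<bar>} = measure (N n) ?S"
        unfolding P(4)[of n, symmetric] by (subst measure_distr[OF comp S]) (auto simp: m'_def intro!: arg_cong[where f = P.prob])
      also have "\<dots> = M.prob {\<omega> \<in> space M. \<epsilon> < \<bar>sqrt (real (k n)) * (sample_mean Xs n \<omega> - \<mu>)\<bar>}"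
        unfolding N_def by (subst measure_distr[OF Zm S]) (auto simp: Z_def intro!: arg_cong[where f = M.prob])
      finally show ?thesis .
    qed
    then show ?thesis using assms(22) that unfolding small_o_prob_def by simp
  qed
  have conv: "(\<lambda>n. P.prob {\<omega> \<in> space P. \<epsilon> < dist (W n \<omega>) (W0 \<omega>)}) \<longlonglongrightarrow> 0" if \<epsilon>: "\<epsilon> > 0" for \<epsilon>
  proof -
    let ?A = "\<lambda>n. {\<omega> \<in> space P. \<epsilon> / 2 < dist (f n (\<omega> (Suc n))) (\<omega> 0)}"
    let ?B = "\<lambda>n. {\<omega> \<in> space P. \<epsilon> / 2 < \<bar>sqrt (real (k n)) * (m' n \<omega> - \<mu>)\<bar>}"
    have lim: "(\<lambda>n. P.prob (?A n) + P.prob (?B n)) \<longlonglongrightarrow> 0 + 0"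
      using \<epsilon> by (intro tendsto_add P(5) mean_conv) auto
    have fPm: "(\<lambda>\<omega>. f n (\<omega> (Suc n))) \<in> borel_measurable P" for n by (rule measurable_compose[OF comp fm])
    have A: "?A n \<in> P.events" for n
      using borel_measurable_dist[OF fPm comp] by measurable
    have "P.prob {\<omega> \<in> space P. \<epsilon> < dist (W n \<omega>) (W0 \<omega>)} \<le> P.prob (?A n) + P.prob (?B n)" for n
    proof -
      have "{\<omega> \<in> space P. \<epsilon> < dist (W n \<omega>) (W0 \<omega>)} \<subseteq> ?A n \<union> ?B n"
      proof
        fix \<omega> assume \<omega>: "\<omega> \<in> {\<omega> \<in> space P. \<epsilon> < dist (W n \<omega>) (W0 \<omega>)}"
        have "dist (W n \<omega>) (W0 \<omega>) \<le> dist (f n (\<omega> (Suc n))) (\<omega> 0) + \<bar>sqrt (real (k n)) * (m' n \<omega> - \<mu>)\<bar>"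
          using dist_real4_le[of "sqrt (real (k n)) * (g' n \<omega> - \<gamma>)" "sqrt (real (k n)) * (a' n \<omega> / a (real n / real (k n)) - 1)"
              "sqrt (real (k n)) * ((x' n \<omega> - U (real n / real (k n))) / a (real n / real (k n)))" "sqrt (real (k n)) * (m' n \<omega> - \<mu>)"
              "\<Gamma> \<omega>" "\<Lambda> \<omega>" "B \<omega>" "snd (snd (snd (\<omega> 0)))"]
          by (simp only: W_def W0_def f_def \<Gamma>_def \<Lambda>_def B_def g'_def a'_def x'_def case_prod_beta prod.collapse)
        then show "\<omega> \<in> ?A n \<union> ?B n" using \<omega> by auto
      qed
      moreover have B: "?B n \<in> P.events" by measurable
      ultimately have "P.prob {\<omega> \<in> space P. \<epsilon> < dist (W n \<omega>) (W0 \<omega>)} \<le> P.prob (?A n \<union> ?B n)"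
        using A[of n] by (intro P.finite_measure_mono) auto
      also have "\<dots> \<le> P.prob (?A n) + P.prob (?B n)" using A B by (intro measure_Un_le)
      finally show ?thesis .
    qed
    then show ?thesis
      using lim by (intro tendsto_sandwich[OF _ _ tendsto_const lim[unfolded add_0]]) auto
  qed

  \<comment> \<open>Both remainders are defined by solving the expansion for them; the identity is
    then algebra, and only their orders rest on the limit theorems.\<close>
  define R1 where "R1 n \<omega> = \<gamma>\<^sup>2 * (sqrt (real (k n)) / a (real n / real (k n)) * (endpoint_est (g' n \<omega>) (a' n \<omega>) (x' n \<omega>) - T.xs))
     - (\<Gamma> \<omega> + \<gamma>\<^sup>2 * B \<omega> - \<gamma> * \<Lambda> \<omega> - l * \<gamma> / (\<gamma> + \<rho>))" for n \<omega>
  define R2 where "R2 n \<omega> = (T.shortfall_est (real (k n) / (real n * p n)) (g' n \<omega>) (a' n \<omega>) (x' n \<omega>) (m' n \<omega>)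
      - T.expectile_target C \<mu> n) / T.expectile_coef \<mu> n
     - ln (real n * p n powr (1 / (1 - \<gamma>)) / real (k n)) / sqrt (real (k n)) * \<Gamma> \<omega>" for n \<omega>
  have R1m: "R1 n \<in> borel_measurable P" for n
    unfolding R1_def[abs_def] endpoint_est_def by measurable
  have R2m: "R2 n \<in> borel_measurable P" for n
    unfolding R2_def[abs_def] T.shortfall_est_def endpoint_est_def quantile_est_def by measurable
  have a_pos: "\<forall>\<^sub>F n in sequentially. a (real n / real (k n)) > 0"
    using eventually_compose_filterlim[OF eventually_gt_at_top[of 1] T.ratio_top] by eventually_elim (rule T.a_pos)
  have sk: "sqrt (real (k n)) > 0" for n using T.k_pos by simp
  have mean': "\<mu> < T.xs" using mean \<mu> by simp
  have undo: "\<gamma> + sqrt (real (k n)) * (g' n \<omega> - \<gamma>) / sqrt (real (k n)) = g' n \<omega>"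
    "a (real n / real (k n)) * (1 + sqrt (real (k n)) * (a' n \<omega> / a (real n / real (k n)) - 1) / sqrt (real (k n))) = a' n \<omega>"
    "U (real n / real (k n)) + a (real n / real (k n)) * (sqrt (real (k n)) * ((x' n \<omega> - U (real n / real (k n))) / a (real n / real (k n)))) / sqrt (real (k n)) = x' n \<omega>"
    "\<mu> + sqrt (real (k n)) * (m' n \<omega> - \<mu>) / sqrt (real (k n)) = m' n \<omega>" if "a (real n / real (k n)) > 0" for n \<omega>
    using that sk[of n] by (simp_all add: field_simps)
  have small1: "small_o_prob P R1 (\<lambda>_. 1)"
  proof (rule small_o_prob_continuous_mapping[OF P(1) Wm W0m conv T.endpoint_remainder_lim[OF mean'] R1m])
    show "\<forall>\<^sub>F n in sequentially. \<forall>\<omega>\<in>space P. R1 n \<omega> = T.endpoint_remainder n (W n \<omega>) (W0 \<omega>) * 1"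
      using a_pos
    proof eventually_elim
      case (elim n)
      show ?case unfolding R1_def T.endpoint_remainder_def W_def W0_def prod.case undo[OF elim] by simp
    qed
  qed
  have small2: "small_o_prob P R2 (\<lambda>n. ln (real n) / sqrt (real (k n)))"
  proof (rule small_o_prob_continuous_mapping[OF P(1) Wm W0m conv T.expectile_remainder_lim[OF mean' C(1-3)] R2m])
    show "\<forall>\<^sub>F n in sequentially. \<forall>\<omega>\<in>space P. R2 n \<omega> = T.expectile_remainder C \<mu> n (W n \<omega>) (W0 \<omega>) * (ln (real n) / sqrt (real (k n)))"
      using a_pos eventually_gt_at_top[of 1]
    proof eventually_elim
      case (elim n)
      \<comment> \<open>This undoes the normalisation in \<open>expectile_remainder\<close>;
        \<open>n > 1\<close> keeps \<open>ln n\<close> away from 0.\<close>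
      have cancel: "z = sqrt (real (k n)) / ln (real n) * z * (ln (real n) / sqrt (real (k n)))" for z
        using elim(2) sk[of n] by simp
      show ?case
        unfolding R2_def T.expectile_remainder_def W_def W0_def prod.case undo[OF elim(1)] by (intro ballI cancel)
    qed
  qed
  have main: "\<forall>\<^sub>F n in sequentially. \<forall>\<omega>\<in>space P.
       expectile_est (real (k n) / (real n * p n)) (g' n \<omega>) (a' n \<omega>) (x' n \<omega>) (m' n \<omega>)
         - expectile M X (1 - p n) =
       a (real n / real (k n)) / sqrt (real (k n)) * (1 / \<gamma>\<^sup>2) *
         (\<Gamma> \<omega> + \<gamma>\<^sup>2 * B \<omega> - \<gamma> * \<Lambda> \<omega> - l * \<gamma> / (\<gamma> + \<rho>) + R1 n \<omega>)
       - (a (real n / real (k n)) * (real (k n) / (real n * p n)) powr \<gamma>) powr (1 / (1 - \<gamma>)) *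
         ((1 - \<gamma>) powr (- 1 / (1 - \<gamma>)) / (\<gamma> * (xstar - \<mu>) powr (\<gamma> / (1 - \<gamma>)))) *
         (ln (real n * p n powr (1 / (1 - \<gamma>)) / real (k n)) / sqrt (real (k n)) * \<Gamma> \<omega> + R2 n \<omega>)
       + r n"
    using a_pos T.expectile_coef_nz[OF mean']
  proof eventually_elim
    case (elim n)
    show ?case
    proof
      fix \<omega>
      let ?e = "endpoint_est (g' n \<omega>) (a' n \<omega>) (x' n \<omega>)"
      let ?s = "T.shortfall_est (real (k n) / (real n * p n)) (g' n \<omega>) (a' n \<omega>) (x' n \<omega>) (m' n \<omega>)"
      have 1: "a (real n / real (k n)) / sqrt (real (k n)) * (1 / \<gamma>\<^sup>2) *
         (\<Gamma> \<omega> + \<gamma>\<^sup>2 * B \<omega> - \<gamma> * \<Lambda> \<omega> - l * \<gamma> / (\<gamma> + \<rho>) + R1 n \<omega>) = ?e - T.xs"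
      proof -
        have "x + (\<gamma>\<^sup>2 * (sqrt (real (k n)) / a (real n / real (k n)) * d) - x) = \<gamma>\<^sup>2 * (sqrt (real (k n)) / a (real n / real (k n)) * d)" for x d by simp
        moreover have "a (real n / real (k n)) / sqrt (real (k n)) * (1 / \<gamma>\<^sup>2) * (\<gamma>\<^sup>2 * (sqrt (real (k n)) / a (real n / real (k n)) * d)) = d" for d
          using elim(1) sk[of n] T.gamma_neg by simp
        ultimately show ?thesis unfolding R1_def by (simp only:)
      qed
      have 2: "T.expectile_coef \<mu> n * (ln (real n * p n powr (1 / (1 - \<gamma>)) / real (k n)) / sqrt (real (k n)) * \<Gamma> \<omega> + R2 n \<omega>)
          = ?s - T.expectile_target C \<mu> n"
        unfolding R2_def using elim(2) by simp
      show "expectile_est (real (k n) / (real n * p n)) (g' n \<omega>) (a' n \<omega>) (x' n \<omega>) (m' n \<omega>)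
         - expectile M X (1 - p n) =
       a (real n / real (k n)) / sqrt (real (k n)) * (1 / \<gamma>\<^sup>2) *
         (\<Gamma> \<omega> + \<gamma>\<^sup>2 * B \<omega> - \<gamma> * \<Lambda> \<omega> - l * \<gamma> / (\<gamma> + \<rho>) + R1 n \<omega>)
       - (a (real n / real (k n)) * (real (k n) / (real n * p n)) powr \<gamma>) powr (1 / (1 - \<gamma>)) *
         ((1 - \<gamma>) powr (- 1 / (1 - \<gamma>)) / (\<gamma> * (xstar - \<mu>) powr (\<gamma> / (1 - \<gamma>)))) *
         (ln (real n * p n powr (1 / (1 - \<gamma>)) / real (k n)) / sqrt (real (k n)) * \<Gamma> \<omega> + R2 n \<omega>)
       + r n"
        unfolding 1 xstar 2[unfolded T.expectile_coef_def] T.expectile_est_eq r_def by simp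
    qed
  qed
  show ?thesis
  proof (rule exI[of _ P], rule exI[of _ \<Gamma>], rule exI[of _ \<Lambda>], rule exI[of _ B], rule exI[of _ g'], rule exI[of _ a'],
      rule exI[of _ x'], rule exI[of _ m'], rule exI[of _ R1], rule exI[of _ R2], rule exI[of _ r], intro conjI allI)
  qed (rule P(1) lim_meas est_meas law law' small1 small2 r main)+
qed

end
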